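(* Let $S_1\colon H_1\to\mathcal{G}_1$ be a compact linear operator between real Hilbert spaces and let $\lambda=(\lambda_m)_{m\in\mathbb{N}}$ be the sequence of eigenvalues of $W_1=S_1^\dagger S_1$ with respect to a non-increasing ordering (extended by zeros). Assume $\lambda_2>0$, and for every $d>1$ let $\emptyset\ne I_d\subseteq\{1,\dots,d\}$ be fixed ($I_1=\{1\}$). Consider the restriction $S_I=(S_{d,I_d})_{d\in\mathbb{N}}$ of the tensor product problem $S=(S_d\colon H_d\to\mathcal{G}_d)_{d\in\mathbb{N}}$ to the $I_d$-symmetric subspaces $\mathfrak{S}_{I_d}(H_d)\subseteq H_d$, in the worst case setting with respect to the absolute error criterion. Then $S_I$ is strongly polynomially tractable if and only if $\lambda\in\ell_\tau$ for some $\tau\in(0,\infty)$ and - $\lambda_1<1$, or - $1=\lambda_1>\lambda_2$ and $(d-\#I_d)\in\mathcal{O}(1)$, as $d\to\infty$. Moreover, provided that $\lambda_1\le1$, the problem $S_I$ is polynomially tractable if and only if $\lambda\in\ell_\tau$ for some $\tau\in(0,\infty)$ and - $\lambda_1<1$, or - $\lambda_1=1$ and $(d-\#I_d)\in\mathcal{O}(\ln d)$, as $d\to\infty$.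
   Context: $H_d=H_1\otimes\cdots\otimes H_1$ and $\mathcal{G}_d=\mathcal{G}_1\otimes\cdots\otimes\mathcal{G}_1$ are $d$-fold Hilbert space tensor products and $S_d=S_1\otimes\cdots\otimes S_1$. Eigenvalues are counted with multiplicity; if only finitely many are positive, the sequence $\lambda$ is extended by zeros. For $\emptyset\neq I\subseteq\{1,\dots,d\}$ let $\mathcal{S}_I$ be the set of permutations of $\{1,\dots,d\}$ that fix every element outside $I$; for $\pi\in\mathcal{S}_I$ let $U_\pi$ be the unitary operator on $H_d$ determined by $U_\pi(f_1\otimes\cdots\otimes f_d)=f_{\pi(1)}\otimes\cdots\otimes f_{\pi(d)}$. The symmetrizer $\mathfrak{S}_I=\frac1{\#\mathcal{S}_I}\sum_{\pi\in\mathcal{S}_I}U_\pi$ is an orthogonal projection; its range $\mathfrak{S}_I(H_d)$ is the $I$-symmetric subspace, equipped with the inner product of $H_d$. $S_{d,I_d}$ is the restriction of $S_d$ to $\mathfrak{S}_{I_d}(H_d)$. Worst case setting: with $\mathcal{F}_d=\mathfrak{S}_{I_d}(H_d)$, $e(n,d)=\inf_A\sup_{f\in\mathcal{F}_d,\|f\|\le1}\|S_df-Af\mid\mathcal{G}_d\|$, the infimum over linear algorithms $Af=\sum_{j=1}^nL_j(f)g_j$ with continuous linear functionals $L_j$ on $\mathcal{F}_d$ and $g_j\in\mathcal{G}_d$; $n(\varepsilon,d)=\min\{n\in\mathbb{N}_0\mid e(n,d)\le\varepsilon\}$. Polynomial tractability: there are $C,p>0$, $q\ge0$ with $n(\varepsilon,d)\le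 C\varepsilon^{-p}d^q$ for all $\varepsilon\in(0,1]$, $d\in\mathbb{N}$; strong polynomial tractability: this holds with $q=0$. *)

theory Defs
  imports
    "HOL-Analysis.Analysis"
    "HOL-Library.Landau_Symbols"
    "HOL-Combinatorics.Permutations"
begin

section \<open>Compact operators and their singular spectrum\<close>

definition compact_operator :: "('a::real_normed_vector \<Rightarrow> 'b::real_normed_vector) \<Rightarrow> bool" where
  "compact_operator S \<longleftrightarrow> bounded_linear S \<and> compact (closure (S ` cball 0 1))"

text \<open>
  Sequences are indexed by the positive naturals; the value at index 0 is irrelevant.
  The positive eigenvalues of a compact operator \<open>W\<close> have finite multiplicity, and every positive
  number has to occur in the sequence as often as its multiplicity says. Since the sequence is
  non-increasing, the remaining entries (if any) are trailing zeros.
\<close>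

definition eigenvalue_sequence :: "('a::real_vector \<Rightarrow> 'a) \<Rightarrow> (nat \<Rightarrow> real) \<Rightarrow> bool" where
  "eigenvalue_sequence W lam \<longleftrightarrow>
     (\<forall>m\<ge>1. 0 \<le> lam m \<and> lam (Suc m) \<le> lam m) \<and>
     (\<forall>\<mu>>0. finite {m. m \<ge> 1 \<and> lam m = \<mu>} \<and>
            card {m. m \<ge> 1 \<and> lam m = \<mu>} = dim {x. W x = \<mu> *\<^sub>R x})"

definition in_ell :: "real \<Rightarrow> (nat \<Rightarrow> real) \<Rightarrow> bool" where
  "in_ell \<tau> lam \<longleftrightarrow> (\<lambda>m. \<bar>lam m\<bar> powr \<tau>) summable_on {1..}"


section \<open>Tensor powers of a Hilbert space\<close>

text \<open>
  The \<open>d\<close>-fold Hilbert space tensor power of \<open>'h\<close> is determined up to unitary equivalence by a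
  multilinear map \<open>t\<close>, to be read as \<open>f\<^sub>1 \<otimes> \<dots> \<otimes> f\<^sub>d = t f\<close>, such that inner products of elementary
  tensors are products of inner products, and elementary tensors have dense span. Here the tensor
  power is the closed span of the elementary tensors in an ambient Hilbert space \<open>'k\<close>; the ambient
  space allows the tensor powers for all \<open>d\<close> to live in one type. The factors are indexed by
  \<open>{1..d}\<close>, and the inner product formula implies that \<open>t f\<close> depends on \<open>f 1, \<dots>, f d\<close> only.
\<close>

definition tensor_map :: "nat \<Rightarrow> ((nat \<Rightarrow> 'h::real_inner) \<Rightarrow> 'k::real_inner) \<Rightarrow> bool" where
  "tensor_map d t \<longleftrightarrow>
     (\<forall>i\<in>{1..d}. \<forall>f. linear (\<lambda>x. t (f(i := x)))) \<and>
     (\<forall>f g. t f \<bullet> t g = (\<Prod>i=1..d. f i \<bullet> g i))"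

definition tensor_space :: "((nat \<Rightarrow> 'h) \<Rightarrow> 'k::real_normed_vector) \<Rightarrow> 'k set" where
  "tensor_space t = closure (span (range t))"

text \<open>
  The bounded linear operator on \<open>tensor_space t\<close> with prescribed values \<open>u f\<close> on the elementary
  tensors \<open>t f\<close>. Only its values on \<open>tensor_space t\<close> matter; to have a unique object on the whole
  ambient type, it is extended by zero on the orthogonal complement.
\<close>

definition tensor_extension ::
    "((nat \<Rightarrow> 'h) \<Rightarrow> 'k::real_inner) \<Rightarrow> ((nat \<Rightarrow> 'h) \<Rightarrow> 'l::real_normed_vector) \<Rightarrow> 'k \<Rightarrow> 'l" where
  "tensor_extension t u =
     (THE T. bounded_linear T \<and> (\<forall>f. T (t f) = u f) \<and>
             (\<forall>x. (\<forall>f. x \<bullet> t f = 0) \<longrightarrow> T x = 0))"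

definition tensor_power_operator ::
    "((nat \<Rightarrow> 'h) \<Rightarrow> 'k::real_inner) \<Rightarrow> ((nat \<Rightarrow> 'g) \<Rightarrow> 'l::real_normed_vector) \<Rightarrow> ('h \<Rightarrow> 'g) \<Rightarrow> 'k \<Rightarrow> 'l" where
  "tensor_power_operator t t' S = tensor_extension t (\<lambda>f. t' (\<lambda>i. S (f i)))"

definition perm_operator :: "((nat \<Rightarrow> 'h) \<Rightarrow> 'k::real_inner) \<Rightarrow> (nat \<Rightarrow> nat) \<Rightarrow> 'k \<Rightarrow> 'k" where
  "perm_operator t \<pi> = tensor_extension t (\<lambda>f. t (\<lambda>i. f (\<pi> i)))"

definition symmetrizer :: "((nat \<Rightarrow> 'h) \<Rightarrow> 'k::real_inner) \<Rightarrow> nat set \<Rightarrow> 'k \<Rightarrow> 'k" where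
  "symmetrizer t I x =
     (1 / real (card {\<pi>. \<pi> permutes I})) *\<^sub>R (\<Sum>\<pi> | \<pi> permutes I. perm_operator t \<pi> x)"

definition symmetric_subspace :: "((nat \<Rightarrow> 'h) \<Rightarrow> 'k::real_inner) \<Rightarrow> nat set \<Rightarrow> 'k set" where
  "symmetric_subspace t I = symmetrizer t I ` tensor_space t"


section \<open>Worst case errors and tractability\<close>

definition continuous_linear_functional_on :: "'k::real_normed_vector set \<Rightarrow> ('k \<Rightarrow> real) \<Rightarrow> bool" where
  "continuous_linear_functional_on F L \<longleftrightarrow>
     (\<forall>x\<in>F. \<forall>y\<in>F. L (x + y) = L x + L y) \<and>
     (\<forall>c. \<forall>x\<in>F. L (c *\<^sub>R x) = c * L x) \<and>
     continuous_on F L"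

definition linear_algorithms ::
    "'k::real_normed_vector set \<Rightarrow> 'l::real_normed_vector set \<Rightarrow> nat \<Rightarrow> ('k \<Rightarrow> 'l) set" where
  "linear_algorithms F G n =
     {A. \<exists>L g. (\<forall>j\<in>{1..n}. continuous_linear_functional_on F (L j) \<and> g j \<in> G) \<and>
               A = (\<lambda>f. \<Sum>j=1..n. L j f *\<^sub>R g j)}"

definition worst_case_error ::
    "'k::real_normed_vector set \<Rightarrow> ('k \<Rightarrow> 'l::real_normed_vector) \<Rightarrow> ('k \<Rightarrow> 'l) \<Rightarrow> real" where
  "worst_case_error F T A = (SUP f\<in>{f\<in>F. norm f \<le> 1}. norm (T f - A f))"

definition minimal_error ::
    "'k::real_normed_vector set \<Rightarrow> 'l::real_normed_vector set \<Rightarrow> ('k \<Rightarrow> 'l) \<Rightarrow> nat \<Rightarrow> real" where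
  "minimal_error F G T n = (INF A\<in>linear_algorithms F G n. worst_case_error F T A)"

text \<open>For compact \<open>T\<close> the minimal errors tend to zero, so the minimum below exists for \<open>\<epsilon> > 0\<close>.\<close>

definition information_complexity ::
    "'k::real_normed_vector set \<Rightarrow> 'l::real_normed_vector set \<Rightarrow> ('k \<Rightarrow> 'l) \<Rightarrow> real \<Rightarrow> nat" where
  "information_complexity F G T \<epsilon> = (LEAST n. minimal_error F G T n \<le> \<epsilon>)"

definition polynomial_bound :: "(real \<Rightarrow> nat \<Rightarrow> nat) \<Rightarrow> real \<Rightarrow> real \<Rightarrow> real \<Rightarrow> bool" where
  "polynomial_bound n C p q \<longleftrightarrow>
     (\<forall>\<epsilon>\<in>{0<..1}. \<forall>d\<ge>1. real (n \<epsilon> d) \<le> C * \<epsilon> powr (- p) * real d powr q)"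

definition polynomially_tractable :: "(real \<Rightarrow> nat \<Rightarrow> nat) \<Rightarrow> bool" where
  "polynomially_tractable n \<longleftrightarrow> (\<exists>C>0. \<exists>p>0. \<exists>q\<ge>0. polynomial_bound n C p q)"

definition strongly_polynomially_tractable :: "(real \<Rightarrow> nat \<Rightarrow> nat) \<Rightarrow> bool" where
  "strongly_polynomially_tractable n \<longleftrightarrow> (\<exists>C>0. \<exists>p>0. polynomial_bound n C p 0)"

definition symmetric_problem_complexity ::
    "(nat \<Rightarrow> (nat \<Rightarrow> 'h) \<Rightarrow> 'k::real_inner) \<Rightarrow> (nat \<Rightarrow> (nat \<Rightarrow> 'g) \<Rightarrow> 'l::real_normed_vector) \<Rightarrow>
     ('h \<Rightarrow> 'g) \<Rightarrow> (nat \<Rightarrow> nat set) \<Rightarrow> real \<Rightarrow> nat \<Rightarrow> nat" where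
  "symmetric_problem_complexity tH tG S I \<epsilon> d =
     information_complexity (symmetric_subspace (tH d) (I d)) (tensor_space (tG d))
       (tensor_power_operator (tH d) (tG d) S) \<epsilon>"

end

theory Submission
  imports Defs
begin

text \<open>
  The squared singular values of the restricted problem are the products of the \<open>lam (j i)\<close>, where \<open>j\<close>
  runs through the multi-indices modulo permutations of the coordinates in \<open>I d\<close>; hence the information
  complexity for \<open>\<epsilon>\<close> is the number of such orbits whose product exceeds \<open>\<epsilon>\<^sup>2\<close>.

  For the upper bound choose \<open>\<tau>\<close> so large that the \<open>lam m powr \<tau>\<close> with \<open>lam m < 1\<close> sum up to at most
  \<open>1/2\<close>. With \<open>M\<close> the multiplicity of the eigenvalue \<open>1\<close>, summing products of \<open>\<tau>\<close>-th powers over all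
  orbits contributes \<open>(M + 1/2) ^ (d - card (I d))\<close> from the coordinates outside \<open>I d\<close> and at most
  \<open>2 * (card (I d) + 1) ^ (M - 1)\<close> from the multisets that describe the coordinates in \<open>I d\<close>.

  For necessity, \<open>d = 1\<close> gives the decay of \<open>lam\<close>. If \<open>lam 1 = 1\<close>, placing \<open>k\<close> entries \<open>2\<close> outside \<open>I d\<close>
  yields \<open>(d - card (I d)) choose k\<close> orbits with product \<open>lam 2 ^ k\<close>, and summing over \<open>k\<close> with geometric
  weights makes \<open>d - card (I d)\<close> at most logarithmic in the complexity bound. If \<open>lam 1 > 1\<close> or
  \<open>lam 1 = lam 2 = 1\<close>, the multi-indices with \<open>k \<le> N\<close> entries \<open>2\<close> alone already exceed every bound
  that is independent of \<open>d\<close>.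
\<close>

section \<open>Hilbert space preliminaries\<close>

text \<open>The tensor power operator is given by a definite description, so its existence has to
  precede every error estimate. A bound on single elementary tensors does not suffice, because
  linear combinations of them may cancel. The bound on the span comes from eigenvectors: the
  truncated expansions along the products of the \<open>e (j i)\<close> satisfy Bessel's inequality
  with a constant independent of the truncation, and they converge on every elementary tensor. The
  same expansion gives the upper error bound. The Hilbert spaces need not be separable and
  \<open>S\<close> may have a kernel, so the eigenvectors are never completed to a basis; an
  estimate of \<open>S\<close> on the complement of the first \<open>N\<close> eigenvectors takes
  the place of completeness. The threshold 1/2 for the tail sum serves twice. The base
  \<open>M + 1/2\<close> is below 1 when no eigenvalue equals 1, so \<open>lam 1 < 1\<close> imposes
  no condition on \<open>I d\<close>; and the product of the \<open>1 - lam m powr \<tau>\<close>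
  over the tail stays at least 1/2, whence the constant 2.\<close>

lemma subspace_closure:
  fixes M :: "'a::real_normed_vector set"
  assumes M: "subspace M"
  shows "subspace (closure M)"
proof (rule subspaceI)
  show "0 \<in> closure M" using subspace_0[OF M] closure_subset by blast
next
  fix x y assume x: "x \<in> closure M" and y: "y \<in> closure M"
  from x obtain X where X: "\<And>n. X n \<in> M" "X \<longlonglongrightarrow> x"
    unfolding closure_sequential by blast
  from y obtain Y where Y: "\<And>n. Y n \<in> M" "Y \<longlonglongrightarrow> y"
    unfolding closure_sequential by blast
  from X Y show "x + y \<in> closure M" unfolding closure_sequential
    by (intro exI[of _ "\<lambda>n. X n + Y n"]) (auto intro: tendsto_add subspace_add[OF M])
next
  fix c :: real and x assume "x \<in> closure M"
  then obtain X where X: "\<And>n. X n \<in> M" "X \<longlonglongrightarrow> x" unfolding closure_sequential by blast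
  then show "c *\<^sub>R x \<in> closure M" unfolding closure_sequential
    by (intro exI[of _ "\<lambda>n. c *\<^sub>R X n"]) (auto intro: tendsto_scaleR subspace_scale[OF M])
qed

text \<open>A minimising sequence for the squared distance \<open>q\<close> is Cauchy by the
  parallelogram law, and its limit attains the minimum within the closed \<open>M\<close>.
  Orthogonality is the first-order condition there: moving along \<open>y\<close> cannot decrease
  \<open>q\<close>.\<close>

lemma orthogonal_projection_exists:
  fixes M :: "'a::{real_inner, complete_space} set"
  assumes M: "subspace M" and cl: "closed M"
  obtains p where "p \<in> M" "\<And>y. y \<in> M \<Longrightarrow> (x - p) \<bullet> y = 0"
proof -
  define q where "q y = (norm (x - y))\<^sup>2" for y
  define D where "D = Inf (q ` M)"
  have ne: "q ` M \<noteq> {}" using subspace_0[OF M] by auto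
  have bdd: "bdd_below (q ` M)" by (rule bdd_belowI[of _ 0]) (auto simp: q_def)
  have D: "D \<le> q y" if "y \<in> M" for y
    unfolding D_def by (rule cInf_lower) (use that bdd in auto)
  have "\<exists>y\<in>M. q y < D + 1 / real (Suc n)" for n
  proof -
    have "Inf (q ` M) < D + 1 / real (Suc n)" by (simp add: D_def)
    then show ?thesis using cInf_less_iff[OF ne bdd] by auto
  qed
  then obtain Y where Y: "\<And>n. Y n \<in> M" "\<And>n. q (Y n) < D + 1 / real (Suc n)" by metis
  have par: "(norm (Y m - Y n))\<^sup>2 \<le> 2 / real (Suc m) + 2 / real (Suc n)" for m n
  proof -
    have mid: "(1/2) *\<^sub>R (Y m + Y n) \<in> M" using M Y(1) by (intro subspace_scale subspace_add)
    have "(norm (Y m - Y n))\<^sup>2 = 2 * q (Y m) + 2 * q (Y n) - 4 * q ((1/2) *\<^sub>R (Y m + Y n))"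
      unfolding q_def power2_norm_eq_inner by (simp add: inner_diff inner_add inner_commute algebra_simps)
    with D[OF mid] Y(2)[of m] Y(2)[of n] show ?thesis by simp
  qed
  have "Cauchy Y"
  proof (rule metric_CauchyI)
    fix e :: real assume "e > 0"
    then obtain N where N: "1 / real (Suc N) < e\<^sup>2 / 4" using nat_approx_posE[of "e\<^sup>2/4"] by auto
    have "dist (Y m) (Y n) < e" if "m \<ge> N" "n \<ge> N" for m n
    proof -
      have "1 / real (Suc m) \<le> 1 / real (Suc N)" "1 / real (Suc n) \<le> 1 / real (Suc N)"
        using that by (auto simp: field_simps)
      with par[of m n] N have "(norm (Y m - Y n))\<^sup>2 < e\<^sup>2" by simp
      then show ?thesis using \<open>e > 0\<close> by (simp add: dist_norm power2_less_imp_less)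
    qed
    then show "\<exists>M. \<forall>m\<ge>M. \<forall>n\<ge>M. dist (Y m) (Y n) < e" by blast
  qed
  then obtain p where p: "Y \<longlonglongrightarrow> p" using Cauchy_convergent_iff convergent_def by blast
  have pM: "p \<in> M" using closed_sequentially[OF cl Y(1) p] .
  have "q p \<le> D"
  proof (rule LIMSEQ_le)
    show "(\<lambda>n. q (Y n)) \<longlonglongrightarrow> q p" unfolding q_def by (intro tendsto_intros p)
    have "(\<lambda>n. D + 1 / real (Suc n)) \<longlonglongrightarrow> D + 0"
      by (intro tendsto_intros LIMSEQ_Suc[OF lim_1_over_n])
    then show "(\<lambda>n. D + 1 / real (Suc n)) \<longlonglongrightarrow> D" by simp
    show "\<exists>N. \<forall>n\<ge>N. q (Y n) \<le> D + 1 / real (Suc n)" using Y(2) less_imp_le by blast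
  qed
  have "(x - p) \<bullet> y = 0" if y: "y \<in> M" for y
  proof (cases "y = 0")
    case False
    \<comment> \<open>The minimiser of \<open>q (p + s *\<^sub>R y)\<close> as a quadratic
      polynomial in \<open>s\<close>; it lowers \<open>q p\<close> by exactly the term that is
      thereby forced to vanish.\<close>
    define s where "s = ((x - p) \<bullet> y) / (y \<bullet> y)"
    have "p + s *\<^sub>R y \<in> M" using M pM y by (intro subspace_scale subspace_add)
    then have "q p \<le> q (p + s *\<^sub>R y)" using D \<open>q p \<le> D\<close> by force
    also have "q (p + s *\<^sub>R y) = q p - 2 * s * ((x - p) \<bullet> y) + s\<^sup>2 * (y \<bullet> y)"
      unfolding q_def power2_norm_eq_inner
      by (simp add: inner_diff inner_add inner_commute power2_eq_square algebra_simps)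
    also have "\<dots> = q p - ((x - p) \<bullet> y)\<^sup>2 / (y \<bullet> y)"
      using False by (simp add: s_def power2_eq_square field_simps)
    finally have "((x - p) \<bullet> y)\<^sup>2 / (y \<bullet> y) \<le> 0" by simp
    moreover have "y \<bullet> y > 0" using False by simp
    ultimately have "((x - p) \<bullet> y)\<^sup>2 \<le> 0" by (simp add: divide_le_0_iff)
    then show ?thesis by simp
  qed simp
  with pM that show thesis by blast
qed

text \<open>The representing vector is a multiple of a normal \<open>w\<close> to the kernel; its
  length is fixed by splitting \<open>x\<close> into a multiple of \<open>w\<close> and a vector of
  the kernel.\<close>

lemma Riesz_representation:
  fixes f :: "'a::{real_inner, complete_space} \<Rightarrow> real"
  assumes f: "bounded_linear f"
  obtains z where "\<And>x. f x = x \<bullet> z"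
proof (cases "\<forall>x. f x = 0")
  case True
  then show ?thesis using that[of 0] by simp
next
  case False
  interpret bounded_linear f by fact
  define M where "M = {x. f x = 0}"
  have "subspace M" unfolding subspace_def M_def by (auto simp: zero add scale)
  moreover have "closed M" unfolding M_def
    by (intro closed_Collect_eq continuous_intros linear_continuous_on f)
  moreover obtain x0 where x0: "f x0 \<noteq> 0" using False by blast
  ultimately obtain p where p: "p \<in> M" "\<And>y. y \<in> M \<Longrightarrow> (x0 - p) \<bullet> y = 0"
    using orthogonal_projection_exists[of M x0] by metis
  define w where "w = x0 - p"
  have fw: "f w = f x0" using p(1) by (simp add: w_def diff M_def)
  then have w0: "w \<bullet> w \<noteq> 0" using x0 zero by auto
  have "f x = x \<bullet> ((f w / (w \<bullet> w)) *\<^sub>R w)" for x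
  proof -
    have "f (x - (f x / f w) *\<^sub>R w) = 0" using x0 fw by (simp add: diff scale)
    then have "w \<bullet> (x - (f x / f w) *\<^sub>R w) = 0" using p(2) by (simp add: M_def w_def)
    then have "w \<bullet> x = (f x / f w) * (w \<bullet> w)" by (simp add: inner_diff)
    then show ?thesis using w0 x0 fw by (simp add: inner_commute field_simps)
  qed
  then show ?thesis using that by blast
qed

text \<open>\<open>adjoint\<close> is a Hilbert choice, so the identity holds only once some map is
  known to satisfy it; the Riesz representation of \<open>\<lambda>x. S x \<bullet> y\<close> for
  each \<open>y\<close> supplies one.\<close>

lemma adjoint_works_complete:
  fixes S :: "'a::{real_inner, complete_space} \<Rightarrow> 'b::real_inner"
  assumes S: "bounded_linear S"
  shows "S x \<bullet> y = x \<bullet> adjoint S y"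
proof -
  have "\<exists>z. \<forall>x. S x \<bullet> y = x \<bullet> z" for y
    using Riesz_representation[of "\<lambda>x. S x \<bullet> y"] bounded_linear_inner_left_comp[OF S] by metis
  then have "\<exists>f'. \<forall>x y. S x \<bullet> y = x \<bullet> f' y" by metis
  from someI_ex[OF this] show ?thesis unfolding adjoint_def by blast
qed

section \<open>Operators prescribed on a spanning family\<close>

lemma subspace_closure_complement:
  fixes M :: "'a::{real_inner, complete_space} set"
  obtains p where "p \<in> closure (span M)" "\<And>y. y \<in> closure (span M) \<Longrightarrow> (x - p) \<bullet> y = 0"
  using orthogonal_projection_exists[OF subspace_closure[OF subspace_span] closed_closure] by blast

text \<open>The uniqueness half of the description in \<open>tensor_extension\<close>. Agreement
  spreads from the \<open>t a\<close> to their closed span by linearity and continuity, and the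
  projection splits every vector into a part there and a part orthogonal to all
  \<open>t a\<close>.\<close>

lemma bounded_linear_closure_span_unique:
  fixes T T' :: "'a::{real_inner, complete_space} \<Rightarrow> 'b::real_normed_vector"
  assumes T: "bounded_linear T" "bounded_linear T'"
    and eq: "\<And>a. T (t a) = T' (t a)"
    and perp: "\<And>x. (\<And>a. x \<bullet> t a = 0) \<Longrightarrow> T x = T' x"
  shows "T x = T' x"
proof -
  interpret D: bounded_linear "\<lambda>x. T x - T' x" using T by (rule bounded_linear_sub)
  have "T y - T' y = 0" if "y \<in> closure (span (range t))" for y
  proof -
    have "closure (span (range t)) \<subseteq> {y. T y - T' y = 0}"
    proof (rule closure_minimal)
      show "span (range t) \<subseteq> {y. T y - T' y = 0}"
        by (rule span_minimal) (use eq in \<open>auto simp: subspace_def D.zero D.add D.scaleR simp del: diff_eq_eq right_minus_eq\<close>)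
      show "closed {y. T y - T' y = 0}"
        by (intro closed_Collect_eq continuous_intros linear_continuous_on T)
    qed
    with that show ?thesis by blast
  qed
  moreover obtain p where p: "p \<in> closure (span (range t))"
      "\<And>y. y \<in> closure (span (range t)) \<Longrightarrow> (x - p) \<bullet> y = 0"
    using subspace_closure_complement[where M = "range t"] by blast
  ultimately have "T p = T' p" by simp
  moreover have "T (x - p) = T' (x - p)"
    by (rule perp) (meson closure_subset p(2) rangeI span_base subsetD)
  ultimately show ?thesis by (simp add: bounded_linear.linear[OF T(1)] bounded_linear.linear[OF T(2)] linear_diff)
qed

text \<open>The operator is read off from the closure of the linear span of its prescribed graph.\<close>

lemma bounded_linear_closure_span_exists:
  fixes t :: "'i \<Rightarrow> 'a::{real_inner, complete_space}" and u :: "'i \<Rightarrow> 'b::{real_normed_vector, complete_space}"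
  assumes bnd: "\<And>x y. (x, y) \<in> span (range (\<lambda>a. (t a, u a))) \<Longrightarrow> norm y \<le> C * norm x"
  shows "\<exists>T. bounded_linear T \<and> (\<forall>a. T (t a) = u a) \<and> (\<forall>x. (\<forall>a. x \<bullet> t a = 0) \<longrightarrow> T x = 0)"
proof -
  define G where "G = closure (span (range (\<lambda>a. (t a, u a))))"
  have G: "subspace G" unfolding G_def by (intro subspace_closure subspace_span)
  have bG: "norm y \<le> C * norm x" if "(x, y) \<in> G" for x y
  proof -
    have "G \<subseteq> {z. norm (snd z) \<le> C * norm (fst z)}" unfolding G_def
    proof (rule closure_minimal)
      show "span (range (\<lambda>a. (t a, u a))) \<subseteq> {z. norm (snd z) \<le> C * norm (fst z)}"
        using bnd by (metis (mono_tags, lifting) mem_Collect_eq prod.collapse subsetI)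
    qed (intro closed_Collect_le continuous_intros)
    with that show ?thesis by auto
  qed
  \<comment> \<open>At \<open>x = 0\<close> the bound forces \<open>y = 0\<close>, so the closed
    subspace \<open>G\<close> is the graph of a function.\<close>
  have uniq: "y = y'" if "(x, y) \<in> G" "(x, y') \<in> G" for x y y'
  proof -
    have "(0, y - y') \<in> G" using subspace_diff[OF G that] by simp
    from bG[OF this] show ?thesis by simp
  qed
  define M where "M = closure (span (range t))"
  have dom: "\<exists>y. (x, y) \<in> G" if "x \<in> M" for x
  proof -
    have sp: "\<exists>y. (x, y) \<in> span (range (\<lambda>a. (t a, u a)))" if "x \<in> span (range t)" for x
    proof -
      have "fst ` range (\<lambda>a. (t a, u a)) = range t" by (simp add: image_image)
      with span_linear_image[OF bounded_linear.linear[OF bounded_linear_fst], of "range (\<lambda>a. (t a, u a))"]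
      have "span (range t) = fst ` span (range (\<lambda>a. (t a, u a)))" by (simp only:)
      with that obtain z where "z \<in> span (range (\<lambda>a. (t a, u a)))" "x = fst z" by blast
      then show ?thesis by (intro exI[of _ "snd z"]) simp
    qed
    from \<open>x \<in> M\<close> obtain X where X: "\<And>n. X n \<in> span (range t)" "X \<longlonglongrightarrow> x"
      unfolding M_def closure_sequential by blast
    have "\<forall>n. \<exists>y. (X n, y) \<in> span (range (\<lambda>a. (t a, u a)))" using sp X(1) by blast
    from choice[OF this] obtain Y where Y: "\<And>n. (X n, Y n) \<in> span (range (\<lambda>a. (t a, u a)))" by blast
    have "Cauchy Y"
    proof (rule metric_CauchyI)
      fix e :: real assume e: "e > 0"
      have "Cauchy X" using X(2) by (rule LIMSEQ_imp_Cauchy)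
      \<comment> \<open>\<open>\<bar>C\<bar> + 1\<close> is a positive divisor whatever the sign of
        \<open>C\<close>.\<close>
      moreover have "e / (\<bar>C\<bar> + 1) > 0" using e by simp
      ultimately obtain N where N: "\<And>m n. m \<ge> N \<Longrightarrow> n \<ge> N \<Longrightarrow> dist (X m) (X n) < e / (\<bar>C\<bar> + 1)"
        unfolding Cauchy_def by blast
      have "dist (Y m) (Y n) < e" if "m \<ge> N" "n \<ge> N" for m n
      proof -
        have "(X m - X n, Y m - Y n) \<in> span (range (\<lambda>a. (t a, u a)))"
          using span_diff[OF Y[of m] Y[of n]] by simp
        then have "norm (Y m - Y n) \<le> C * norm (X m - X n)" by (rule bnd)
        also have "\<dots> \<le> (\<bar>C\<bar> + 1) * norm (X m - X n)" by (intro mult_right_mono) auto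
        also have "\<dots> < (\<bar>C\<bar> + 1) * (e / (\<bar>C\<bar> + 1))"
          by (rule mult_strict_left_mono) (use N[OF that] in \<open>auto simp: dist_norm\<close>)
        finally show ?thesis by (simp add: dist_norm)
      qed
      then show "\<exists>M. \<forall>m\<ge>M. \<forall>n\<ge>M. dist (Y m) (Y n) < e" by blast
    qed
    then obtain y where "Y \<longlonglongrightarrow> y" using Cauchy_convergent_iff convergent_def by blast
    then have "(\<lambda>n. (X n, Y n)) \<longlonglongrightarrow> (x, y)" by (intro tendsto_Pair X)
    then have "(x, y) \<in> G" unfolding G_def closure_sequential using Y by (intro exI[of _ "\<lambda>n. (X n, Y n)"]) auto
    then show ?thesis ..
  qed
  have Ms: "subspace M" unfolding M_def by (intro subspace_closure subspace_span)
  have "\<forall>x. \<exists>p. p \<in> M \<and> (\<forall>y\<in>M. p \<bullet> y = x \<bullet> y)"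
  proof
    fix x
    obtain p where "p \<in> M" "\<And>y. y \<in> M \<Longrightarrow> (x - p) \<bullet> y = 0"
      using subspace_closure_complement[where M = "range t"] unfolding M_def by blast
    then show "\<exists>p. p \<in> M \<and> (\<forall>y\<in>M. p \<bullet> y = x \<bullet> y)" by (intro exI[of _ p]) (auto simp: inner_diff_left)
  qed
  from choice[OF this] obtain P where P: "\<And>x. P x \<in> M" "\<And>x y. y \<in> M \<Longrightarrow> P x \<bullet> y = x \<bullet> y"
    by blast
  have Pu: "P x = p" if "p \<in> M" "\<And>y. y \<in> M \<Longrightarrow> p \<bullet> y = x \<bullet> y" for x p
  proof -
    have "P x - p \<in> M" using Ms P(1) that(1) by (rule subspace_diff)
    then have "(P x - p) \<bullet> (P x - p) = 0"
      using P(2)[of "P x - p" x] that(2)[of "P x - p"] by (simp add: inner_diff_left)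
    then show ?thesis by simp
  qed
  \<comment> \<open>The function with graph \<open>G\<close> lives on \<open>M\<close> only;
    composing it with the projection \<open>P\<close> onto \<open>M\<close> extends it by zero on
    the orthogonal complement.\<close>
  have "\<forall>x. \<exists>y. (P x, y) \<in> G" using dom P(1) by blast
  from choice[OF this] obtain T where T: "\<And>x. (P x, T x) \<in> G" by blast
  have Padd: "P (x + y) = P x + P y" for x y
    by (rule Pu) (use P Ms in \<open>auto simp: subspace_add inner_add_left\<close>)
  have Psc: "P (c *\<^sub>R x) = c *\<^sub>R P x" for c x
    by (rule Pu) (use P Ms in \<open>auto simp: subspace_scale\<close>)
  have Pn: "norm (P x) \<le> norm x" for x
  proof -
    have "P x \<bullet> P x = x \<bullet> P x" using P(2)[OF P(1), of x x] .
    also have "\<dots> \<le> norm x * norm (P x)" by (rule norm_cauchy_schwarz)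
    finally have "norm (P x) * norm (P x) \<le> norm x * norm (P x)" by (simp add: norm_eq_sqrt_inner)
    then show ?thesis by (metis mult_right_le_imp_le norm_ge_zero norm_zero order_le_less)
  qed
  have "bounded_linear T"
  proof (rule bounded_linear_intro[where K = "\<bar>C\<bar>"])
    show "T (x + y) = T x + T y" for x y
      by (rule uniq[OF T]) (use subspace_add[OF G T[of x] T[of y]] Padd in simp)
    show "T (c *\<^sub>R x) = c *\<^sub>R T x" for c x
      by (rule uniq[OF T]) (use subspace_scale[OF G T[of x]] Psc in simp)
    show "norm (T x) \<le> norm x * \<bar>C\<bar>" for x
    proof -
      have "norm (T x) \<le> C * norm (P x)" using bG[OF T] .
      also have "\<dots> \<le> \<bar>C\<bar> * norm x" by (intro mult_mono) (use Pn in auto)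
      finally show ?thesis by (simp add: mult.commute)
    qed
  qed
  moreover have "T (t a) = u a" for a
  proof -
    have "t a \<in> M" unfolding M_def by (meson closure_subset rangeI span_base subsetD)
    then have "P (t a) = t a" by (intro Pu) auto
    moreover have "(t a, u a) \<in> G" unfolding G_def by (meson closure_subset rangeI span_base subsetD)
    ultimately show ?thesis using uniq T[of "t a"] by simp
  qed
  moreover have "T x = 0" if "\<And>a. x \<bullet> t a = 0" for x
  proof -
    have "M \<subseteq> {y. x \<bullet> y = 0}" unfolding M_def
    proof (rule closure_minimal)
      show "span (range t) \<subseteq> {y. x \<bullet> y = 0}"
        by (rule span_minimal) (use that in \<open>auto simp: subspace_def inner_add_right\<close>)
    qed (intro closed_Collect_eq continuous_intros)
    then have "P x = 0" by (intro Pu) (use subspace_0[OF Ms] in auto)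
    then show ?thesis using bG[OF T, of x] by simp
  qed
  ultimately show ?thesis by blast
qed

section \<open>Spectral decomposition of compact operators\<close>

text \<open>Finitely many balls of radius \<open>c/2\<close> cover the image of the unit ball, and
  no ball contains two of the \<open>S x\<close>: being orthogonal of length at least
  \<open>c\<close>, they are more than \<open>c\<close> apart. This bounds both the dimension of an
  eigenspace and the number of indices with large eigenvalue.\<close>

lemma compact_operator_orthogonal_bound:
  fixes S :: "'a::real_normed_vector \<Rightarrow> 'b::real_inner"
  assumes S: "compact_operator S" and c: "c > 0"
  shows "\<exists>k. \<forall>B. finite B \<longrightarrow> (\<forall>x\<in>B. norm x = 1 \<and> c \<le> norm (S x)) \<longrightarrow>
      (\<forall>x\<in>B. \<forall>y\<in>B. x \<noteq> y \<longrightarrow> S x \<bullet> S y = 0) \<longrightarrow> card B \<le> k"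
proof -
  have "compact (closure (S ` cball 0 1))" using S by (simp add: compact_operator_def)
  then obtain K where K: "finite K" "closure (S ` cball 0 1) \<subseteq> (\<Union>x\<in>K. ball x (c/2))"
    unfolding compact_eq_totally_bounded using c half_gt_zero by metis
  show ?thesis
  proof (intro exI allI impI)
    fix B assume "finite B" "\<forall>x\<in>B. norm x = 1 \<and> c \<le> norm (S x)"
      "\<forall>x\<in>B. \<forall>y\<in>B. x \<noteq> y \<longrightarrow> S x \<bullet> S y = 0"
    then have B: "finite B" "\<And>x. x \<in> B \<Longrightarrow> norm x = 1 \<and> c \<le> norm (S x)"
      "\<And>x y. x \<in> B \<Longrightarrow> y \<in> B \<Longrightarrow> x \<noteq> y \<Longrightarrow> S x \<bullet> S y = 0" by blast+
    have "\<exists>y\<in>K. dist y (S x) < c/2" if "x \<in> B" for x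
    proof -
      have "S x \<in> closure (S ` cball 0 1)" using B(2)[OF that] closure_subset by fastforce
      with K(2) have "S x \<in> (\<Union>y\<in>K. ball y (c/2))" by blast
      then show ?thesis by (simp only: UN_iff mem_ball)
    qed
    then obtain f where f: "\<And>x. x \<in> B \<Longrightarrow> f x \<in> K \<and> dist (f x) (S x) < c/2" by metis
    have "inj_on f B"
    proof (rule inj_onI, rule ccontr)
      fix x y assume xy: "x \<in> B" "y \<in> B" "f x = f y" "x \<noteq> y"
      have "dist (S x) (S y) < c"
        using f[OF xy(1)] f[OF xy(2)] xy(3) dist_triangle_half_r[of "f x" "S x" c "S y"] by simp
      then have "(norm (S x - S y))\<^sup>2 < c\<^sup>2" using c by (simp add: dist_norm power_strict_mono)
      moreover have "(norm (S x - S y))\<^sup>2 = (norm (S x))\<^sup>2 + (norm (S y))\<^sup>2"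
        using B(3)[OF xy(1,2,4)] by (simp add: power2_norm_eq_inner inner_diff inner_commute)
      moreover have "c\<^sup>2 \<le> (norm (S x))\<^sup>2" using B(2)[OF xy(1)] c by (simp add: power_mono)
      ultimately show False by (smt (verit) zero_le_power2)
    qed
    then show "card B \<le> card K" by (rule card_inj_on_le) (use f K in auto)
  qed
qed

text \<open>The orthogonal set from \<open>basis_orthogonal\<close> may contain 0, and its
  cardinality is only bounded from above. With 0 deleted it still spans, so independence of
  \<open>B\<close> gives the reverse inequality; normalising preserves span and size.\<close>

lemma orthonormal_basis_of_independent:
  fixes B :: "'a::real_inner set"
  assumes B: "finite B" "independent B"
  obtains C where "finite C" "card C = card B" "span C = span B" "\<And>x. x \<in> C \<Longrightarrow> norm x = 1"
    "\<And>x y. x \<in> C \<Longrightarrow> y \<in> C \<Longrightarrow> x \<noteq> y \<Longrightarrow> x \<bullet> y = 0"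
proof -
  obtain D where D: "finite D" "card D \<le> card B" "span D = span B" "pairwise orthogonal D"
    using basis_orthogonal[OF B(1)] by blast
  define D' where "D' = D - {0}"
  have D'f: "finite D'" and spD': "span D' = span B" using D by (auto simp: D'_def span_delete_0)
  have orth: "x \<bullet> y = 0" if "x \<in> D'" "y \<in> D'" "x \<noteq> y" for x y
    using D(4) that by (auto simp: D'_def pairwise_def orthogonal_def)
  have "card B \<le> card D'" using independent_span_bound[OF D'f B(2)] spD' span_superset by metis
  moreover have "card D' \<le> card D" unfolding D'_def by (rule card_mono) (use D in auto)
  ultimately have cD': "card D' = card B" using D(2) by simp
  define h where "h x = (1 / norm x) *\<^sub>R x" for x :: 'a
  have hn: "norm (h x) = 1" if "x \<in> D'" for x using that by (simp add: h_def D'_def)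
  have ho: "h x \<bullet> h y = 0" if "x \<in> D'" "y \<in> D'" "x \<noteq> y" for x y using orth[OF that] by (simp add: h_def)
  have inj: "inj_on h D'"
  proof (rule inj_onI, rule ccontr)
    fix x y assume "x \<in> D'" "y \<in> D'" "h x = h y" "x \<noteq> y"
    with ho[of x y] hn[of x] show False by (metis inner_eq_zero_iff norm_zero zero_neq_one)
  qed
  have "span (h ` D') = span D'"
  proof (rule antisym)
    show "span (h ` D') \<subseteq> span D'"
      by (rule span_minimal) (auto simp: h_def intro!: span_scale intro: span_base)
    have "x \<in> span (h ` D')" if "x \<in> D'" for x
    proof -
      have "x = norm x *\<^sub>R h x" using that by (simp add: h_def D'_def)
      then show ?thesis using that by (metis imageI span_base span_scale)
    qed
    then show "span D' \<subseteq> span (h ` D')" by (intro span_minimal) auto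
  qed
  with spD' cD' D'f hn ho inj show thesis
    by (intro that[of "h ` D'"]) (auto simp: card_image)
qed

text \<open>Finite dimension is the point: on an infinite-dimensional space \<open>dim\<close> would
  be the cardinality of an infinite set, hence 0. An orthonormal family of eigenvectors for
  \<open>\<mu>\<close> has orthogonal images of length \<open>sqrt \<mu>\<close>, so compactness
  bounds its size.\<close>

lemma eigenspace_orthonormal_basis:
  fixes S :: "'a::{real_inner, complete_space} \<Rightarrow> 'b::real_inner"
  assumes S: "compact_operator S" and mu: "\<mu> > 0"
  defines "E \<equiv> {x. (adjoint S \<circ> S) x = \<mu> *\<^sub>R x}"
  obtains C where "finite C" "card C = dim E" "span C = E" "\<And>x. x \<in> C \<Longrightarrow> norm x = 1"
    "\<And>x y. x \<in> C \<Longrightarrow> y \<in> C \<Longrightarrow> x \<noteq> y \<Longrightarrow> x \<bullet> y = 0"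
proof -
  have bl: "bounded_linear S" using S by (simp add: compact_operator_def)
  note lin = bounded_linear.linear[OF bl]
  have W: "y \<bullet> (adjoint S \<circ> S) x = S y \<bullet> S x" for x y by (simp add: adjoint_works_complete[OF bl])
  have Eiff: "x \<in> E \<longleftrightarrow> (\<forall>y. S y \<bullet> S x = \<mu> * (y \<bullet> x))" for x
  proof
    assume "x \<in> E" then have "(adjoint S \<circ> S) x = \<mu> *\<^sub>R x" by (simp add: E_def)
    then show "\<forall>y. S y \<bullet> S x = \<mu> * (y \<bullet> x)" using W[of _ x] by simp
  next
    assume "\<forall>y. S y \<bullet> S x = \<mu> * (y \<bullet> x)"
    then have "\<forall>y. y \<bullet> (adjoint S \<circ> S) x = y \<bullet> (\<mu> *\<^sub>R x)" using W[of _ x] by simp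
    then show "x \<in> E" unfolding E_def vector_eq_ldot by blast
  qed
  have sE: "subspace E"
    by (rule subspaceI) (auto simp: Eiff linear_0[OF lin] linear_add[OF lin] linear_scale[OF lin] inner_add_right algebra_simps)
  obtain k where k: "\<forall>B. finite B \<longrightarrow> (\<forall>x\<in>B. norm x = 1 \<and> sqrt \<mu> \<le> norm (S x)) \<longrightarrow>
      (\<forall>x\<in>B. \<forall>y\<in>B. x \<noteq> y \<longrightarrow> S x \<bullet> S y = 0) \<longrightarrow> card B \<le> k"
    using compact_operator_orthogonal_bound[OF S real_sqrt_gt_zero[OF mu]] by blast
  obtain B where B: "B \<subseteq> E" "independent B" "E \<subseteq> span B" "card B = dim E" using basis_exists by blast
  have small: "card B' \<le> k" if B': "B' \<subseteq> B" "finite B'" for B'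
  proof -
    have "independent B'" using B(2) B'(1) by (rule independent_mono)
    then obtain C where C: "finite C" "card C = card B'" "span C = span B'" "\<And>x. x \<in> C \<Longrightarrow> norm x = 1"
      "\<And>x y. x \<in> C \<Longrightarrow> y \<in> C \<Longrightarrow> x \<noteq> y \<Longrightarrow> x \<bullet> y = 0"
      using orthonormal_basis_of_independent[OF B'(2)] by blast
    have "span C \<subseteq> E" unfolding C(3) using B'(1) B(1) sE by (intro span_minimal) auto
    then have CE: "C \<subseteq> E" using span_superset by blast
    have "card C \<le> k"
    proof (rule k[rule_format, OF C(1)])
      fix x assume x: "x \<in> C"
      then have "S x \<bullet> S x = \<mu> * (x \<bullet> x)" using CE Eiff by blast
      then have "norm (S x) = sqrt \<mu>" using C(4)[OF x] by (simp add: norm_eq_sqrt_inner)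
      with C(4)[OF x] show "norm x = 1 \<and> sqrt \<mu> \<le> norm (S x)" by simp
    next
      fix x y assume "x \<in> C" "y \<in> C" "x \<noteq> y"
      then show "S x \<bullet> S y = 0" using CE Eiff C(5)[of x y] by (metis mult_zero_right subsetD)
    qed
    with C(2) show ?thesis by simp
  qed
  have "finite B"
  proof (rule ccontr)
    assume "infinite B"
    then obtain B' where "B' \<subseteq> B" "card B' = Suc k" "finite B'" using infinite_arbitrarily_large by metis
    with small show False by (metis not_less_eq_eq order_refl)
  qed
  then obtain C where C: "finite C" "card C = card B" "span C = span B" "\<And>x. x \<in> C \<Longrightarrow> norm x = 1"
      "\<And>x y. x \<in> C \<Longrightarrow> y \<in> C \<Longrightarrow> x \<noteq> y \<Longrightarrow> x \<bullet> y = 0"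
    using orthonormal_basis_of_independent[OF _ B(2)] by blast
  moreover have "span B = E" using B sE by (simp add: span_minimal subset_antisym)
  ultimately show thesis using that B(4) by metis
qed

lemma bounded_linear_adjoint_complete:
  fixes S :: "'a::{real_inner, complete_space} \<Rightarrow> 'b::real_inner"
  assumes S: "bounded_linear S"
  shows "bounded_linear (adjoint S)"
proof -
  interpret S: bounded_linear S by (rule S)
  note adj = adjoint_works_complete[OF S]
  obtain K where K: "\<And>x. norm (S x) \<le> norm x * K" "K > 0" using S.pos_bounded by blast
  show ?thesis
  proof (rule bounded_linear_intro[where K = K])
    show "adjoint S (x + y) = adjoint S x + adjoint S y" for x y
      by (rule vector_eq_ldot[THEN iffD1]) (simp add: inner_add_right flip: adj)
    show "adjoint S (c *\<^sub>R x) = c *\<^sub>R adjoint S x" for c x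
      by (rule vector_eq_ldot[THEN iffD1]) (simp flip: adj)
    show "norm (adjoint S y) \<le> norm y * K" for y
    proof -
      have "norm (adjoint S y) * norm (adjoint S y) = S (adjoint S y) \<bullet> y"
        using adj[of "adjoint S y" y] by (simp add: power2_norm_eq_inner flip: power2_eq_square)
      also have "\<dots> \<le> norm (S (adjoint S y)) * norm y" by (rule norm_cauchy_schwarz)
      also have "\<dots> \<le> (norm (adjoint S y) * K) * norm y" by (intro mult_right_mono K) auto
      finally have "norm (adjoint S y) * norm (adjoint S y) \<le> (norm y * K) * norm (adjoint S y)"
        by (simp add: ac_simps)
      then show ?thesis using K(2) by (cases "norm (adjoint S y) = 0") (simp_all add: mult_le_cancel_right)
    qed
  qed
qed

text \<open>The norm of \<open>S\<close> on \<open>V\<close> is attained at an eigenvector. Along a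
  maximising sequence the defect \<open>W (Y n) - \<sigma>\<^sup>2 *\<^sub>R Y n\<close> tends to 0,
  and compactness makes \<open>S (Y n)\<close> converge along a subsequence; together they force
  \<open>Y\<close> itself to converge.\<close>

lemma maximising_eigenvector:
  fixes S :: "'a::{real_inner, complete_space} \<Rightarrow> 'b::{real_inner, complete_space}"
  assumes S: "compact_operator S"
    and V: "subspace V" "closed V" and inv: "\<And>x. x \<in> V \<Longrightarrow> (adjoint S \<circ> S) x \<in> V"
    and x0: "x0 \<in> V" "S x0 \<noteq> 0"
  obtains z \<sigma> where "z \<in> V" "z \<noteq> 0" "\<sigma> > 0" "(adjoint S \<circ> S) z = \<sigma>\<^sup>2 *\<^sub>R z"
    "\<And>y. y \<in> V \<Longrightarrow> norm (S y) \<le> \<sigma> * norm y"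
proof -
  have bl: "bounded_linear S" using S by (simp add: compact_operator_def)
  interpret S: bounded_linear S by (rule bl)
  define W where "W = adjoint S \<circ> S"
  have W: "y \<bullet> W x = S y \<bullet> S x" for x y by (simp add: adjoint_works_complete[OF bl] W_def)
  define A where "A = (\<lambda>x. norm (S x)) ` {x \<in> V. norm x \<le> 1}"
  define \<sigma> where "\<sigma> = Sup A"
  obtain K where K: "\<And>x. norm (S x) \<le> norm x * K" "K > 0" using S.pos_bounded by blast
  have bdd: "bdd_above A"
  proof (rule bdd_aboveI[of _ K])
    fix a assume "a \<in> A"
    then obtain x where "a = norm (S x)" "norm x \<le> 1" by (auto simp: A_def)
    with K(1)[of x] K(2) show "a \<le> K" by (smt (verit) mult_left_le_one_le norm_ge_zero mult.commute mult_right_mono)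
  qed
  have ne: "A \<noteq> {}" using x0(1) subspace_0[OF V(1)] by (auto simp: A_def intro!: exI[of _ 0])
  have le: "norm (S y) \<le> \<sigma> * norm y" if "y \<in> V" for y
  proof (cases "y = 0")
    case False
    have "norm (S ((1 / norm y) *\<^sub>R y)) \<in> A"
      using False that V(1) by (auto simp: A_def intro!: imageI subspace_scale)
    then have "norm (S ((1 / norm y) *\<^sub>R y)) \<le> \<sigma>" unfolding \<sigma>_def using bdd by (rule cSup_upper)
    then show ?thesis using False by (simp add: S.scaleR field_simps)
  qed (simp add: S.zero)
  have \<sigma>: "\<sigma> > 0"
  proof -
    have "0 < \<sigma> * norm x0" using le[OF x0(1)] x0(2) by (smt (verit) zero_less_norm_iff)
    then show ?thesis by (simp add: zero_less_mult_iff)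
  qed
  have "\<exists>x\<in>V. norm x \<le> 1 \<and> \<sigma> - 1 / real (Suc n) < norm (S x)" for n
  proof -
    have "\<sigma> - 1 / real (Suc n) < Sup A" by (simp add: \<sigma>_def)
    then show ?thesis using less_cSup_iff[OF ne bdd] by (auto simp: A_def)
  qed
  then obtain X where X: "\<And>n. X n \<in> V" "\<And>n. norm (X n) \<le> 1" "\<And>n. \<sigma> - 1 / real (Suc n) < norm (S (X n))"
    by metis
  have up: "norm (S (X n)) \<le> \<sigma>" for n
    using le[OF X(1)[of n]] X(2)[of n] \<sigma> by (smt (verit) mult_left_le)
  have lim\<sigma>: "(\<lambda>n. norm (S (X n))) \<longlonglongrightarrow> \<sigma>"
  proof (rule tendsto_sandwich[OF _ _ _ tendsto_const])
    have "(\<lambda>n. \<sigma> - 1 / real (Suc n)) \<longlonglongrightarrow> \<sigma> - 0"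
      by (intro tendsto_intros LIMSEQ_Suc[OF lim_1_over_n])
    then show "(\<lambda>n. \<sigma> - 1 / real (Suc n)) \<longlonglongrightarrow> \<sigma>" by simp
  qed (use X(3) up in \<open>auto intro!: always_eventually less_imp_le\<close>)
  have "seq_compact (closure (S ` cball 0 1))"
    using S by (auto simp: compact_operator_def intro: compact_imp_seq_compact)
  moreover have "\<forall>n. S (X n) \<in> closure (S ` cball 0 1)"
    using X(2) closure_subset by (metis imageI mem_cball_0 subsetD)
  ultimately obtain y r where r: "strict_mono (r :: nat \<Rightarrow> nat)" "((\<lambda>n. S (X n)) \<circ> r) \<longlonglongrightarrow> y"
    by (rule seq_compactE) blast
  define Y where "Y n = X (r n)" for n
  have SY: "(\<lambda>n. S (Y n)) \<longlonglongrightarrow> y" using r(2) by (simp add: Y_def o_def)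
  have nSY: "(\<lambda>n. norm (S (Y n))) \<longlonglongrightarrow> \<sigma>"
    using LIMSEQ_subseq_LIMSEQ[OF lim\<sigma> r(1)] by (simp add: Y_def o_def)
  \<comment> \<open>Invariance of \<open>V\<close> enters here: the maximality of
    \<open>\<sigma>\<close> is applied to the vector \<open>W x\<close>.\<close>
  have nW: "norm (W x) \<le> \<sigma> * norm (S x)" if "x \<in> V" for x
  proof -
    have "norm (W x) * norm (W x) = S (W x) \<bullet> S x"
      using W[of "W x" x] by (simp add: power2_norm_eq_inner flip: power2_eq_square)
    also have "\<dots> \<le> norm (S (W x)) * norm (S x)" by (rule norm_cauchy_schwarz)
    also have "\<dots> \<le> (\<sigma> * norm (W x)) * norm (S x)"
      using le[OF inv[OF that]] by (intro mult_right_mono) (auto simp: W_def)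
    finally have "norm (W x) * norm (W x) \<le> (\<sigma> * norm (S x)) * norm (W x)" by (simp add: ac_simps)
    then show ?thesis using \<sigma> by (cases "norm (W x) = 0") (simp_all add: mult_le_cancel_right)
  qed
  have est: "(norm (W (Y n) - \<sigma>\<^sup>2 *\<^sub>R Y n))\<^sup>2 \<le> \<sigma>^4 - \<sigma>\<^sup>2 * (norm (S (Y n)))\<^sup>2" for n
  proof -
    have YV: "Y n \<in> V" "norm (Y n) \<le> 1" using X by (auto simp: Y_def)
    have "(norm (W (Y n) - \<sigma>\<^sup>2 *\<^sub>R Y n))\<^sup>2 = (norm (W (Y n)))\<^sup>2 - 2 * \<sigma>\<^sup>2 * (norm (S (Y n)))\<^sup>2 + \<sigma>^4 * (norm (Y n))\<^sup>2"
      unfolding power2_norm_eq_inner W[of "Y n" "Y n", symmetric]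
      by (simp add: inner_diff inner_commute power2_eq_square power4_eq_xxxx algebra_simps)
    also have "(norm (W (Y n)))\<^sup>2 \<le> (\<sigma> * norm (S (Y n)))\<^sup>2" using nW[OF YV(1)] by (simp add: power_mono)
    also have "\<sigma>^4 * (norm (Y n))\<^sup>2 \<le> \<sigma>^4" using YV(2) \<sigma> by (simp add: mult_left_le power_le_one)
    finally show ?thesis by (simp add: power_mult_distrib algebra_simps)
  qed
  have "(\<lambda>n. (norm (W (Y n) - \<sigma>\<^sup>2 *\<^sub>R Y n))\<^sup>2) \<longlonglongrightarrow> 0"
  proof (rule tendsto_sandwich[OF _ _ tendsto_const])
    have "(\<lambda>n. \<sigma>^4 - \<sigma>\<^sup>2 * (norm (S (Y n)))\<^sup>2) \<longlonglongrightarrow> \<sigma>^4 - \<sigma>\<^sup>2 * \<sigma>\<^sup>2" by (intro tendsto_intros nSY)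
    then show "(\<lambda>n. \<sigma>^4 - \<sigma>\<^sup>2 * (norm (S (Y n)))\<^sup>2) \<longlonglongrightarrow> 0" by (simp add: power4_eq_xxxx power2_eq_square)
  qed (use est in auto)
  then have "(\<lambda>n. sqrt ((norm (W (Y n) - \<sigma>\<^sup>2 *\<^sub>R Y n))\<^sup>2)) \<longlonglongrightarrow> sqrt 0" by (rule tendsto_real_sqrt)
  then have "(\<lambda>n. W (Y n) - \<sigma>\<^sup>2 *\<^sub>R Y n) \<longlonglongrightarrow> 0"
    by (simp add: tendsto_norm_zero_iff)
  moreover have WY: "(\<lambda>n. W (Y n)) \<longlonglongrightarrow> adjoint S y"
    using bounded_linear.tendsto[OF bounded_linear_adjoint_complete[OF bl] SY] by (simp add: W_def)
  \<comment> \<open>Solving for \<open>Y n\<close>: both \<open>W (Y n)\<close> and the defect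
    converge, hence so does \<open>Y n\<close> after division by
    \<open>\<sigma>\<^sup>2\<close>.\<close>
  ultimately have "(\<lambda>n. W (Y n) - (W (Y n) - \<sigma>\<^sup>2 *\<^sub>R Y n)) \<longlonglongrightarrow> adjoint S y - 0" by (intro tendsto_diff)
  then have "(\<lambda>n. (1 / \<sigma>\<^sup>2) *\<^sub>R (\<sigma>\<^sup>2 *\<^sub>R Y n)) \<longlonglongrightarrow> (1 / \<sigma>\<^sup>2) *\<^sub>R adjoint S y" by (intro tendsto_intros) simp
  moreover define z where "z = (1 / \<sigma>\<^sup>2) *\<^sub>R adjoint S y"
  ultimately have Yz: "Y \<longlonglongrightarrow> z" using \<sigma> by simp
  have zV: "z \<in> V" using closed_sequentially[OF V(2) _ Yz] X(1) by (simp add: Y_def)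
  have "(\<lambda>n. W (Y n)) \<longlonglongrightarrow> W z"
    using bounded_linear.tendsto[OF bounded_linear_adjoint_complete[OF bl] S.tendsto[OF Yz]] by (simp add: W_def)
  then have "W z = adjoint S y" using WY LIMSEQ_unique by blast
  then have Wz: "W z = \<sigma>\<^sup>2 *\<^sub>R z" using \<sigma> by (simp add: z_def)
  have "(\<lambda>n. norm (S (Y n))) \<longlonglongrightarrow> norm (S z)" by (intro tendsto_norm S.tendsto Yz)
  then have "norm (S z) = \<sigma>" using nSY LIMSEQ_unique by blast
  then have "z \<noteq> 0" using \<sigma> S.zero by auto
  with zV Wz \<sigma> le show thesis using that unfolding W_def by blast
qed

text \<open>The spectral information on which everything later rests. \<open>e m\<close> is
  constrained only where \<open>lam m > 0\<close>, and these vectors may fail to span the space;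
  \<open>S_tail\<close> stands in for completeness.\<close>

locale singular_system =
  fixes S :: "'h::{real_inner, complete_space} \<Rightarrow> 'g::{real_inner, complete_space}"
    and lam :: "nat \<Rightarrow> real" and e :: "nat \<Rightarrow> 'h"
  assumes bounded_linear_S: "bounded_linear S"
    and lam_nonneg: "m \<ge> 1 \<Longrightarrow> 0 \<le> lam m"
    and lam_antimono: "1 \<le> m \<Longrightarrow> m \<le> n \<Longrightarrow> lam n \<le> lam m"
    and e_orthonormal: "m \<ge> 1 \<Longrightarrow> n \<ge> 1 \<Longrightarrow> lam m > 0 \<Longrightarrow> lam n > 0 \<Longrightarrow>
      e m \<bullet> e n = (if m = n then 1 else 0)"
    and S_e: "m \<ge> 1 \<Longrightarrow> lam m > 0 \<Longrightarrow> S x \<bullet> S (e m) = lam m * (x \<bullet> e m)"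
    and S_tail: "(\<And>m. 1 \<le> m \<Longrightarrow> m \<le> N \<Longrightarrow> lam m > 0 \<Longrightarrow> x \<bullet> e m = 0) \<Longrightarrow>
      (norm (S x))\<^sup>2 \<le> lam (Suc N) * (norm x)\<^sup>2"
    and finite_lam_ge: "c > 0 \<Longrightarrow> finite {m. m \<ge> 1 \<and> c \<le> lam m}"

lemma eigenvalue_sequence_antimono:
  assumes "eigenvalue_sequence W lam" "1 \<le> m" "m \<le> n"
  shows "lam n \<le> lam m"
  using assms(3,2)
proof (induction n rule: dec_induct)
  case (step n)
  then have "lam (Suc n) \<le> lam n" using assms(1) by (auto simp: eigenvalue_sequence_def)
  with step show ?case by simp
qed simp

text \<open>The indices carrying a given positive eigenvalue are as many as the dimension of its
  eigenspace, so they can be matched with an orthonormal basis of it. Vectors from different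
  eigenspaces are orthogonal because \<open>W\<close> is symmetric.\<close>

lemma singular_system_exists:
  fixes S :: "'h::{real_inner, complete_space} \<Rightarrow> 'g::{real_inner, complete_space}"
  assumes S: "compact_operator S" and lam: "eigenvalue_sequence (adjoint S \<circ> S) lam"
  shows "\<exists>e. singular_system S lam e"
proof -
  have bl: "bounded_linear S" using S by (simp add: compact_operator_def)
  define W where "W = adjoint S \<circ> S"
  have W: "y \<bullet> W x = S y \<bullet> S x" for x y by (simp add: adjoint_works_complete[OF bl] W_def)
  define E where "E \<mu> = {x. W x = \<mu> *\<^sub>R x}" for \<mu>
  have nonneg: "0 \<le> lam m" if "m \<ge> 1" for m using lam that by (auto simp: eigenvalue_sequence_def)
  note anti = eigenvalue_sequence_antimono[OF lam]
  define Q where "Q \<mu> f \<longleftrightarrow> span (f ` {m. m \<ge> 1 \<and> lam m = \<mu>}) = E \<mu> \<and>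
      (\<forall>m. m \<ge> 1 \<and> lam m = \<mu> \<longrightarrow> norm (f m) = 1) \<and>
      (\<forall>m n. m \<ge> 1 \<and> lam m = \<mu> \<and> n \<ge> 1 \<and> lam n = \<mu> \<and> m \<noteq> n \<longrightarrow> f m \<bullet> f n = 0)"
    for \<mu> and f :: "nat \<Rightarrow> 'h"
  have "\<exists>f. Q \<mu> f" if mu: "\<mu> > 0" for \<mu> :: real
  proof -
    let ?M = "{m. m \<ge> 1 \<and> lam m = \<mu>}"
    obtain C where C: "finite C" "card C = dim (E \<mu>)" "span C = E \<mu>" "\<And>x. x \<in> C \<Longrightarrow> norm x = 1"
      "\<And>x y. x \<in> C \<Longrightarrow> y \<in> C \<Longrightarrow> x \<noteq> y \<Longrightarrow> x \<bullet> y = 0"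
      using eigenspace_orthonormal_basis[OF S mu] unfolding E_def W_def by blast
    have "finite ?M \<and> card ?M = dim (E \<mu>)" using lam mu unfolding eigenvalue_sequence_def E_def W_def by blast
    then obtain f where f: "bij_betw f ?M C" using C(1,2) finite_same_card_bij by metis
    then have im: "f ` ?M = C" by (simp add: bij_betw_def)
    have inj: "inj_on f ?M" using f by (simp add: bij_betw_def)
    have "norm (f m) = 1" if "m \<ge> 1 \<and> lam m = \<mu>" for m using that C(4) im by blast
    moreover have "f m \<bullet> f n = 0" if "m \<ge> 1 \<and> lam m = \<mu> \<and> n \<ge> 1 \<and> lam n = \<mu> \<and> m \<noteq> n" for m n
    proof (rule C(5))
      show "f m \<in> C" "f n \<in> C" using that im by blast+
      show "f m \<noteq> f n" using inj that by (auto dest: inj_onD)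
    qed
    ultimately show ?thesis unfolding Q_def using im C(3) by (intro exI[of _ f]) simp
  qed
  then have "\<forall>\<mu>. \<exists>f. \<mu> > 0 \<longrightarrow> Q \<mu> f" by blast
  from choice[OF this] obtain f where Q: "\<And>\<mu>. \<mu> > 0 \<Longrightarrow> Q \<mu> (f \<mu>)" by blast
  have f: "span (f \<mu> ` {m. m \<ge> 1 \<and> lam m = \<mu>}) = E \<mu>"
    "m \<ge> 1 \<Longrightarrow> lam m = \<mu> \<Longrightarrow> norm (f \<mu> m) = 1"
    "m \<ge> 1 \<Longrightarrow> lam m = \<mu> \<Longrightarrow> n \<ge> 1 \<Longrightarrow> lam n = \<mu> \<Longrightarrow> m \<noteq> n \<Longrightarrow> f \<mu> m \<bullet> f \<mu> n = 0"
    if "\<mu> > 0" for \<mu> m n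
  proof -
    note q = Q[OF that, unfolded Q_def]
    show "span (f \<mu> ` {m. m \<ge> 1 \<and> lam m = \<mu>}) = E \<mu>" using q by (rule conjunct1)
    show "norm (f \<mu> m) = 1" if "m \<ge> 1" "lam m = \<mu>" using q that by simp
    show "f \<mu> m \<bullet> f \<mu> n = 0" if "m \<ge> 1" "lam m = \<mu>" "n \<ge> 1" "lam n = \<mu>" "m \<noteq> n" using q that by simp
  qed
  define e where "e m = f (lam m) m" for m
  have We: "W (e m) = lam m *\<^sub>R e m" if "m \<ge> 1" "lam m > 0" for m
  proof -
    have "e m \<in> f (lam m) ` {k. k \<ge> 1 \<and> lam k = lam m}" using that by (auto simp: e_def)
    then have "e m \<in> span (f (lam m) ` {k. k \<ge> 1 \<and> lam k = lam m})" by (rule span_base)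
    then have "e m \<in> E (lam m)" using f(1)[OF that(2)] by simp
    then show ?thesis by (simp add: E_def)
  qed
  have Se: "S x \<bullet> S (e m) = lam m * (x \<bullet> e m)" if "m \<ge> 1" "lam m > 0" for m x
    using W[of x "e m"] We[OF that] by simp
  have orth: "e m \<bullet> e n = (if m = n then 1 else 0)" if "m \<ge> 1" "n \<ge> 1" "lam m > 0" "lam n > 0" for m n
  proof (cases "m = n")
    case True
    have "norm (e m) = 1" unfolding e_def by (rule f(2)[OF that(3,1) refl])
    with True show ?thesis by (simp add: norm_eq_1)
  next
    case neq: False
    show ?thesis
    proof (cases "lam m = lam n")
      case True
      have "f (lam m) m \<bullet> f (lam m) n = 0" by (rule f(3)[OF that(3,1) refl that(2) True[symmetric] neq])
      with True neq show ?thesis by (simp add: e_def)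
    next
      case False
      have "lam n * (e m \<bullet> e n) = lam m * (e m \<bullet> e n)"
        using Se[OF that(2,4), of "e m"] Se[OF that(1,3), of "e n"] by (simp add: inner_commute)
      with False neq show ?thesis by simp
    qed
  qed
  have tail: "(norm (S x))\<^sup>2 \<le> lam (Suc N) * (norm x)\<^sup>2"
    if x: "\<And>m. 1 \<le> m \<Longrightarrow> m \<le> N \<Longrightarrow> lam m > 0 \<Longrightarrow> x \<bullet> e m = 0" for N x
  proof -
    define V where "V = {x. \<forall>m. 1 \<le> m \<longrightarrow> m \<le> N \<longrightarrow> lam m > 0 \<longrightarrow> x \<bullet> e m = 0}"
    have xV: "x \<in> V" using x by (simp add: V_def)
    have sV: "subspace V" by (rule subspaceI) (auto simp: V_def inner_add_left)
    have cV: "closed V"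
    proof -
      have "V = (\<Inter>m\<in>{m. 1 \<le> m \<and> m \<le> N \<and> lam m > 0}. {x. x \<bullet> e m = 0})" by (auto simp: V_def)
      then show ?thesis by (auto intro!: closed_INT closed_Collect_eq continuous_intros)
    qed
    have inv: "(adjoint S \<circ> S) y \<in> V" if "y \<in> V" for y
    proof -
      have "W y \<bullet> e m = 0" if "1 \<le> m" "m \<le> N" "lam m > 0" for m
      proof -
        have "W y \<bullet> e m = S (e m) \<bullet> S y" using W[of "e m" y] by (simp add: inner_commute)
        also have "\<dots> = lam m * (y \<bullet> e m)" using Se[OF that(1,3), of y] by (simp add: inner_commute)
        also have "\<dots> = 0" using \<open>y \<in> V\<close> that by (simp add: V_def)
        finally show ?thesis .
      qed
      then show ?thesis by (simp add: V_def W_def)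
    qed
    show ?thesis
    proof (cases "S x = 0")
      case True
      then show ?thesis using nonneg[of "Suc N"] by simp
    next
      case False
      obtain z \<sigma> where z: "z \<in> V" "z \<noteq> 0" "\<sigma> > 0" "(adjoint S \<circ> S) z = \<sigma>\<^sup>2 *\<^sub>R z"
        "\<And>y. y \<in> V \<Longrightarrow> norm (S y) \<le> \<sigma> * norm y"
        using maximising_eigenvector[OF S sV cV inv xV False] by blast
      have s2: "\<sigma>\<^sup>2 > 0" using z(3) by simp
      have "z \<in> E (\<sigma>\<^sup>2)" using z(4) by (simp add: E_def W_def)
      then have zsp: "z \<in> span (f (\<sigma>\<^sup>2) ` {m. m \<ge> 1 \<and> lam m = \<sigma>\<^sup>2})" using f(1)[OF s2] by simp
      \<comment> \<open>The nonzero \<open>z\<close> lies in the span of the chosen eigenvectors for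
        \<open>\<sigma>\<^sup>2\<close>, so one of them is not orthogonal to it. By the definition
        of \<open>V\<close> its index exceeds \<open>N\<close>, which caps
        \<open>\<sigma>\<^sup>2\<close> by \<open>lam (Suc N)\<close>.\<close>
      have "\<exists>m. m \<ge> 1 \<and> lam m = \<sigma>\<^sup>2 \<and> z \<bullet> e m \<noteq> 0"
      proof (rule ccontr)
        assume "\<not> ?thesis"
        then have "f (\<sigma>\<^sup>2) ` {m. m \<ge> 1 \<and> lam m = \<sigma>\<^sup>2} \<subseteq> {y. z \<bullet> y = 0}" by (auto simp: e_def)
        moreover have "subspace {y. z \<bullet> y = 0}" by (rule subspaceI) (auto simp: inner_add_right)
        ultimately have "z \<in> {y. z \<bullet> y = 0}" using zsp span_minimal by blast
        with z(2) show False by simp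
      qed
      then obtain m where m: "m \<ge> 1" "lam m = \<sigma>\<^sup>2" "z \<bullet> e m \<noteq> 0" by blast
      have "m > N" using z(1) m s2 by (auto simp: V_def not_le[symmetric])
      then have "\<sigma>\<^sup>2 \<le> lam (Suc N)" using anti[of "Suc N" m] m(2) by simp
      have "(norm (S x))\<^sup>2 \<le> (\<sigma> * norm x)\<^sup>2" using z(5)[OF xV] by (simp add: power_mono)
      also have "\<dots> = \<sigma>\<^sup>2 * (norm x)\<^sup>2" by (simp add: power_mult_distrib)
      also have "\<dots> \<le> lam (Suc N) * (norm x)\<^sup>2" using \<open>\<sigma>\<^sup>2 \<le> lam (Suc N)\<close> by (simp add: mult_right_mono)
      finally show ?thesis .
    qed
  qed
  \<comment> \<open>Finite multiplicities alone would let the eigenvalues decrease to a positive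
    limit; compactness of \<open>S\<close> excludes this.\<close>
  have fin: "finite {m. m \<ge> 1 \<and> c \<le> lam m}" if c: "c > 0" for c
  proof (rule ccontr)
    assume inf: "infinite {m. m \<ge> 1 \<and> c \<le> lam m}"
    obtain k where k: "\<forall>B. finite B \<longrightarrow> (\<forall>x\<in>B. norm x = 1 \<and> sqrt c \<le> norm (S x)) \<longrightarrow>
      (\<forall>x\<in>B. \<forall>y\<in>B. x \<noteq> y \<longrightarrow> S x \<bullet> S y = 0) \<longrightarrow> card B \<le> k"
      using compact_operator_orthogonal_bound[OF S real_sqrt_gt_zero[OF c]] by blast
    obtain M where M: "M \<subseteq> {m. m \<ge> 1 \<and> c \<le> lam m}" "finite M" "card M = Suc k"
      using infinite_arbitrarily_large[OF inf] by metis
    have Mo: "e m \<bullet> e n = (if m = n then 1 else 0)" if "m \<in> M" "n \<in> M" for m n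
      using orth[of m n] that M(1) c by force
    have MS: "S (e m) \<bullet> S (e n) = lam n * (e m \<bullet> e n)" if "n \<in> M" for m n
      using Se[of n "e m"] that M(1) c by force
    have inj: "inj_on e M" by (rule inj_onI) (metis Mo zero_neq_one)
    have "card (e ` M) \<le> k"
    proof (rule k[rule_format])
      fix x assume "x \<in> e ` M"
      then obtain m where m: "m \<in> M" "x = e m" by blast
      then have "norm x = 1" using Mo[of m m] by (simp add: norm_eq_1)
      moreover have "sqrt c \<le> norm (S x)"
        using m MS[of m m] Mo[of m m] M(1) by (auto simp: norm_eq_sqrt_inner)
      ultimately show "norm x = 1 \<and> sqrt c \<le> norm (S x)" by simp
    next
      fix x y assume "x \<in> e ` M" "y \<in> e ` M" "x \<noteq> y"
      then show "S x \<bullet> S y = 0" using MS Mo by auto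
    qed (use M in auto)
    with M(3) inj show False by (simp add: card_image)
  qed
  show ?thesis by (rule exI[of _ e], rule singular_system.intro[OF bl nonneg anti orth Se tail fin])
qed

section \<open>Tensor powers of operators\<close>

lemma tensor_map_inner: "tensor_map d t \<Longrightarrow> t f \<bullet> t g = (\<Prod>i=1..d. f i \<bullet> g i)"
  by (simp add: tensor_map_def)

text \<open>By the product formula and the distributive law both sides have the same inner product
  with every elementary tensor. Both lie in the span of elementary tensors, so their difference is
  orthogonal to itself.\<close>

lemma tensor_map_sum_expansion:
  fixes u :: "(nat \<Rightarrow> 'g::real_inner) \<Rightarrow> 'l::real_inner"
  assumes u: "tensor_map d u" and A: "finite A"
  shows "u (\<lambda>i. \<Sum>m\<in>A. c i m *\<^sub>R v m) =
    (\<Sum>j\<in>{1..d} \<rightarrow>\<^sub>E A. (\<Prod>i=1..d. c i (j i)) *\<^sub>R u (\<lambda>i. v (j i)))" (is "?l = ?r")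
proof -
  have *: "?l \<bullet> u g = ?r \<bullet> u g" for g
  proof -
    have "?l \<bullet> u g = (\<Prod>i=1..d. \<Sum>m\<in>A. c i m * (v m \<bullet> g i))"
      by (simp add: tensor_map_inner[OF u] inner_sum_left)
    also have "\<dots> = (\<Sum>j\<in>{1..d} \<rightarrow>\<^sub>E A. \<Prod>i=1..d. c i (j i) * (v (j i) \<bullet> g i))"
      by (rule prod_sum_PiE) (use A in auto)
    also have "\<dots> = ?r \<bullet> u g"
      by (simp add: inner_sum_left tensor_map_inner[OF u] prod.distrib)
    finally show ?thesis .
  qed
  have "(?l - ?r) \<bullet> (?l - ?r) = (?l - ?r) \<bullet> ?l - (?l - ?r) \<bullet> ?r" by (rule inner_diff_right)
  also have "(?l - ?r) \<bullet> ?l = 0" using *[of "\<lambda>i. \<Sum>m\<in>A. c i m *\<^sub>R v m"] by (simp only: inner_diff_left diff_self)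
  also have "(?l - ?r) \<bullet> ?r = 0"
  proof -
    have "(?l - ?r) \<bullet> u (\<lambda>i. v (j i)) = 0" for j by (simp only: inner_diff_left * diff_self)
    then show ?thesis by (simp only: inner_sum_right inner_scaleR_right mult_zero_right sum.neutral_const)
  qed
  finally show ?thesis by simp
qed

text \<open>The bound along the span of the graph is the only obligation left for a concrete
  operator. It includes well-definedness, since a combination with \<open>x = 0\<close> must have
  \<open>y = 0\<close>.\<close>

lemma tensor_extension_props:
  fixes t :: "(nat \<Rightarrow> 'h) \<Rightarrow> 'k::{real_inner, complete_space}"
    and u :: "(nat \<Rightarrow> 'h) \<Rightarrow> 'l::{real_inner, complete_space}"
  assumes bnd: "\<And>x y. (x, y) \<in> span (range (\<lambda>f. (t f, u f))) \<Longrightarrow> norm y \<le> C * norm x"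
  shows "bounded_linear (tensor_extension t u)" "tensor_extension t u (t f) = u f"
    "(\<And>f. x \<bullet> t f = 0) \<Longrightarrow> tensor_extension t u x = 0"
proof -
  let ?P = "\<lambda>T. bounded_linear T \<and> (\<forall>f. T (t f) = u f) \<and> (\<forall>x. (\<forall>f. x \<bullet> t f = 0) \<longrightarrow> T x = 0)"
  have "\<exists>!T. ?P T"
  proof (rule ex_ex1I)
    show "\<exists>T. ?P T" by (rule bounded_linear_closure_span_exists[OF bnd])
    fix T T' assume T: "?P T" and T': "?P T'"
    show "T = T'"
    proof (rule ext, rule bounded_linear_closure_span_unique[where t = t])
      show "bounded_linear T" "bounded_linear T'" using T T' by (blast dest: conjunct1)+
      show "T (t f) = T' (t f)" for f using T T' by simp
      show "T y = T' y" if "\<And>f. y \<bullet> t f = 0" for y using T T' that by simp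
    qed
  qed
  from theI'[OF this] have P: "?P (tensor_extension t u)" unfolding tensor_extension_def .
  from P show "bounded_linear (tensor_extension t u)" by (rule conjunct1)
  from P show "tensor_extension t u (t f) = u f" by simp
  from P show "tensor_extension t u x = 0" if "\<And>f. x \<bullet> t f = 0" using that by simp
qed

text \<open>Reindexing the product shows that permuting factors preserves inner products of
  elementary tensors, hence norms along the span of the graph. The third fact identifies the adjoint
  as the operator of the inverse permutation, tested on elementary tensors.\<close>

lemma perm_operator_props:
  fixes t :: "(nat \<Rightarrow> 'h::real_inner) \<Rightarrow> 'k::{real_inner, complete_space}"
  assumes t: "tensor_map d t" and p: "\<pi> permutes {1..d}"
  shows "bounded_linear (perm_operator t \<pi>)" "perm_operator t \<pi> (t f) = t (\<lambda>i. f (\<pi> i))"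
    "perm_operator t \<pi> x \<bullet> t g = x \<bullet> t (\<lambda>i. g (inv \<pi> i))"
proof -
  let ?G = "range (\<lambda>f. (t f, t (\<lambda>i. f (\<pi> i))))"
  have tt: "t (\<lambda>i. f (\<pi> i)) \<bullet> t (\<lambda>i. g (\<pi> i)) = t f \<bullet> t g" for f g
    unfolding tensor_map_inner[OF t] using prod.permute[OF p, of "\<lambda>i. f i \<bullet> g i"] by (simp add: o_def)
  have bnd: "norm y \<le> 1 * norm x" if xy: "(x, y) \<in> span ?G" for x y
  proof -
    have 1: "y \<bullet> t (\<lambda>i. f (\<pi> i)) = x \<bullet> t f" for f
    proof -
      have "span ?G \<subseteq> {z. snd z \<bullet> t (\<lambda>i. f (\<pi> i)) = fst z \<bullet> t f}"
        by (rule span_minimal) (auto simp: tt subspace_def inner_add_left)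
      with xy show ?thesis by auto
    qed
    have "span ?G \<subseteq> {z. y \<bullet> snd z = x \<bullet> fst z}"
      by (rule span_minimal) (auto simp: 1 subspace_def inner_add_right)
    with xy have "y \<bullet> y = x \<bullet> x" by auto
    then show ?thesis by (simp add: norm_eq_sqrt_inner)
  qed
  note props = tensor_extension_props[of t "\<lambda>f. t (\<lambda>i. f (\<pi> i))" 1, folded perm_operator_def]
  show bl: "bounded_linear (perm_operator t \<pi>)" by (rule props(1)) (rule bnd)
  have pf: "perm_operator t \<pi> (t f) = t (\<lambda>i. f (\<pi> i))" for f by (rule props(2)) (rule bnd)
  show "perm_operator t \<pi> (t f) = t (\<lambda>i. f (\<pi> i))" by (rule pf)
  show "perm_operator t \<pi> x \<bullet> t g = x \<bullet> t (\<lambda>i. g (inv \<pi> i))"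
  proof (rule bounded_linear_closure_span_unique[where t = t and T = "\<lambda>x. perm_operator t \<pi> x \<bullet> t g"
        and T' = "\<lambda>x. x \<bullet> t (\<lambda>i. g (inv \<pi> i))"])
    show "bounded_linear (\<lambda>x. perm_operator t \<pi> x \<bullet> t g)"
      by (rule bounded_linear_inner_left_comp[OF bl])
    show "bounded_linear (\<lambda>x. x \<bullet> t (\<lambda>i. g (inv \<pi> i)))" by (rule bounded_linear_inner_left)
    show "perm_operator t \<pi> (t f) \<bullet> t g = t f \<bullet> t (\<lambda>i. g (inv \<pi> i))" for f
      using tt[of f "\<lambda>i. g (inv \<pi> i)"] permutes_inverses(2)[OF p] by (simp add: pf)
    show "perm_operator t \<pi> y \<bullet> t g = y \<bullet> t (\<lambda>i. g (inv \<pi> i))" if "\<And>f. y \<bullet> t f = 0" for y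
    proof -
      have "perm_operator t \<pi> y = 0" by (rule props(3)[OF bnd that])
      then show ?thesis by (simp add: that)
    qed
  qed
qed

lemma symmetrizer_linear:
  fixes t :: "(nat \<Rightarrow> 'h::real_inner) \<Rightarrow> 'k::{real_inner, complete_space}"
  assumes t: "tensor_map d t" and I: "I \<subseteq> {1..d}"
  shows "linear (symmetrizer t I)"
proof -
  have bl: "linear (perm_operator t \<pi>)" if "\<pi> permutes I" for \<pi>
    using perm_operator_props(1)[OF t permutes_subset[OF that I]] bounded_linear.linear by blast
  show ?thesis unfolding symmetrizer_def
    by (intro linear_compose_scale_right linear_compose_sum ballI) (simp add: bl)
qed

text \<open>Moving the operators to the other side of the inner product makes it an average over the
  permutations of \<open>I\<close>, which composition with \<open>\<pi>\<close> merely
  reorders.\<close>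

lemma symmetric_subspace_inner_permute:
  fixes t :: "(nat \<Rightarrow> 'h::real_inner) \<Rightarrow> 'k::{real_inner, complete_space}"
  assumes t: "tensor_map d t" and I: "I \<subseteq> {1..d}" and x: "x \<in> symmetric_subspace t I"
    and p: "\<pi> permutes I"
  shows "x \<bullet> t (\<lambda>i. g (\<pi> i)) = x \<bullet> t g"
proof -
  from x obtain y where y: "x = symmetrizer t I y" by (auto simp: symmetric_subspace_def)
  have "(\<Sum>\<sigma> | \<sigma> permutes I. perm_operator t \<sigma> y \<bullet> t (\<lambda>i. g (\<pi> i))) =
      (\<Sum>\<sigma> | \<sigma> permutes I. y \<bullet> t (\<lambda>i. g (\<pi> (inv \<sigma> i))))"
    by (rule sum.cong) (use perm_operator_props(3)[OF t permutes_subset[OF _ I]] in auto)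
  \<comment> \<open>Summing over inverses brings the argument into the form
    \<open>\<pi> \<circ> \<sigma>\<close>, to which left translation by \<open>\<pi>\<close>
    applies; afterwards the inversion is undone.\<close>
  also have "\<dots> = (\<Sum>\<sigma> | \<sigma> permutes I. y \<bullet> t (\<lambda>i. g (\<pi> (\<sigma> i))))"
    using sum_permutations_inverse[of "\<lambda>\<sigma>. y \<bullet> t (\<lambda>i. g (\<pi> (\<sigma> i)))" I] by simp
  also have "\<dots> = (\<Sum>\<sigma> | \<sigma> permutes I. y \<bullet> t (\<lambda>i. g (\<sigma> i)))"
    using setum_permutations_compose_left[OF p, of "\<lambda>\<sigma>. y \<bullet> t (\<lambda>i. g (\<sigma> i))"] by simp
  also have "\<dots> = (\<Sum>\<sigma> | \<sigma> permutes I. y \<bullet> t (\<lambda>i. g (inv \<sigma> i)))"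
    using sum_permutations_inverse[of "\<lambda>\<sigma>. y \<bullet> t (\<lambda>i. g (\<sigma> i))" I] by simp
  also have "\<dots> = (\<Sum>\<sigma> | \<sigma> permutes I. perm_operator t \<sigma> y \<bullet> t g)"
    by (rule sum.cong) (use perm_operator_props(3)[OF t permutes_subset[OF _ I]] in auto)
  finally show ?thesis by (simp add: y symmetrizer_def inner_sum_left)
qed

lemma subspace_symmetric_subspace:
  fixes t :: "(nat \<Rightarrow> 'h::real_inner) \<Rightarrow> 'k::{real_inner, complete_space}"
  assumes "tensor_map d t" "I \<subseteq> {1..d}"
  shows "subspace (symmetric_subspace t I)"
  unfolding symmetric_subspace_def tensor_space_def
  by (intro linear_subspace_image symmetrizer_linear[OF assms] subspace_closure subspace_span)

section \<open>Eigenvector expansion of the tensor power operator\<close>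

locale tensor_problem = singular_system S lam e
  for S :: "'h::{real_inner, complete_space} \<Rightarrow> 'g::{real_inner, complete_space}"
    and lam e +
  fixes d :: nat and t :: "(nat \<Rightarrow> 'h) \<Rightarrow> 'k::{real_inner, complete_space}"
    and u :: "(nat \<Rightarrow> 'g) \<Rightarrow> 'l::{real_inner, complete_space}"
  assumes t: "tensor_map d t" and u: "tensor_map d u"
begin

definition "pos_idx = {m. m \<ge> 1 \<and> lam m > 0}"
text \<open>Extensional functions, so that a multi-index is determined by its values on
  \<open>{1..d}\<close>. Indices with \<open>lam m = 0\<close> are left out because
  \<open>e m\<close> is arbitrary there.\<close>

definition "idx = ({1..d} \<rightarrow>\<^sub>E pos_idx)"
definition "idx_upto N = ({1..d} \<rightarrow>\<^sub>E pos_idx \<inter> {1..N})"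
definition "basis j = t (\<lambda>i. e (j i))"
definition "im_basis j = u (\<lambda>i. S (e (j i)))"
definition "ev j = (\<Prod>i=1..d. lam (j i))"
definition "T = tensor_power_operator t u S"

lemma idx_in: "j \<in> idx \<Longrightarrow> i \<in> {1..d} \<Longrightarrow> j i \<ge> 1 \<and> lam (j i) > 0"
  by (auto simp: idx_def pos_idx_def)

lemma idx_eqI: "j \<in> idx \<Longrightarrow> k \<in> idx \<Longrightarrow> (\<And>i. i \<in> {1..d} \<Longrightarrow> j i = k i) \<Longrightarrow> j = k"
  unfolding idx_def by (rule PiE_ext)

lemma prod_delta_idx:
  assumes "j \<in> idx" "k \<in> idx"
  shows "(\<Prod>i=1..d. if j i = k i then f i else 0) = (if j = k then \<Prod>i=1..d. f i else (0::real))"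
proof (cases "j = k")
  case False
  then obtain i where "i \<in> {1..d}" "j i \<noteq> k i" using idx_eqI[OF assms] by blast
  then show ?thesis using False by (auto intro!: prod_zero)
qed simp

lemma basis_inner:
  assumes "j \<in> idx" "k \<in> idx"
  shows "basis j \<bullet> basis k = (if j = k then 1 else 0)"
proof -
  have "basis j \<bullet> basis k = (\<Prod>i=1..d. if j i = k i then 1 else 0)"
    unfolding basis_def tensor_map_inner[OF t]
    by (rule prod.cong) (use e_orthonormal idx_in[OF assms(1)] idx_in[OF assms(2)] in auto)
  then show ?thesis unfolding prod_delta_idx[OF assms] by simp
qed

lemma im_basis_inner:
  assumes "j \<in> idx" "k \<in> idx"
  shows "im_basis j \<bullet> im_basis k = (if j = k then ev j else 0)"
proof -
  have "im_basis j \<bullet> im_basis k = (\<Prod>i=1..d. if j i = k i then lam (j i) else 0)"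
    unfolding im_basis_def tensor_map_inner[OF u]
  proof (rule prod.cong)
    fix i assume i: "i \<in> {1..d}"
    then show "S (e (j i)) \<bullet> S (e (k i)) = (if j i = k i then lam (j i) else 0)"
      using S_e[of "k i"] e_orthonormal[of "j i" "k i"] idx_in[OF assms(1) i] idx_in[OF assms(2) i] by auto
  qed simp
  then show ?thesis unfolding prod_delta_idx[OF assms] ev_def by simp
qed

lemma norm_sum_im_basis:
  assumes "finite Y" "Y \<subseteq> idx"
  shows "(norm (\<Sum>j\<in>Y. c j *\<^sub>R im_basis j))\<^sup>2 = (\<Sum>j\<in>Y. (c j)\<^sup>2 * ev j)"
proof -
  have "(norm (\<Sum>j\<in>Y. c j *\<^sub>R im_basis j))\<^sup>2 = (\<Sum>j\<in>Y. (norm (c j *\<^sub>R im_basis j))\<^sup>2)"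
    using assms by (intro norm_sum_Pythagorean) (auto simp: pairwise_def orthogonal_def im_basis_inner subset_iff)
  also have "\<dots> = (\<Sum>j\<in>Y. (c j)\<^sup>2 * ev j)"
  proof (rule sum.cong)
    fix j assume "j \<in> Y"
    then have "(norm (im_basis j))\<^sup>2 = ev j" using assms im_basis_inner[of j j] by (auto simp: power2_norm_eq_inner)
    then show "(norm (c j *\<^sub>R im_basis j))\<^sup>2 = (c j)\<^sup>2 * ev j" by (simp add: power_mult_distrib)
  qed simp
  finally show ?thesis .
qed

lemma norm_sum_basis:
  assumes "finite Y" "Y \<subseteq> idx"
  shows "(norm (\<Sum>j\<in>Y. c j *\<^sub>R basis j))\<^sup>2 = (\<Sum>j\<in>Y. (c j)\<^sup>2)"
proof -
  have "(norm (\<Sum>j\<in>Y. c j *\<^sub>R basis j))\<^sup>2 = (\<Sum>j\<in>Y. (norm (c j *\<^sub>R basis j))\<^sup>2)"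
    using assms by (intro norm_sum_Pythagorean) (auto simp: pairwise_def orthogonal_def basis_inner subset_iff)
  also have "\<dots> = (\<Sum>j\<in>Y. (c j)\<^sup>2)"
  proof (rule sum.cong)
    fix j assume "j \<in> Y"
    then have "(norm (basis j))\<^sup>2 = 1" using assms basis_inner[of j j] by (auto simp: power2_norm_eq_inner)
    then show "(norm (c j *\<^sub>R basis j))\<^sup>2 = (c j)\<^sup>2" by (simp add: power_mult_distrib)
  qed simp
  finally show ?thesis .
qed

lemma Bessel_inequality:
  assumes "finite Y" "Y \<subseteq> idx"
  shows "(\<Sum>j\<in>Y. (x \<bullet> basis j)\<^sup>2) \<le> (norm x)\<^sup>2"
proof -
  define z where "z = (\<Sum>j\<in>Y. (x \<bullet> basis j) *\<^sub>R basis j)"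
  have zz: "z \<bullet> z = (\<Sum>j\<in>Y. (x \<bullet> basis j)\<^sup>2)"
    using norm_sum_basis[OF assms, of "\<lambda>j. x \<bullet> basis j"] by (simp add: z_def power2_norm_eq_inner)
  have xz: "x \<bullet> z = (\<Sum>j\<in>Y. (x \<bullet> basis j)\<^sup>2)" by (simp add: z_def inner_sum_right power2_eq_square)
  have "0 \<le> (x - z) \<bullet> (x - z)" by simp
  also have "\<dots> = (norm x)\<^sup>2 - (\<Sum>j\<in>Y. (x \<bullet> basis j)\<^sup>2)"
    using zz xz by (simp add: inner_diff inner_commute power2_norm_eq_inner)
  finally show ?thesis by simp
qed

lemma norm_sum_im_basis_le:
  assumes Y: "finite Y" "Y \<subseteq> idx" and c: "c \<ge> 0" "\<And>j. j \<in> Y \<Longrightarrow> ev j \<le> c"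
  shows "(norm (\<Sum>j\<in>Y. (x \<bullet> basis j) *\<^sub>R im_basis j))\<^sup>2 \<le> c * (norm x)\<^sup>2"
proof -
  have "(\<Sum>j\<in>Y. (x \<bullet> basis j)\<^sup>2 * ev j) \<le> (\<Sum>j\<in>Y. c * (x \<bullet> basis j)\<^sup>2)"
    by (rule sum_mono) (subst mult.commute, intro mult_right_mono c(2), simp_all)
  also have "\<dots> \<le> c * (norm x)\<^sup>2"
    using Bessel_inequality[OF Y, of x] c by (simp add: mult_left_mono flip: sum_distrib_left)
  finally show ?thesis by (simp add: norm_sum_im_basis[OF Y])
qed

lemma lam_tendsto_0: "(\<lambda>N. lam (Suc N)) \<longlonglongrightarrow> 0"
proof (rule LIMSEQ_I)
  fix r :: real assume r: "r > 0"
  obtain M where M: "\<And>m. m \<ge> 1 \<and> r \<le> lam m \<Longrightarrow> m \<le> M"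
    using finite_lam_ge[OF r] finite_nat_set_iff_bounded_le by (metis (mono_tags, lifting) mem_Collect_eq)
  have "norm (lam (Suc N) - 0) < r" if "N \<ge> M" for N
    using M[of "Suc N"] that lam_nonneg[of "Suc N"] by fastforce
  then show "\<exists>no. \<forall>n\<ge>no. norm (lam (Suc n) - 0) < r" by blast
qed

definition "proj N x = (\<Sum>m\<in>pos_idx \<inter> {1..N}. (x \<bullet> e m) *\<^sub>R e m)"

lemma proj_inner:
  assumes "1 \<le> m" "m \<le> N" "lam m > 0"
  shows "proj N x \<bullet> e m = x \<bullet> e m"
proof -
  have "proj N x \<bullet> e m = (\<Sum>k\<in>pos_idx \<inter> {1..N}. if k = m then x \<bullet> e m else 0)"
    unfolding proj_def inner_sum_left
    by (rule sum.cong) (use e_orthonormal assms in \<open>auto simp: pos_idx_def\<close>)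
  then show ?thesis using assms by (simp add: pos_idx_def)
qed

text \<open>\<open>proj N x\<close> need not tend to \<open>x\<close>, since \<open>S\<close> may
  have a kernel. What holds is that the remainder is orthogonal to the first \<open>N\<close>
  eigenvectors and no longer than \<open>x\<close>, so its image under \<open>S\<close> is
  controlled by \<open>lam (Suc N)\<close>, which tends to 0.\<close>

lemma S_proj_tendsto: "(\<lambda>N. S (proj N x)) \<longlonglongrightarrow> S x"
proof -
  interpret bounded_linear S by (rule bounded_linear_S)
  have le: "(norm (S (x - proj N x)))\<^sup>2 \<le> lam (Suc N) * (norm x)\<^sup>2" for N
  proof -
    have "(norm (S (x - proj N x)))\<^sup>2 \<le> lam (Suc N) * (norm (x - proj N x))\<^sup>2"
      by (rule S_tail) (simp add: inner_diff_left proj_inner)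
    also have "\<dots> \<le> lam (Suc N) * (norm x)\<^sup>2"
    proof (rule mult_left_mono)
      have "proj N x \<bullet> proj N x = (\<Sum>m\<in>pos_idx \<inter> {1..N}. (x \<bullet> e m) * (proj N x \<bullet> e m))"
        by (subst (2) proj_def) (simp add: inner_sum_right)
      also have "\<dots> = (\<Sum>m\<in>pos_idx \<inter> {1..N}. (x \<bullet> e m) * (x \<bullet> e m))"
        by (rule sum.cong) (auto simp: proj_inner pos_idx_def)
      also have "\<dots> = x \<bullet> proj N x" by (simp add: proj_def inner_sum_right)
      finally have "(norm (x - proj N x))\<^sup>2 = (norm x)\<^sup>2 - (norm (proj N x))\<^sup>2"
        by (simp add: power2_norm_eq_inner inner_diff inner_commute)
      then show "(norm (x - proj N x))\<^sup>2 \<le> (norm x)\<^sup>2" by simp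
    qed (simp add: lam_nonneg)
    finally show ?thesis .
  qed
  have "(\<lambda>N. lam (Suc N) * (norm x)\<^sup>2) \<longlonglongrightarrow> 0 * (norm x)\<^sup>2" by (intro tendsto_intros lam_tendsto_0)
  then have lim: "(\<lambda>N. lam (Suc N) * (norm x)\<^sup>2) \<longlonglongrightarrow> 0" by simp
  have "(\<lambda>N. (norm (S (x - proj N x)))\<^sup>2) \<longlonglongrightarrow> 0"
    by (rule tendsto_sandwich[OF _ _ tendsto_const lim]) (simp_all add: le)
  then have "(\<lambda>N. sqrt ((norm (S (x - proj N x)))\<^sup>2)) \<longlonglongrightarrow> sqrt 0" by (rule tendsto_real_sqrt)
  then have "(\<lambda>N. S x - S (proj N x)) \<longlonglongrightarrow> 0" by (simp add: tendsto_norm_zero_iff diff)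
  then have "(\<lambda>N. S x - (S x - S (proj N x))) \<longlonglongrightarrow> S x - 0" by (intro tendsto_intros)
  then show ?thesis by simp
qed

lemma finite_idx_upto: "finite (idx_upto N)"
  unfolding idx_upto_def by (intro finite_PiE) auto

lemma idx_upto_subset: "idx_upto N \<subseteq> idx"
  unfolding idx_upto_def idx_def by (intro PiE_mono) auto

lemma u_proj_expansion:
  "u (\<lambda>i. S (proj N (f i))) = (\<Sum>j\<in>idx_upto N. (t f \<bullet> basis j) *\<^sub>R im_basis j)"
proof -
  interpret bounded_linear S by (rule bounded_linear_S)
  have "u (\<lambda>i. S (proj N (f i))) = u (\<lambda>i. \<Sum>m\<in>pos_idx \<inter> {1..N}. (f i \<bullet> e m) *\<^sub>R S (e m))"
    by (simp add: proj_def sum scale)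
  also have "\<dots> = (\<Sum>j\<in>idx_upto N. (t f \<bullet> basis j) *\<^sub>R im_basis j)"
    by (subst tensor_map_sum_expansion[OF u])
       (auto simp: idx_upto_def basis_def im_basis_def tensor_map_inner[OF t])
  finally show ?thesis .
qed

text \<open>The squared distance expands into inner products of elementary tensors, which are
  products over the factors; convergence in each factor therefore suffices.\<close>

lemma u_S_limit: "(\<lambda>N. \<Sum>j\<in>idx_upto N. (t f \<bullet> basis j) *\<^sub>R im_basis j) \<longlonglongrightarrow> u (\<lambda>i. S (f i))"
proof -
  define v where "v N = u (\<lambda>i. S (proj N (f i)))" for N
  define w where "w = u (\<lambda>i. S (f i))"
  have 1: "(\<lambda>N. v N \<bullet> v N) \<longlonglongrightarrow> w \<bullet> w" unfolding v_def w_def tensor_map_inner[OF u]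
    by (intro tendsto_prod tendsto_inner S_proj_tendsto)
  have 2: "(\<lambda>N. v N \<bullet> w) \<longlonglongrightarrow> w \<bullet> w" unfolding v_def w_def tensor_map_inner[OF u]
    by (intro tendsto_prod tendsto_inner S_proj_tendsto tendsto_const)
  have "(\<lambda>N. v N \<bullet> v N - 2 * (v N \<bullet> w) + w \<bullet> w) \<longlonglongrightarrow> w \<bullet> w - 2 * (w \<bullet> w) + w \<bullet> w"
    by (intro tendsto_intros 1 2)
  then have "(\<lambda>N. (norm (v N - w))\<^sup>2) \<longlonglongrightarrow> 0"
    by (simp add: power2_norm_eq_inner inner_diff inner_commute algebra_simps)
  then have "(\<lambda>N. sqrt ((norm (v N - w))\<^sup>2)) \<longlonglongrightarrow> sqrt 0" by (rule tendsto_real_sqrt)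
  then have "(\<lambda>N. v N - w) \<longlonglongrightarrow> 0" by (simp add: tendsto_norm_zero_iff)
  then have "v \<longlonglongrightarrow> w" by (simp add: LIM_zero_iff)
  then show ?thesis unfolding v_def w_def u_proj_expansion .
qed

lemma ev_le: "j \<in> idx \<Longrightarrow> ev j \<le> lam 1 ^ d"
proof -
  assume j: "j \<in> idx"
  have "ev j \<le> (\<Prod>i=1..d. lam 1)" unfolding ev_def
  proof (rule prod_mono)
    fix i assume "i \<in> {1..d}"
    then show "0 \<le> lam (j i) \<and> lam (j i) \<le> lam 1" using idx_in[OF j, of i] lam_antimono[of 1 "j i"] by simp
  qed
  then show ?thesis by simp
qed

text \<open>The bounding constant is the \<open>d\<close>-th power of the norm of \<open>S\<close>.
  The partial sums are linear and obey it uniformly in \<open>N\<close>; the pairs along which they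
  converge to the second component form a subspace, so the bound passes to the whole span of the
  graph.\<close>

lemma
  shows bounded_linear_T: "bounded_linear T" and T_t: "T (t f) = u (\<lambda>i. S (f i))"
    and T_perp: "(\<And>f. x \<bullet> t f = 0) \<Longrightarrow> T x = 0"
proof -
  let ?G = "range (\<lambda>f. (t f, u (\<lambda>i. S (f i))))"
  have bnd: "norm y \<le> sqrt (lam 1 ^ d) * norm x" if xy: "(x, y) \<in> span ?G" for x y
  proof -
    define A where "A N x = (\<Sum>j\<in>idx_upto N. (x \<bullet> basis j) *\<^sub>R im_basis j)" for N x
    have A0: "A N 0 = 0" for N by (simp add: A_def)
    have Aadd: "A N (x + y) = A N x + A N y" for N x y
      by (simp add: A_def inner_add_left scaleR_left_distrib sum.distrib)
    have Asc: "A N (c *\<^sub>R x) = c *\<^sub>R A N x" for N c x by (simp add: A_def scaleR_sum_right)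
    have "span ?G \<subseteq> {z. (\<lambda>N. A N (fst z)) \<longlonglongrightarrow> snd z}"
    proof (rule span_minimal)
      show "?G \<subseteq> {z. (\<lambda>N. A N (fst z)) \<longlonglongrightarrow> snd z}" using u_S_limit by (auto simp: A_def)
      show "subspace {z. (\<lambda>N. A N (fst z)) \<longlonglongrightarrow> snd z}"
        by (rule subspaceI) (auto simp: A0 Aadd Asc intro: tendsto_add tendsto_scaleR)
    qed
    with xy have "(\<lambda>N. A N x) \<longlonglongrightarrow> y" by auto
    moreover have "norm (A N x) \<le> sqrt (lam 1 ^ d) * norm x" for N
    proof -
      have "(norm (A N x))\<^sup>2 \<le> lam 1 ^ d * (norm x)\<^sup>2" unfolding A_def
        using idx_upto_subset ev_le lam_nonneg[of 1]
        by (intro norm_sum_im_basis_le finite_idx_upto) auto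
      then show ?thesis using real_sqrt_le_mono by (fastforce simp: real_sqrt_mult)
    qed
    ultimately show ?thesis using Lim_norm_ubound[of sequentially "\<lambda>N. A N x"] by simp
  qed
  note props = tensor_extension_props[of t "\<lambda>f. u (\<lambda>i. S (f i))" "sqrt (lam 1 ^ d)",
      folded tensor_power_operator_def, folded T_def]
  show "bounded_linear T" by (rule props(1)) (rule bnd)
  show "T (t f) = u (\<lambda>i. S (f i))" by (rule props(2)) (rule bnd)
  show "T x = 0" if "\<And>f. x \<bullet> t f = 0" by (rule props(3)[OF bnd that])
qed

lemma T_basis: "T (basis j) = im_basis j"
  by (simp add: basis_def im_basis_def T_t)

lemma finite_subset_idx_upto:
  assumes "finite X" "X \<subseteq> idx"
  obtains N0 where "\<And>N. N \<ge> N0 \<Longrightarrow> X \<subseteq> idx_upto N"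
proof -
  have fin: "finite (\<Union>j\<in>X. j ` {1..d})" using assms by auto
  obtain N0 where N0: "\<And>m. m \<in> (\<Union>j\<in>X. j ` {1..d}) \<Longrightarrow> m \<le> N0"
    using finite_nat_set_iff_bounded_le fin by meson
  show thesis
  proof (rule that[of N0])
    fix N assume "N \<ge> N0"
    show "X \<subseteq> idx_upto N"
    proof
      fix j assume j: "j \<in> X"
      then have "j \<in> idx" using assms by blast
      moreover have "j i \<le> N" if "i \<in> {1..d}" for i
        using N0[of "j i"] j that \<open>N \<ge> N0\<close> by fastforce
      ultimately show "j \<in> idx_upto N" by (auto simp: idx_def idx_upto_def pos_idx_def PiE_iff)
    qed
  qed
qed

text \<open>On the span the partial sums converge to \<open>T y\<close>. Removing the terms in
  \<open>X\<close> leaves multi-indices with \<open>ev j \<le> c\<close>, so Bessel's inequality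
  bounds the difference before the limit; closedness then extends the bound to the tensor
  space.\<close>

lemma T_approximation:
  assumes X: "finite X" "X \<subseteq> idx" and c: "c \<ge> 0" "\<And>j. j \<in> idx - X \<Longrightarrow> ev j \<le> c"
  shows "(norm (T x - (\<Sum>j\<in>X. (x \<bullet> basis j) *\<^sub>R im_basis j)))\<^sup>2 \<le> c * (norm x)\<^sup>2"
proof -
  interpret T: bounded_linear T by (rule bounded_linear_T)
  define A where "A Y x = (\<Sum>j\<in>Y. (x \<bullet> basis j) *\<^sub>R im_basis j)" for Y x
  have Aadd: "A Y (x + y) = A Y x + A Y y" for Y x y
    by (simp add: A_def inner_add_left scaleR_left_distrib sum.distrib)
  have Asc: "A Y (c *\<^sub>R x) = c *\<^sub>R A Y x" for Y c x by (simp add: A_def scaleR_sum_right)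
  obtain N0 where N0: "\<And>N. N \<ge> N0 \<Longrightarrow> X \<subseteq> idx_upto N" using finite_subset_idx_upto[OF X] by blast
  have on_span: "(norm (T y - A X y))\<^sup>2 \<le> c * (norm y)\<^sup>2" if y: "y \<in> span (range t)" for y
  proof -
    have "span (range t) \<subseteq> {y. (\<lambda>N. A (idx_upto N) y) \<longlonglongrightarrow> T y}"
    proof (rule span_minimal)
      show "range t \<subseteq> {y. (\<lambda>N. A (idx_upto N) y) \<longlonglongrightarrow> T y}" using u_S_limit by (auto simp: A_def T_t)
      show "subspace {y. (\<lambda>N. A (idx_upto N) y) \<longlonglongrightarrow> T y}"
        by (rule subspaceI) (auto simp: T.zero T.add T.scaleR Aadd Asc A_def[of _ 0] intro: tendsto_add tendsto_scaleR)
    qed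
    with y have "(\<lambda>N. A (idx_upto N) y) \<longlonglongrightarrow> T y" by blast
    then have "(\<lambda>N. (norm (A (idx_upto N) y - A X y))\<^sup>2) \<longlonglongrightarrow> (norm (T y - A X y))\<^sup>2"
      by (intro tendsto_intros)
    then show ?thesis
    proof (rule LIMSEQ_le_const2)
      have "(norm (A (idx_upto N) y - A X y))\<^sup>2 \<le> c * (norm y)\<^sup>2" if "N \<ge> N0" for N
      proof -
        have "A (idx_upto N) y - A X y = A (idx_upto N - X) y"
          unfolding A_def using N0[OF that] finite_idx_upto by (simp add: sum_diff)
        then show ?thesis unfolding A_def using c idx_upto_subset finite_idx_upto
          by (auto intro!: norm_sum_im_basis_le)
      qed
      then show "\<exists>N. \<forall>n\<ge>N. (norm (A (idx_upto n) y - A X y))\<^sup>2 \<le> c * (norm y)\<^sup>2" by blast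
    qed
  qed
  have on_cl: "(norm (T y - A X y))\<^sup>2 \<le> c * (norm y)\<^sup>2" if y: "y \<in> closure (span (range t))" for y
  proof -
    have "closure (span (range t)) \<subseteq> {y. (norm (T y - A X y))\<^sup>2 \<le> c * (norm y)\<^sup>2}"
    proof (rule closure_minimal)
      show "span (range t) \<subseteq> {y. (norm (T y - A X y))\<^sup>2 \<le> c * (norm y)\<^sup>2}" using on_span by blast
      show "closed {y. (norm (T y - A X y))\<^sup>2 \<le> c * (norm y)\<^sup>2}" unfolding A_def
        by (intro closed_Collect_le continuous_intros linear_continuous_on bounded_linear_T)
    qed
    with y show ?thesis by blast
  qed
  \<comment> \<open>Outside the tensor space both \<open>T\<close> and the finite sum see only the
    projection \<open>p\<close>, which is no longer than \<open>x\<close>.\<close>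
  obtain p where p: "p \<in> closure (span (range t))" "\<And>y. y \<in> closure (span (range t)) \<Longrightarrow> (x - p) \<bullet> y = 0"
    using subspace_closure_complement[where M = "range t"] by blast
  have perp: "(x - p) \<bullet> t f = 0" for f
    by (rule p(2)) (meson closure_subset rangeI span_base subsetD)
  have "T (x - p) = 0" by (rule T_perp[OF perp])
  then have 1: "T x = T p" by (simp add: T.diff)
  have "x \<bullet> basis j = p \<bullet> basis j" for j using perp by (simp add: basis_def inner_diff_left)
  then have 2: "A X x = A X p" by (simp add: A_def)
  have "(norm x)\<^sup>2 = (norm (x - p))\<^sup>2 + (norm p)\<^sup>2"
    using p(2)[OF p(1)] by (simp add: power2_norm_eq_inner inner_diff inner_commute)
  then have "(norm p)\<^sup>2 \<le> (norm x)\<^sup>2" by simp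
  then have 3: "c * (norm p)\<^sup>2 \<le> c * (norm x)\<^sup>2" using c(1) by (rule mult_left_mono)
  have "(norm (T x - A X x))\<^sup>2 \<le> c * (norm x)\<^sup>2"
    using order_trans[OF on_cl[OF p(1)] 3] by (simp only: 1 2)
  then show ?thesis by (simp only: A_def)
qed

end

section \<open>Minimal errors and orbits of multi-indices\<close>

lemma continuous_linear_functional_on_bounded:
  assumes F: "subspace F" and L: "continuous_linear_functional_on F L"
  obtains K where "\<And>x. x \<in> F \<Longrightarrow> norm x \<le> 1 \<Longrightarrow> \<bar>L x\<bar> \<le> K"
proof -
  have sc: "\<And>c x. x \<in> F \<Longrightarrow> L (c *\<^sub>R x) = c * L x" and cont: "continuous_on F L"
    using L by (auto simp: continuous_linear_functional_on_def)
  have F0: "0 \<in> F" using F by (rule subspace_0)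
  then have L0: "L 0 = 0" using sc[of 0 0] by simp
  obtain \<delta> where \<delta>: "\<delta> > 0" "\<And>x. x \<in> F \<Longrightarrow> dist x 0 < \<delta> \<Longrightarrow> dist (L x) (L 0) < 1"
    using cont F0 unfolding continuous_on_iff by (metis zero_less_one)
  show thesis
  proof (rule that[of "2 / \<delta>"])
    fix x assume x: "x \<in> F" "norm x \<le> 1"
    have "norm ((\<delta>/2) *\<^sub>R x) < \<delta>" using \<delta>(1) x(2) by (simp add: mult_le_one field_simps)
    then have "\<bar>L ((\<delta>/2) *\<^sub>R x)\<bar> < 1"
      using \<delta>(2)[of "(\<delta>/2) *\<^sub>R x"] subspace_scale[OF F x(1)] by (simp add: L0)
    then have "\<delta> / 2 * \<bar>L x\<bar> < 1" using \<delta>(1) sc[OF x(1)] by (simp add: abs_mult)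
    then show "\<bar>L x\<bar> \<le> 2 / \<delta>" using \<delta>(1) by (simp add: field_simps)
  qed
qed

text \<open>A real \<open>SUP\<close> yields an upper bound only for sets bounded above, so this
  precedes any use of \<open>worst_case_error\<close>.\<close>

lemma worst_case_error_bdd_above:
  fixes T :: "'k::real_normed_vector \<Rightarrow> 'l::real_normed_vector"
  assumes F: "subspace F" and T: "bounded_linear T" and A: "A \<in> linear_algorithms F G n"
  shows "bdd_above ((\<lambda>f. norm (T f - A f)) ` {f \<in> F. norm f \<le> 1})"
proof -
  obtain L g where L: "\<And>j. j \<in> {1..n} \<Longrightarrow> continuous_linear_functional_on F (L j)"
    and A: "A = (\<lambda>f. \<Sum>j=1..n. L j f *\<^sub>R g j)"
    using A unfolding linear_algorithms_def by blast
  have "\<forall>j. \<exists>K. j \<in> {1..n} \<longrightarrow> (\<forall>x\<in>F. norm x \<le> 1 \<longrightarrow> \<bar>L j x\<bar> \<le> K)"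
    using continuous_linear_functional_on_bounded[OF F L] by metis
  from choice[OF this] obtain K where K: "\<And>j x. j \<in> {1..n} \<Longrightarrow> x \<in> F \<Longrightarrow> norm x \<le> 1 \<Longrightarrow> \<bar>L j x\<bar> \<le> K j" by blast
  obtain KT where KT: "\<And>x. norm (T x) \<le> norm x * KT" "KT > 0" using bounded_linear.pos_bounded[OF T] by blast
  show ?thesis
  proof (rule bdd_aboveI2)
    fix x assume "x \<in> {f \<in> F. norm f \<le> 1}"
    then have x: "x \<in> F" "norm x \<le> 1" by auto
    have "norm (T x) \<le> 1 * KT" using KT x(2) by (meson less_imp_le mult_right_mono order_trans)
    moreover have "norm (A x) \<le> (\<Sum>j=1..n. K j * norm (g j))" unfolding A
      by (rule sum_norm_le) (use K x in \<open>auto intro: mult_right_mono\<close>)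
    ultimately show "norm (T x - A x) \<le> KT + (\<Sum>j=1..n. K j * norm (g j))"
      using norm_triangle_ineq4[of "T x" "A x"] by simp
  qed
qed

lemma worst_case_error_upper:
  assumes "subspace F" "bounded_linear T" "A \<in> linear_algorithms F G n" "f \<in> F" "norm f \<le> 1"
  shows "norm (T f - A f) \<le> worst_case_error F T A"
  unfolding worst_case_error_def
  by (rule cSUP_upper[OF _ worst_case_error_bdd_above[OF assms(1-3)]]) (use assms in auto)

lemma minimal_error_le:
  assumes F: "subspace F" and T: "bounded_linear T" and A: "A \<in> linear_algorithms F G n"
    and le: "\<And>f. f \<in> F \<Longrightarrow> norm f \<le> 1 \<Longrightarrow> norm (T f - A f) \<le> c"
  shows "minimal_error F G T n \<le> c"
  unfolding minimal_error_def
proof (rule cINF_lower2[OF _ A])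
  have F0: "0 \<in> F" using F by (rule subspace_0)
  show "bdd_below (worst_case_error F T ` linear_algorithms F G n)"
  proof (rule bdd_belowI2)
    fix B assume "B \<in> linear_algorithms F G n"
    then have "norm (T 0 - B 0) \<le> worst_case_error F T B" using worst_case_error_upper[OF F T _ F0] by simp
    then show "0 \<le> worst_case_error F T B" by (meson norm_ge_zero order_trans)
  qed
  show "worst_case_error F T A \<le> c" unfolding worst_case_error_def
    by (rule cSUP_least) (use F0 le in \<open>auto intro!: exI[of _ 0]\<close>)
qed

text \<open>An algorithm with \<open>n\<close> functionals maps the span of \<open>B\<close> into a
  space of dimension at most \<open>n\<close>, so it kills a nonzero vector there. After
  normalisation the error on this vector is the norm of its image under \<open>T\<close>.\<close>

lemma minimal_error_ge:
  fixes T :: "'k::real_normed_vector \<Rightarrow> 'l::real_normed_vector"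
  assumes F: "subspace F" and T: "bounded_linear T" and G: "G \<noteq> {}"
    and B: "finite B" "independent B" "B \<subseteq> F" "n < card B"
    and ge: "\<And>x. x \<in> span B \<Longrightarrow> s * norm x \<le> norm (T x)"
  shows "s \<le> minimal_error F G T n"
  unfolding minimal_error_def
proof (rule cINF_greatest)
  obtain g0 where "g0 \<in> G" using G by blast
  moreover have "continuous_linear_functional_on F (\<lambda>_. 0)" by (simp add: continuous_linear_functional_on_def)
  ultimately show "linear_algorithms F G n \<noteq> {}" unfolding linear_algorithms_def
    by (auto intro!: exI[of _ "\<lambda>_ _. 0"] exI[of _ "\<lambda>_. g0"])
next
  fix A assume A: "A \<in> linear_algorithms F G n"
  then obtain L g where L: "\<And>j. j \<in> {1..n} \<Longrightarrow> continuous_linear_functional_on F (L j)"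
    and Aeq: "A = (\<lambda>f. \<Sum>j=1..n. L j f *\<^sub>R g j)"
    unfolding linear_algorithms_def by blast
  have Ladd: "L j (x + y) = L j x + L j y" if "j \<in> {1..n}" "x \<in> F" "y \<in> F" for j x y
    using L[OF that(1)] that by (simp add: continuous_linear_functional_on_def)
  have Lsc: "L j (c *\<^sub>R x) = c * L j x" if "j \<in> {1..n}" "x \<in> F" for j c x
    using L[OF that(1)] that by (simp add: continuous_linear_functional_on_def)
  have Aadd: "A (x + y) = A x + A y" if "x \<in> F" "y \<in> F" for x y
    unfolding Aeq sum.distrib[symmetric] by (rule sum.cong) (use Ladd that in \<open>auto simp: scaleR_left_distrib\<close>)
  have Asc: "A (c *\<^sub>R x) = c *\<^sub>R A x" if "x \<in> F" for c x
    unfolding Aeq scaleR_sum_right by (rule sum.cong) (use Lsc that in auto)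
  have A0: "A 0 = 0" using Asc[of 0 0] subspace_0[OF F] by simp
  have Asum: "A (\<Sum>b\<in>D. c b *\<^sub>R b) = (\<Sum>b\<in>D. c b *\<^sub>R A b)" if "D \<subseteq> B" for D c
    using finite_subset[OF that B(1)] that
  proof (induction D rule: finite_induct)
    case (insert b D)
    have "(\<Sum>b\<in>D. c b *\<^sub>R b) \<in> F" using insert B(3) by (intro subspace_sum[OF F] subspace_scale[OF F]) auto
    moreover have "c b *\<^sub>R b \<in> F" "b \<in> F" using insert B(3) subspace_scale[OF F] by auto
    ultimately show ?case using insert by (simp add: Aadd Asc)
  qed (simp add: A0)
  have Asp: "A b \<in> span (g ` {1..n})" for b unfolding Aeq
    by (intro span_sum span_scale span_base) auto
  \<comment> \<open>If \<open>A\<close> identifies two elements of \<open>B\<close>, their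
    difference is already killed. The case is separate because the image set forgets the repetition
    and may well be independent.\<close>
  have "\<exists>c. (\<exists>b\<in>B. c b \<noteq> 0) \<and> (\<Sum>b\<in>B. c b *\<^sub>R A b) = 0"
  proof (cases "inj_on A B")
    case True
    have "dependent (A ` B)"
    proof (rule ccontr)
      assume "independent (A ` B)"
      then have "card (A ` B) \<le> card (g ` {1..n})"
        using independent_span_bound[of "g ` {1..n}" "A ` B"] Asp by blast
      also have "\<dots> \<le> n" using card_image_le[of "{1..n}" g] by simp
      finally show False using B(4) True by (simp add: card_image)
    qed
    then obtain c where c: "\<exists>v\<in>A ` B. c v \<noteq> 0" "(\<Sum>v\<in>A ` B. c v *\<^sub>R v) = 0"
      using dependent_finite[of "A ` B"] B(1) by blast
    then show ?thesis using True by (intro exI[of _ "\<lambda>b. c (A b)"]) (auto simp: sum.reindex)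
  next
    case False
    then obtain b b' where b: "b \<in> B" "b' \<in> B" "b \<noteq> b'" "A b = A b'" by (auto simp: inj_on_def)
    define c where "c x = (if x = b then 1 else 0) - (if x = b' then 1 else 0 :: real)" for x
    have "(\<Sum>x\<in>B. c x *\<^sub>R A x) = A b - A b'"
    proof -
      have "(\<Sum>x\<in>B. c x *\<^sub>R A x) = (\<Sum>x\<in>B. (if x = b then A x else 0) - (if x = b' then A x else 0))"
        by (rule sum.cong) (auto simp: c_def)
      then show ?thesis using b(1,2) B(1) by (simp add: sum_subtractf)
    qed
    moreover have "c b \<noteq> 0" using b(3) by (simp add: c_def)
    ultimately show ?thesis using b(1,4) by (intro exI[of _ c]) auto
  qed
  then obtain c b where c: "b \<in> B" "c b \<noteq> 0" "(\<Sum>b\<in>B. c b *\<^sub>R A b) = 0" by blast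
  define x where "x = (\<Sum>b\<in>B. c b *\<^sub>R b)"
  have x0: "x \<noteq> 0" using independentD[OF B(2,1) subset_refl, of c b] c unfolding x_def by blast
  have Ax: "A x = 0" using Asum[OF subset_refl] c(3) by (simp add: x_def)
  have xF: "x \<in> F" unfolding x_def using B(3) by (intro subspace_sum[OF F] subspace_scale[OF F]) auto
  have xs: "x \<in> span B" unfolding x_def by (intro span_sum span_scale span_base)
  define y where "y = (1 / norm x) *\<^sub>R x"
  have y: "y \<in> F" "norm y = 1" "A y = 0" "y \<in> span B"
    using xF x0 Ax xs Asc[OF xF] by (auto simp: y_def subspace_scale[OF F] span_scale)
  have "s \<le> norm (T y)" using ge[OF y(4)] y(2) by simp
  also have "\<dots> = norm (T y - A y)" using y(3) by simp
  also have "\<dots> \<le> worst_case_error F T A" by (rule worst_case_error_upper[OF F T A]) (use y in auto)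
  finally show "s \<le> worst_case_error F T A" .
qed

lemma linear_algorithmsI:
  assumes "finite K" "card K = n"
    and "\<And>k. k \<in> K \<Longrightarrow> continuous_linear_functional_on F (L k)" "\<And>k. k \<in> K \<Longrightarrow> g k \<in> G"
  shows "(\<lambda>f. \<Sum>k\<in>K. L k f *\<^sub>R g k) \<in> linear_algorithms F G n"
proof -
  obtain h where h: "bij_betw h {1..n} K" using ex_bij_betw_nat_finite_1[OF assms(1)] assms(2) by blast
  then have hK: "h j \<in> K" if "j \<in> {1..n}" for j using that by (auto simp: bij_betw_def)
  have "(\<lambda>f. \<Sum>k\<in>K. L k f *\<^sub>R g k) = (\<lambda>f. \<Sum>j=1..n. L (h j) f *\<^sub>R g (h j))"
    using sum.reindex_bij_betw[OF h, of "\<lambda>k. L k f *\<^sub>R g k" for f] by auto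
  then show ?thesis unfolding linear_algorithms_def using assms(3,4) hK
    by (intro CollectI exI[of _ "\<lambda>j. L (h j)"] exI[of _ "\<lambda>j. g (h j)"]) auto
qed

section \<open>Information complexity as a number of orbits\<close>

locale symmetric_problem = tensor_problem S lam e d t u
  for S :: "'h::{real_inner, complete_space} \<Rightarrow> 'g::{real_inner, complete_space}"
    and lam e d and t :: "(nat \<Rightarrow> 'h) \<Rightarrow> 'k::{real_inner, complete_space}"
    and u :: "(nat \<Rightarrow> 'g) \<Rightarrow> 'l::{real_inner, complete_space}" +
  fixes I :: "nat set"
  assumes I: "I \<subseteq> {1..d}"
begin

definition "F = symmetric_subspace t I"
definition "complexity \<epsilon> = information_complexity F (tensor_space u) T \<epsilon>"
text \<open>The strict inequality matches the criterion that the error be at most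
  \<open>\<epsilon>\<close>: squared singular values equal to \<open>\<epsilon>\<^sup>2\<close> cost
  no functional.\<close>

definition "large_idx c = {j \<in> idx. c < ev j}"

lemma subspace_F: "subspace F" unfolding F_def by (rule subspace_symmetric_subspace[OF t I])

lemma idx_permute:
  assumes j: "j \<in> idx" and p: "\<pi> permutes I"
  shows "j \<circ> \<pi> \<in> idx"
proof -
  have p': "\<pi> permutes {1..d}" using permutes_subset[OF p I] .
  have "j (\<pi> i) \<in> pos_idx" if "i \<in> {1..d}" for i
  proof -
    have "\<pi> i \<in> {1..d}" using permutes_in_image[OF p'] that by blast
    with PiE_mem[of j "{1..d}" "\<lambda>_. pos_idx" "\<pi> i"] j show ?thesis unfolding idx_def by blast
  qed
  moreover have "j (\<pi> i) = undefined" if "i \<notin> {1..d}" for i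
    unfolding permutes_not_in[OF p' that] by (rule PiE_arb[OF j[unfolded idx_def] that])
  ultimately show ?thesis by (auto simp: idx_def PiE_iff extensional_def)
qed

lemma ev_permute:
  assumes p: "\<pi> permutes I"
  shows "ev (j \<circ> \<pi>) = ev j"
  using prod.permute[OF permutes_subset[OF p I], of "\<lambda>i. lam (j i)"] by (simp add: ev_def o_def)

lemma F_inner_basis_permute:
  "x \<in> F \<Longrightarrow> \<pi> permutes I \<Longrightarrow> x \<bullet> basis (j \<circ> \<pi>) = x \<bullet> basis j"
  using symmetric_subspace_inner_permute[OF t I, of x \<pi> "\<lambda>i. e (j i)"] by (simp add: F_def basis_def)

text \<open>Every factor is at most \<open>\<Lambda>\<close>, so a product above \<open>c\<close>
  forces each factor above \<open>c / \<Lambda> ^ (d - 1)\<close>, which leaves finitely many values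
  per coordinate. The maximum with 1 keeps \<open>\<Lambda>\<close> positive.\<close>

lemma finite_large_idx:
  assumes c: "c > 0"
  shows "finite (large_idx c)"
proof -
  define \<Lambda> where "\<Lambda> = max 1 (lam 1)"
  define M where "M = {m. m \<ge> 1 \<and> c / \<Lambda> ^ (d - 1) \<le> lam m}"
  have \<Lambda>: "\<Lambda> \<ge> 1" by (simp add: \<Lambda>_def)
  have "finite M" unfolding M_def using c \<Lambda> by (intro finite_lam_ge) auto
  moreover have "large_idx c \<subseteq> {1..d} \<rightarrow>\<^sub>E M"
  proof
    fix j assume "j \<in> large_idx c"
    then have j: "j \<in> idx" "c < ev j" by (auto simp: large_idx_def)
    have "j i \<in> M" if i: "i \<in> {1..d}" for i
    proof -
      have "ev j = lam (j i) * (\<Prod>k\<in>{1..d} - {i}. lam (j k))" unfolding ev_def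
        by (rule prod.remove) (use i in auto)
      also have "(\<Prod>k\<in>{1..d} - {i}. lam (j k)) \<le> (\<Prod>k\<in>{1..d} - {i}. \<Lambda>)"
      proof (rule prod_mono)
        fix k assume "k \<in> {1..d} - {i}"
        then show "0 \<le> lam (j k) \<and> lam (j k) \<le> \<Lambda>"
          using idx_in[OF j(1), of k] lam_antimono[of 1 "j k"] by (simp add: \<Lambda>_def le_max_iff_disj)
      qed
      also have "\<dots> = \<Lambda> ^ (d - 1)" using i by simp
      finally have "c < lam (j i) * \<Lambda> ^ (d - 1)"
        using j idx_in[OF j(1) i] by (simp add: mult_left_mono)
      then show ?thesis using idx_in[OF j(1) i] \<Lambda> by (simp add: M_def divide_le_eq)
    qed
    then show "j \<in> {1..d} \<rightarrow>\<^sub>E M" using j(1) by (auto simp: idx_def PiE_iff)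
  qed
  ultimately show ?thesis by (meson finite_PiE finite_atLeastAtMost finite_subset)
qed

text \<open>For \<open>f\<close> in \<open>F\<close> the coefficients
  \<open>f \<bullet> basis j\<close> agree along an orbit, so one functional per label suffices. The
  abstract label \<open>\<kappa>\<close> allows the identity, which shows that the minimum exists,
  as well as the multiplicity label used for counting.\<close>

lemma minimal_error_le_card:
  assumes \<epsilon>: "\<epsilon> > 0"
    and \<kappa>: "\<And>j k. j \<in> large_idx (\<epsilon>\<^sup>2) \<Longrightarrow> k \<in> large_idx (\<epsilon>\<^sup>2) \<Longrightarrow> \<kappa> j = \<kappa> k \<Longrightarrow>
      \<exists>\<pi>. \<pi> permutes I \<and> k = j \<circ> \<pi>"
  shows "minimal_error F (tensor_space u) T (card (\<kappa> ` large_idx (\<epsilon>\<^sup>2))) \<le> \<epsilon>"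
proof -
  define X where "X = large_idx (\<epsilon>\<^sup>2)"
  have X: "finite X" "X \<subseteq> idx" using finite_large_idx[of "\<epsilon>\<^sup>2"] \<epsilon> by (auto simp: X_def large_idx_def)
  define rep where "rep k = (SOME j. j \<in> X \<and> \<kappa> j = k)" for k
  have rep: "rep k \<in> X \<and> \<kappa> (rep k) = k" if "k \<in> \<kappa> ` X" for k
  proof -
    from that have "\<exists>j. j \<in> X \<and> \<kappa> j = k" by blast
    from someI_ex[OF this] show ?thesis unfolding rep_def .
  qed
  define A where "A f = (\<Sum>k\<in>\<kappa> ` X. (f \<bullet> basis (rep k)) *\<^sub>R (\<Sum>j\<in>{j\<in>X. \<kappa> j = k}. im_basis j))" for f
  have A: "A \<in> linear_algorithms F (tensor_space u) (card (\<kappa> ` X))"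
    unfolding A_def
  proof (rule linear_algorithmsI)
    show "continuous_linear_functional_on F (\<lambda>f. f \<bullet> basis (rep k))" for k
      by (auto simp: continuous_linear_functional_on_def inner_add_left intro!: continuous_intros)
    have "(\<Sum>j\<in>{j\<in>X. \<kappa> j = k}. im_basis j) \<in> span (range u)" for k
      by (intro span_sum span_base) (auto simp: im_basis_def)
    then show "(\<Sum>j\<in>{j\<in>X. \<kappa> j = k}. im_basis j) \<in> tensor_space u" for k
      unfolding tensor_space_def using closure_subset by blast
  qed (use X in auto)
  have "minimal_error F (tensor_space u) T (card (\<kappa> ` X)) \<le> \<epsilon>"
  proof (rule minimal_error_le[OF subspace_F bounded_linear_T A])
    fix f assume f: "f \<in> F" "norm f \<le> 1"
    have "A f = (\<Sum>k\<in>\<kappa> ` X. \<Sum>j\<in>{j\<in>X. \<kappa> j = k}. (f \<bullet> basis j) *\<^sub>R im_basis j)"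
      unfolding A_def scaleR_sum_right
    proof (intro sum.cong refl)
      fix k j assume k: "k \<in> \<kappa> ` X" and "j \<in> {j\<in>X. \<kappa> j = k}"
      then have j: "j \<in> X" "\<kappa> j = k" by auto
      obtain \<pi> where "\<pi> permutes I" "j = rep k \<circ> \<pi>"
        using \<kappa>[of "rep k" j] rep[OF k] j by (auto simp: X_def)
      then show "(f \<bullet> basis (rep k)) *\<^sub>R im_basis j = (f \<bullet> basis j) *\<^sub>R im_basis j"
        using F_inner_basis_permute[OF f(1), of \<pi> "rep k"] by simp
    qed
    also have "\<dots> = (\<Sum>j\<in>X. (f \<bullet> basis j) *\<^sub>R im_basis j)"
      by (rule sum.group) (use X in auto)
    finally have Af: "A f = (\<Sum>j\<in>X. (f \<bullet> basis j) *\<^sub>R im_basis j)" .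
    have "(norm (T f - A f))\<^sup>2 \<le> \<epsilon>\<^sup>2 * (norm f)\<^sup>2" unfolding Af
      by (rule T_approximation[OF X]) (auto simp: X_def large_idx_def)
    also have "\<dots> \<le> \<epsilon>\<^sup>2" using f(2) by (simp add: mult_left_le power_le_one)
    finally show "norm (T f - A f) \<le> \<epsilon>" using \<epsilon> power2_le_imp_le by fastforce
  qed
  then show ?thesis by (simp add: X_def)
qed

lemma complexity_le:
  assumes "\<epsilon> > 0"
    and "\<And>j k. j \<in> large_idx (\<epsilon>\<^sup>2) \<Longrightarrow> k \<in> large_idx (\<epsilon>\<^sup>2) \<Longrightarrow> \<kappa> j = \<kappa> k \<Longrightarrow>
      \<exists>\<pi>. \<pi> permutes I \<and> k = j \<circ> \<pi>"
  shows "complexity \<epsilon> \<le> card (\<kappa> ` large_idx (\<epsilon>\<^sup>2))"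
  unfolding complexity_def information_complexity_def
  by (rule Least_le, rule minimal_error_le_card[OF assms])

lemma T_span_basis_ge:
  assumes Z: "finite Z" "Z \<subseteq> idx" and s: "s \<ge> 0" "\<And>j. j \<in> Z \<Longrightarrow> s\<^sup>2 \<le> ev j"
    and x: "x \<in> span (basis ` Z)"
  shows "s * norm x \<le> norm (T x)"
proof -
  interpret T: bounded_linear T by (rule bounded_linear_T)
  have inj: "inj_on basis Z"
    by (rule inj_onI) (metis Z(2) basis_inner subsetD zero_neq_one)
  obtain c0 where "x = (\<Sum>v\<in>basis ` Z. c0 v *\<^sub>R v)" using x Z(1) span_finite[of "basis ` Z"] by auto
  moreover define c where "c j = c0 (basis j)" for j
  ultimately have c: "x = (\<Sum>j\<in>Z. c j *\<^sub>R basis j)" by (simp add: sum.reindex[OF inj])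
  have "(s * norm x)\<^sup>2 = (\<Sum>j\<in>Z. (c j)\<^sup>2 * s\<^sup>2)"
    unfolding power_mult_distrib c norm_sum_basis[OF Z] by (simp add: sum_distrib_left mult.commute)
  also have "\<dots> \<le> (\<Sum>j\<in>Z. (c j)\<^sup>2 * ev j)" using s by (intro sum_mono mult_left_mono) auto
  also have "\<dots> = (norm (T x))\<^sup>2" by (simp add: c T.sum T.scaleR T_basis norm_sum_im_basis[OF Z])
  finally show ?thesis by (rule power2_le_imp_le) simp
qed

text \<open>Symmetrising \<open>basis j\<close> for pairwise inequivalent \<open>j\<close> gives
  orthogonal nonzero vectors of \<open>F\<close>. Each is a combination of basis vectors with the
  same \<open>ev\<close>, so \<open>T\<close> stretches their span by at least \<open>s\<close>, and
  too few functionals leave an error of at least \<open>s\<close>.\<close>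

lemma card_le_complexity:
  assumes \<epsilon>: "\<epsilon> > 0" and Y: "finite Y" "Y \<subseteq> large_idx (\<epsilon>\<^sup>2)"
    and ineq: "\<And>j k \<pi>. j \<in> Y \<Longrightarrow> k \<in> Y \<Longrightarrow> \<pi> permutes I \<Longrightarrow> k = j \<circ> \<pi> \<Longrightarrow> j = k"
  shows "card Y \<le> complexity \<epsilon>"
proof (cases "Y = {}")
  case False
  define P where "P = {\<pi>. \<pi> permutes I}"
  have finI: "finite I" using I finite_subset by blast
  have P: "finite P" "id \<in> P" using finite_permutations[OF finI] by (auto simp: P_def permutes_id)
  have Yidx: "Y \<subseteq> idx" using Y by (auto simp: large_idx_def)
  define \<phi> where "\<phi> j = symmetrizer t I (basis j)" for j
  have \<phi>: "\<phi> j = (1 / real (card P)) *\<^sub>R (\<Sum>\<pi>\<in>P. basis (j \<circ> \<pi>))" for j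
    unfolding \<phi>_def symmetrizer_def P_def basis_def
    by (rule arg_cong2[where f = scaleR], simp, rule sum.cong)
       (use perm_operator_props(2)[OF t permutes_subset[OF _ I]] in \<open>auto simp: o_def\<close>)
  have \<phi>F: "\<phi> j \<in> F" for j
  proof -
    have "basis j \<in> tensor_space t" unfolding tensor_space_def basis_def
      by (meson closure_subset rangeI span_base subsetD)
    then show ?thesis by (auto simp: \<phi>_def F_def symmetric_subspace_def)
  qed
  have orth: "\<phi> j \<bullet> \<phi> k = 0" if "j \<in> Y" "k \<in> Y" "j \<noteq> k" for j k
  proof -
    have "basis (j \<circ> \<pi>) \<bullet> basis (k \<circ> \<sigma>) = 0" if "\<pi> \<in> P" "\<sigma> \<in> P" for \<pi> \<sigma>
    proof -
      have p: "\<pi> permutes I" "\<sigma> permutes I" using that by (auto simp: P_def)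
      have "j \<circ> \<pi> \<noteq> k \<circ> \<sigma>"
      proof
        assume eq: "j \<circ> \<pi> = k \<circ> \<sigma>"
        have "k = k \<circ> \<sigma> \<circ> inv \<sigma>" using permutes_inv_o(1)[OF p(2)] by (simp add: o_assoc[symmetric])
        then have "k = j \<circ> (\<pi> \<circ> inv \<sigma>)" using eq by (simp add: o_assoc)
        moreover have "\<pi> \<circ> inv \<sigma> permutes I" using p by (intro permutes_compose permutes_inv)
        ultimately show False using ineq[OF \<open>j \<in> Y\<close> \<open>k \<in> Y\<close>] \<open>j \<noteq> k\<close> by blast
      qed
      then show ?thesis using basis_inner[OF idx_permute[OF _ p(1)] idx_permute[OF _ p(2)], of j k]
        Yidx \<open>j \<in> Y\<close> \<open>k \<in> Y\<close> by auto
    qed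
    then show ?thesis by (simp add: \<phi> inner_sum_left inner_sum_right)
  qed
  \<comment> \<open>No cancellation: all \<open>basis (j \<circ> \<pi>) \<bullet> basis j\<close>
    are 0 or 1, and the identity contributes 1.\<close>
  have \<phi>0: "\<phi> j \<noteq> 0" if "j \<in> Y" for j
  proof -
    have jx: "j \<in> idx" using that Yidx by blast
    have "0 < basis (j \<circ> id) \<bullet> basis j" using basis_inner[OF jx jx] by simp
    also have "\<dots> \<le> (\<Sum>\<pi>\<in>P. basis (j \<circ> \<pi>) \<bullet> basis j)"
    proof (rule member_le_sum)
      fix \<pi> assume "\<pi> \<in> P - {id}"
      then show "0 \<le> basis (j \<circ> \<pi>) \<bullet> basis j"
        using basis_inner[OF idx_permute[OF jx] jx] by (auto simp: P_def)
    qed (fact P)+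
    finally have "0 < real (card P) * (\<phi> j \<bullet> basis j)"
      using P by (auto simp: \<phi> inner_sum_left card_gt_0_iff)
    then show ?thesis by auto
  qed
  have inj: "inj_on \<phi> Y" by (rule inj_onI) (metis orth \<phi>0 inner_eq_zero_iff)
  have ind: "independent (\<phi> ` Y)"
    by (rule pairwise_orthogonal_independent) (use orth \<phi>0 in \<open>auto simp: pairwise_def orthogonal_def\<close>)
  \<comment> \<open>A minimum over the finite \<open>Y\<close>, hence strictly above
    \<open>\<epsilon>\<close>; the strict gap is what contradicts an error of at most
    \<open>\<epsilon>\<close>.\<close>
  define s where "s = sqrt (Min (ev ` Y))"
  have s2: "\<epsilon>\<^sup>2 < Min (ev ` Y)" using Y False by (subst Min_gr_iff) (auto simp: large_idx_def)
  then have s_gt: "\<epsilon> < s" unfolding s_def using \<epsilon> by (simp add: real_less_rsqrt)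
  have "0 \<le> Min (ev ` Y)" using s2 zero_le_power2[of \<epsilon>] by linarith
  then have ss: "s\<^sup>2 = Min (ev ` Y)" unfolding s_def by (rule real_sqrt_pow2)
  define Z where "Z = (\<lambda>(j, \<pi>). j \<circ> \<pi>) ` (Y \<times> P)"
  have Z: "finite Z" "Z \<subseteq> idx" using Y P Yidx idx_permute by (auto simp: Z_def P_def)
  have sZ: "s\<^sup>2 \<le> ev k" if "k \<in> Z" for k
    using that Y(1) by (auto simp: Z_def P_def ss ev_permute)
  have \<phi>Z: "\<phi> ` Y \<subseteq> span (basis ` Z)"
    unfolding \<phi> by (auto simp: Z_def intro!: span_scale span_sum intro: span_base)
  have lower: "s \<le> minimal_error F (tensor_space u) T n" if "n < card Y" for n
  proof (rule minimal_error_ge[OF subspace_F bounded_linear_T _ _ ind])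
    show "tensor_space u \<noteq> {}" unfolding tensor_space_def using span_zero closure_subset by blast
    show "n < card (\<phi> ` Y)" using that inj by (simp add: card_image)
    fix x assume "x \<in> span (\<phi> ` Y)"
    then have "x \<in> span (basis ` Z)" using \<phi>Z span_minimal subspace_span by blast
    then show "s * norm x \<le> norm (T x)" using T_span_basis_ge[OF Z _ sZ] s_gt \<epsilon> by simp
  qed (use Y \<phi>F in auto)
  \<comment> \<open>A \<open>LEAST\<close> satisfies its predicate only if a witness exists;
    labelling every multi-index by itself gives one.\<close>
  have upper: "minimal_error F (tensor_space u) T (complexity \<epsilon>) \<le> \<epsilon>"
    unfolding complexity_def information_complexity_def
  proof (rule LeastI)
    show "minimal_error F (tensor_space u) T (card ((\<lambda>j. j) ` large_idx (\<epsilon>\<^sup>2))) \<le> \<epsilon>"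
      by (rule minimal_error_le_card[OF \<epsilon>]) (use permutes_id in \<open>auto intro!: exI[of _ id]\<close>)
  qed
  show ?thesis
  proof (rule ccontr)
    assume "\<not> ?thesis"
    then have "s \<le> minimal_error F (tensor_space u) T (complexity \<epsilon>)" by (intro lower) simp
    with upper s_gt show False by linarith
  qed
qed simp

end

section \<open>Counting orbits\<close>

text \<open>Multiset equality is the form from which \<open>image_mset_eq_implies_permutes\<close>
  produces the permutation.\<close>

lemma image_mset_eqI_card_fibres:
  fixes f g :: "'a \<Rightarrow> 'b"
  assumes I: "finite I" and eq: "\<And>m. card {i \<in> I. f i = m} = card {i \<in> I. g i = m}"
  shows "image_mset f (mset_set I) = image_mset g (mset_set I)"
proof (rule multiset_eqI)
  fix m
  have "count (image_mset h (mset_set I)) m = card {i \<in> I. h i = m}" for h :: "'a \<Rightarrow> 'b"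
  proof -
    have "{x. x \<in># mset_set I \<and> m = h x} = {i \<in> I. h i = m}" using I by auto
    then have "count (image_mset h (mset_set I)) m = (\<Sum>i\<in>{i \<in> I. h i = m}. count (mset_set I) i)"
      unfolding count_image_mset' by simp
    also have "\<dots> = (\<Sum>i\<in>{i \<in> I. h i = m}. 1)" using I by (intro sum.cong) (auto simp: count_mset_set)
    finally show ?thesis by simp
  qed
  then show "count (image_mset f (mset_set I)) m = count (image_mset g (mset_set I)) m" using eq by simp
qed

lemma prod_fibres:
  fixes w :: "'b \<Rightarrow> real"
  assumes "finite I" "finite M" "\<And>i. i \<in> I \<Longrightarrow> f i \<in> M"
  shows "(\<Prod>i\<in>I. w (f i)) = (\<Prod>m\<in>M. w m ^ card {i \<in> I. f i = m})"
proof -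
  have "(\<Prod>m\<in>M. w m ^ card {i \<in> I. f i = m}) = (\<Prod>m\<in>M. \<Prod>i\<in>{i \<in> I. f i = m}. w (f i))"
    by (rule prod.cong) auto
  also have "\<dots> = (\<Prod>i\<in>I. w (f i))" by (rule prod.group) (use assms in auto)
  finally show ?thesis by simp
qed

lemma sum_powers_le_inverse:
  fixes w :: real
  assumes "0 \<le> w" "w < 1"
  shows "(\<Sum>k\<le>a. w ^ k) \<le> 1 / (1 - w)"
proof -
  have "(\<Sum>k\<le>a. w ^ k) = (1 - w ^ Suc a) / (1 - w)"
    using assms sum_gp0[of w a] by auto
  also have "\<dots> \<le> 1 / (1 - w)" using assms by (intro divide_right_mono) auto
  finally show ?thesis .
qed

text \<open>At most \<open>M - 1\<close> factors have \<open>2 \<le> m \<le> M\<close>, each at most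
  \<open>a + 1\<close>. The others are geometric sums, and the Weierstrass inequality keeps the
  product of their \<open>1 - w m\<close> at least 1/2.\<close>

lemma prod_sum_powers_le:
  fixes w :: "nat \<Rightarrow> real"
  assumes w: "\<And>m. m \<ge> 1 \<Longrightarrow> 0 \<le> w m" "\<And>m. m \<ge> 1 \<Longrightarrow> w m \<le> 1"
    and tail: "(\<Sum>m\<in>{M<..R}. w m) \<le> 1/2"
  shows "(\<Prod>m=2..R. \<Sum>k\<le>a. w m ^ k) \<le> 2 * real (Suc a) ^ (M - 1)"
proof -
  let ?h = "\<lambda>m. \<Sum>k\<le>a. w m ^ k"
  let ?A = "{2..R} \<inter> {..M}" and ?B = "{2..R} \<inter> {M<..}"
  have h0: "0 \<le> ?h m" if "m \<ge> 1" for m using w(1)[OF that] by (simp add: sum_nonneg)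
  have "(\<Prod>m\<in>?A. ?h m) \<le> (\<Prod>m\<in>?A. real (Suc a))"
  proof (rule prod_mono)
    fix m assume "m \<in> ?A"
    then have m: "m \<ge> 1" by auto
    have "?h m \<le> (\<Sum>k\<le>a. 1)" using w m by (intro sum_mono power_le_one) auto
    then show "0 \<le> ?h m \<and> ?h m \<le> real (Suc a)" using h0[OF m] by simp
  qed
  also have "\<dots> \<le> real (Suc a) ^ (M - 1)"
  proof -
    have "card ?A \<le> card {2..M}" by (rule card_mono) auto
    then have "card ?A \<le> M - 1" by simp
    then show ?thesis by (simp add: power_increasing del: of_nat_Suc)
  qed
  finally have A: "(\<Prod>m\<in>?A. ?h m) \<le> real (Suc a) ^ (M - 1)" .
  have sB: "(\<Sum>m\<in>?B. w m) \<le> 1/2"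
  proof -
    have "(\<Sum>m\<in>?B. w m) \<le> (\<Sum>m\<in>{M<..R}. w m)" by (rule sum_mono2) (use w in auto)
    with tail show ?thesis by simp
  qed
  have wB: "w m \<le> 1/2" if "m \<in> ?B" for m
  proof -
    have "w m \<le> (\<Sum>m\<in>?B. w m)" by (rule member_le_sum) (use that w in auto)
    with sB show ?thesis by simp
  qed
  have "(\<Prod>m\<in>?B. ?h m) \<le> (\<Prod>m\<in>?B. 1 / (1 - w m))"
  proof (rule prod_mono)
    fix m assume m: "m \<in> ?B"
    then have "m \<ge> 1" by auto
    then show "0 \<le> ?h m \<and> ?h m \<le> 1 / (1 - w m)"
      using h0 wB[OF m] w(1) by (auto intro: sum_powers_le_inverse)
  qed
  also have "\<dots> = 1 / (\<Prod>m\<in>?B. 1 - w m)" by (simp add: prod_dividef)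
  also have "\<dots> \<le> 2"
  proof -
    have "1 - (\<Sum>m\<in>?B. w m) \<le> (\<Prod>m\<in>?B. 1 - w m)"
      by (rule Weierstrass_prod_ineq) (use w in auto)
    with sB have "1/2 \<le> (\<Prod>m\<in>?B. 1 - w m)" by simp
    then show ?thesis by (simp add: field_simps)
  qed
  finally have B: "(\<Prod>m\<in>?B. ?h m) \<le> 2" .
  have "(\<Prod>m=2..R. ?h m) = (\<Prod>m\<in>?A. ?h m) * (\<Prod>m\<in>?B. ?h m)"
    by (subst prod.union_disjoint[symmetric]) (auto intro!: prod.cong)
  also have "\<dots> \<le> real (Suc a) ^ (M - 1) * 2"
    by (rule mult_mono[OF A B]) (auto intro!: prod_nonneg h0)
  finally show ?thesis by simp
qed

context symmetric_problem
begin

lemma powr_ev: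
  assumes "j \<in> idx"
  shows "ev j powr \<tau> = (\<Prod>i=1..d. lam (j i) powr \<tau>)"
  unfolding ev_def by (subst prod_powr_distrib) (use idx_in[OF assms] in \<open>auto intro: less_imp_le\<close>)

text \<open>
  Modulo permutations of \<open>I\<close>, a multi-index is determined by its entries outside \<open>I\<close> together with the
  multiplicities in \<open>I\<close> of the values \<open>m \<ge> 2\<close>: the multiplicity of the value \<open>1\<close> is what is left.
  Dropping it is what keeps the bound free of powers of \<open>card I\<close> for \<open>lam 1 = 1 > lam 2\<close>.
\<close>

lemma complexity_upper_bound:
  assumes \<epsilon>: "\<epsilon> > 0" and \<tau>: "\<tau> > 0" and lam1: "lam 1 \<le> 1"
    and tail: "\<And>R. (\<Sum>m\<in>{M<..R}. lam m powr \<tau>) \<le> 1/2"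
  shows "real (complexity \<epsilon>) \<le>
    2 * real (Suc (card I)) ^ (M - 1) * (real M + 1/2) ^ (d - card I) * \<epsilon> powr (- 2 * \<tau>)"
proof -
  define w where "w m = lam m powr \<tau>" for m
  have w0: "0 \<le> w m" for m by (simp add: w_def)
  have w1: "w m \<le> 1" if "m \<ge> 1" for m
  proof -
    have "lam m \<le> 1" using lam_antimono[of 1 m] that lam1 by simp
    then show ?thesis using lam_nonneg[OF that] \<tau> by (simp add: w_def powr_le_one_le powr_le1)
  qed
  define X where "X = large_idx (\<epsilon>\<^sup>2)"
  have X: "finite X" "X \<subseteq> idx" using finite_large_idx[of "\<epsilon>\<^sup>2"] \<epsilon> by (auto simp: X_def large_idx_def)
  obtain R where "\<And>N. N \<ge> R \<Longrightarrow> X \<subseteq> idx_upto N" using finite_subset_idx_upto[OF X] by blast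
  then have "X \<subseteq> idx_upto R" by simp
  have XR: "j i \<in> {1..R}" if "j \<in> X" "i \<in> {1..d}" for j i
  proof -
    have "j \<in> {1..d} \<rightarrow>\<^sub>E pos_idx \<inter> {1..R}" using \<open>X \<subseteq> idx_upto R\<close> that(1) unfolding idx_upto_def by blast
    from PiE_mem[OF this that(2)] show ?thesis by simp
  qed
  have finI: "finite I" using I finite_subset by blast
  define c where "c j m = card {i \<in> I. j i = m}" for j :: "nat \<Rightarrow> nat" and m
  define Ic where "Ic = {1..d} - I"
  define \<kappa> where "\<kappa> j = (restrict j Ic, restrict (c j) {2..R})" for j :: "nat \<Rightarrow> nat"
  have csum: "(\<Sum>m\<in>{1..R}. c j m) = card I" if "j \<in> X" for j
  proof -
    have "(\<Sum>m\<in>{1..R}. c j m) = (\<Sum>m\<in>{1..R}. \<Sum>i\<in>{i \<in> I. j i = m}. 1)" by (simp add: c_def)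
    also have "\<dots> = (\<Sum>i\<in>I. 1)" by (rule sum.group) (use finI XR[OF that] I in auto)
    finally show ?thesis by simp
  qed
  have equiv: "\<exists>\<pi>. \<pi> permutes I \<and> k = j \<circ> \<pi>" if j: "j \<in> X" and k: "k \<in> X" and eq: "\<kappa> j = \<kappa> k" for j k
  proof -
    have c2: "c j m = c k m" if "m \<in> {2..R}" for m
    proof -
      have "restrict (c j) {2..R} m = restrict (c k) {2..R} m" using eq by (simp add: \<kappa>_def)
      then show ?thesis using that by simp
    qed
    have c_out: "c j m = 0" if "j \<in> X" "m \<notin> {1..R}" for j m
    proof -
      have "{i \<in> I. j i = m} = {}" using XR[OF that(1)] I that(2) by blast
      then show ?thesis unfolding c_def by (simp only: card.empty)
    qed
    have "c j m = c k m" for m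
    proof (cases "m \<in> {1..R}")
      case True
      have s: "(\<Sum>m\<in>{1..R}. f m) = f 1 + (\<Sum>m\<in>{2..R}. f m)" for f :: "nat \<Rightarrow> nat"
        using True by (subst sum.atLeast_Suc_atMost) (auto simp: numeral_2_eq_2)
      have "c j 1 + (\<Sum>m\<in>{2..R}. c j m) = c k 1 + (\<Sum>m\<in>{2..R}. c k m)"
        using csum[OF j] csum[OF k] unfolding s by simp
      moreover have "(\<Sum>m\<in>{2..R}. c j m) = (\<Sum>m\<in>{2..R}. c k m)" by (rule sum.cong) (use c2 in auto)
      ultimately have "c j 1 = c k 1" by simp
      with c2[of m] True show ?thesis by (cases "m = 1") auto
    qed (simp add: c_out j k)
    then have "image_mset k (mset_set I) = image_mset j (mset_set I)"
      by (intro image_mset_eqI_card_fibres finI) (simp add: c_def)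
    then obtain \<pi> where \<pi>: "\<pi> permutes I" "\<forall>i\<in>I. k i = j (\<pi> i)"
      using image_mset_eq_implies_permutes[OF finI] by blast
    have "k i = j (\<pi> i)" for i
    proof (cases "i \<in> I")
      case False
      have "k i = j i"
      proof (cases "i \<in> {1..d}")
        case True
        then have "i \<in> Ic" using False by (simp add: Ic_def)
        moreover have "restrict j Ic i = restrict k Ic i" using eq by (simp add: \<kappa>_def)
        ultimately show ?thesis by simp
      next
        case False
        have "j \<in> idx" "k \<in> idx" using j k X(2) by blast+
        then show ?thesis using PiE_arb[OF _ False] unfolding idx_def by metis
      qed
      then show ?thesis using permutes_not_in[OF \<pi>(1) False] by simp
    qed (use \<pi> in simp)
    then show ?thesis using \<pi>(1) by (intro exI[of _ \<pi>]) auto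
  qed
  have "complexity \<epsilon> \<le> card (\<kappa> ` X)" unfolding X_def
    by (rule complexity_le[OF \<epsilon>]) (use equiv in \<open>auto simp: X_def\<close>)
  \<comment> \<open>The weight of a label: \<open>W (\<kappa> j)\<close> is the \<tau>-th power of
    \<open>ev j\<close> without the factor from entries 1 inside \<open>I\<close>. That factor is at
    most 1, so dropping it never lowers the weight.\<close>
  define W where "W = (\<lambda>(r, q). (\<Prod>i\<in>Ic. w (r i)) * (\<Prod>m=2..R. w m ^ q m))"
  have W0: "0 \<le> W y" for y by (auto simp: W_def split: prod.split intro!: mult_nonneg_nonneg prod_nonneg zero_le_power w0)
  have W_ge: "\<epsilon> powr (2 * \<tau>) \<le> W (\<kappa> j)" if j: "j \<in> X" for j
  proof -
    have jj: "j \<in> idx" "\<epsilon>\<^sup>2 < ev j" using j by (auto simp: X_def large_idx_def)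
    have "\<epsilon> powr (2 * \<tau>) = (\<epsilon>\<^sup>2) powr \<tau>" using \<epsilon> by (simp add: powr_powr[symmetric])
    also have "\<dots> \<le> ev j powr \<tau>" using jj(2) \<tau> by (intro powr_mono2) auto
    also have "\<dots> = (\<Prod>i=1..d. w (j i))" unfolding w_def by (rule powr_ev[OF jj(1)])
    also have "\<dots> = (\<Prod>i\<in>Ic. w (j i)) * (\<Prod>i\<in>I. w (j i))"
      unfolding Ic_def by (rule prod.subset_diff[OF I]) simp
    also have "(\<Prod>i\<in>I. w (j i)) = (\<Prod>m=1..R. w m ^ c j m)" unfolding c_def
      by (rule prod_fibres) (use finI XR[OF j] I in auto)
    also have "\<dots> \<le> (\<Prod>m=2..R. w m ^ c j m)"
    proof (cases "R \<ge> 1")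
      case True
      have "(\<Prod>m=1..R. w m ^ c j m) = w 1 ^ c j 1 * (\<Prod>m=2..R. w m ^ c j m)"
        using True by (subst prod.atLeast_Suc_atMost) (auto simp: numeral_2_eq_2)
      also have "\<dots> \<le> 1 * (\<Prod>m=2..R. w m ^ c j m)"
        by (intro mult_right_mono power_le_one w0 w1 prod_nonneg ballI zero_le_power) auto
      finally show ?thesis by simp
    qed simp
    also have "(\<Prod>i\<in>Ic. w (j i)) * (\<Prod>m=2..R. w m ^ c j m) = W (\<kappa> j)"
      by (simp add: W_def \<kappa>_def)
    finally show ?thesis by (simp add: mult_left_mono prod_nonneg w0)
  qed
  \<comment> \<open>A box containing the labels of \<open>X\<close>. It may also contain labels of
    no multi-index, but as a product it lets the total weight factorise.\<close>
  let ?B = "(Ic \<rightarrow>\<^sub>E {1..R}) \<times> ({2..R} \<rightarrow>\<^sub>E {..card I})"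
  have sub: "\<kappa> ` X \<subseteq> ?B"
  proof
    fix y assume "y \<in> \<kappa> ` X"
    then obtain j where j: "j \<in> X" "y = \<kappa> j" by blast
    have "c j m \<le> card I" for m unfolding c_def by (rule card_mono[OF finI]) auto
    then show "y \<in> ?B" using j XR[OF j(1)] by (auto simp: \<kappa>_def Ic_def)
  qed
  have finIc: "finite Ic" by (simp add: Ic_def)
  have finB: "finite ?B" using finIc by (intro finite_cartesian_product finite_PiE) auto
  have sum1: "(\<Sum>m=1..R. w m) \<le> real M + 1/2"
  proof -
    have "(\<Sum>m=1..R. w m) \<le> (\<Sum>m\<in>{1..M} \<union> {M<..R}. w m)" by (rule sum_mono2) (auto simp: w0)
    also have "\<dots> = (\<Sum>m=1..M. w m) + (\<Sum>m\<in>{M<..R}. w m)" by (rule sum.union_disjoint) auto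
    also have "(\<Sum>m=1..M. w m) \<le> (\<Sum>m=1..M. 1)" by (rule sum_mono) (use w1 in auto)
    also have "(\<Sum>m\<in>{M<..R}. w m) \<le> 1/2" using tail by (simp add: w_def)
    finally show ?thesis by simp
  qed
  \<comment> \<open>Markov's inequality: every label counted weighs at least
    \<open>\<epsilon> powr (2 * \<tau>)\<close>, so their number is bounded through the total weight
    of the box.\<close>
  have "real (card (\<kappa> ` X)) * \<epsilon> powr (2 * \<tau>) = (\<Sum>y\<in>\<kappa> ` X. \<epsilon> powr (2 * \<tau>))" by simp
  also have "\<dots> \<le> (\<Sum>y\<in>\<kappa> ` X. W y)" by (rule sum_mono) (use W_ge in blast)
  also have "\<dots> \<le> (\<Sum>y\<in>?B. W y)" by (rule sum_mono2[OF finB sub]) (rule W0)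
  also have "\<dots> = (\<Sum>r\<in>Ic \<rightarrow>\<^sub>E {1..R}. \<Prod>i\<in>Ic. w (r i)) * (\<Sum>q\<in>{2..R} \<rightarrow>\<^sub>E {..card I}. \<Prod>m=2..R. w m ^ q m)"
    unfolding W_def by (subst sum.cartesian_product[symmetric]) (simp add: sum_product)
  also have "(\<Sum>r\<in>Ic \<rightarrow>\<^sub>E {1..R}. \<Prod>i\<in>Ic. w (r i)) = (\<Prod>i\<in>Ic. \<Sum>m=1..R. w m)"
    by (rule prod_sum_PiE[symmetric]) (use finIc in auto)
  also have "\<dots> = (\<Sum>m=1..R. w m) ^ (d - card I)"
    using I finI by (simp add: Ic_def card_Diff_subset)
  also have "(\<Sum>q\<in>{2..R} \<rightarrow>\<^sub>E {..card I}. \<Prod>m=2..R. w m ^ q m) = (\<Prod>m=2..R. \<Sum>k\<le>card I. w m ^ k)"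
    by (rule prod_sum_PiE[symmetric]) auto
  also have "(\<Sum>m=1..R. w m) ^ (d - card I) * (\<Prod>m=2..R. \<Sum>k\<le>card I. w m ^ k) \<le>
      (real M + 1/2) ^ (d - card I) * (2 * real (Suc (card I)) ^ (M - 1))"
  proof (rule mult_mono)
    show "(\<Sum>m=1..R. w m) ^ (d - card I) \<le> (real M + 1/2) ^ (d - card I)"
      by (rule power_mono[OF sum1]) (simp add: sum_nonneg w0)
    show "(\<Prod>m=2..R. \<Sum>k\<le>card I. w m ^ k) \<le> 2 * real (Suc (card I)) ^ (M - 1)"
      by (rule prod_sum_powers_le) (use w0 w1 tail in \<open>auto simp: w_def\<close>)
  qed (auto intro!: prod_nonneg sum_nonneg zero_le_power w0)
  finally have "real (card (\<kappa> ` X)) * \<epsilon> powr (2 * \<tau>) \<le>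
      2 * real (Suc (card I)) ^ (M - 1) * (real M + 1/2) ^ (d - card I)" by (simp add: ac_simps)
  then have "real (card (\<kappa> ` X)) * \<epsilon> powr (2 * \<tau>) * \<epsilon> powr (- 2 * \<tau>) \<le>
      2 * real (Suc (card I)) ^ (M - 1) * (real M + 1/2) ^ (d - card I) * \<epsilon> powr (- 2 * \<tau>)"
    by (rule mult_right_mono) simp
  moreover have "\<epsilon> powr (2 * \<tau>) * \<epsilon> powr (- 2 * \<tau>) = 1" using \<epsilon> by (simp flip: powr_add)
  ultimately have "real (card (\<kappa> ` X)) \<le>
      2 * real (Suc (card I)) ^ (M - 1) * (real M + 1/2) ^ (d - card I) * \<epsilon> powr (- 2 * \<tau>)"
    by (simp add: mult.assoc)
  with \<open>complexity \<epsilon> \<le> card (\<kappa> ` X)\<close> show ?thesis by linarith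
qed

section \<open>Lower bounds from explicit multi-indices\<close>

lemma card_lam_le_complexity:
  assumes d: "d = 1" and I: "I = {1}" and \<epsilon>: "\<epsilon> > 0"
  shows "card {m. m \<ge> 1 \<and> \<epsilon>\<^sup>2 < lam m} \<le> complexity \<epsilon>"
proof -
  let ?M = "{m. m \<ge> 1 \<and> \<epsilon>\<^sup>2 < lam m}"
  have "finite ?M" by (rule finite_subset[OF _ finite_lam_ge[of "\<epsilon>\<^sup>2"]]) (use \<epsilon> in auto)
  define f where "f m = (\<lambda>i\<in>{1::nat..d}. m)" for m :: nat
  have f1: "f m 1 = m" for m by (simp add: f_def d)
  have inj: "inj_on f ?M" by (rule inj_onI) (metis f1)
  have "card (f ` ?M) \<le> complexity \<epsilon>"
  proof (rule card_le_complexity[OF \<epsilon>])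
    have "0 < lam m" if "\<epsilon>\<^sup>2 < lam m" for m using that zero_le_power2[of \<epsilon>] by linarith
    then have "f m \<in> idx" if "m \<in> ?M" for m using that by (auto simp: idx_def pos_idx_def f_def)
    moreover have "ev (f m) = lam m" for m unfolding ev_def f_def by (simp add: d)
    ultimately show "f ` ?M \<subseteq> large_idx (\<epsilon>\<^sup>2)" by (auto simp: large_idx_def)
    fix j k \<pi> assume "\<pi> permutes I" "k = j \<circ> \<pi>"
    then show "j = k" by (simp add: I)
  qed (use \<open>finite ?M\<close> in auto)
  with inj show ?thesis by (simp add: card_image)
qed

definition "twos A = (\<lambda>i\<in>{1..d}. if i \<in> A then 2 else 1 :: nat)"

lemma ev_twos:
  assumes "A \<subseteq> {1..d}"
  shows "ev (twos A) = lam 2 ^ card A * lam 1 ^ (d - card A)"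
proof -
  have fin: "finite A" using assms finite_subset by blast
  have "ev (twos A) = (\<Prod>i=1..d. if i \<in> A then lam 2 else lam 1)"
    unfolding ev_def by (rule prod.cong) (auto simp: twos_def)
  also have "\<dots> = (\<Prod>i\<in>A. lam 2) * (\<Prod>i\<in>{1..d} - A. lam 1)"
    by (subst prod.subset_diff[OF assms]) (auto simp: mult.commute intro!: arg_cong2[where f = "(*)"] prod.cong)
  finally show ?thesis using assms fin by (simp add: card_Diff_subset)
qed

lemma twos_in_large_idx:
  assumes "lam 2 > 0" "A \<subseteq> {1..d}" "c < lam 2 ^ card A * lam 1 ^ (d - card A)"
  shows "twos A \<in> large_idx c"
proof -
  have "lam 1 > 0" using lam_antimono[of 1 2] assms(1) by simp
  then show ?thesis using assms ev_twos[OF assms(2)] by (auto simp: large_idx_def idx_def pos_idx_def twos_def)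
qed

text \<open>Permutations of \<open>I\<close> fix the coordinates outside \<open>I\<close> and move
  only entries 1 inside it, so different sets \<open>A\<close> outside \<open>I\<close> give
  different orbits.\<close>

lemma binomial_le_complexity:
  assumes lam: "lam 1 = 1" "lam 2 > 0" and \<epsilon>: "\<epsilon> > 0" "\<epsilon>\<^sup>2 < lam 2 ^ k"
  shows "(d - card I) choose k \<le> complexity \<epsilon>"
proof -
  let ?A = "{A. A \<subseteq> {1..d} - I \<and> card A = k}"
  have finI: "finite I" using I finite_subset by blast
  have recover: "{i \<in> {1..d}. twos A i = 2} = A" if "A \<in> ?A" for A using that by (auto simp: twos_def)
  have "card (twos ` ?A) \<le> complexity \<epsilon>"
  proof (rule card_le_complexity[OF \<epsilon>(1)])
    show "twos ` ?A \<subseteq> large_idx (\<epsilon>\<^sup>2)"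
      using lam \<epsilon>(2) by (auto intro!: twos_in_large_idx)
    fix j k' \<pi> assume "j \<in> twos ` ?A" "k' \<in> twos ` ?A" and \<pi>: "\<pi> permutes I" "k' = j \<circ> \<pi>"
    then obtain A B where A: "A \<in> ?A" "j = twos A" and B: "B \<in> ?A" "k' = twos B" by blast
    show "j = k'"
    proof
      fix i show "j i = k' i"
      proof (cases "i \<in> I")
        case True
        then have "i \<notin> A" "i \<notin> B" "i \<in> {1..d}" using A(1) B(1) I by auto
        then show ?thesis by (simp add: A(2) B(2) twos_def)
      next
        case False
        then show ?thesis using permutes_not_in[OF \<pi>(1)] by (simp add: \<pi>(2))
      qed
    qed
  qed simp
  moreover have "inj_on twos ?A" by (rule inj_on_inverseI[where g = "\<lambda>j. {i \<in> {1..d}. j i = 2}"]) (rule recover)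
  then have "card (twos ` ?A) = card ?A" by (rule card_image)
  moreover have "card ?A = card ({1..d} - I) choose k" by (rule n_subsets) simp
  moreover have "card ({1..d} - I) = d - card I" using I finI by (simp add: card_Diff_subset)
  ultimately show ?thesis by (simp only:)
qed

text \<open>The sum of the entries is invariant under all permutations of the coordinates and equals
  \<open>d + k\<close> here, so the orbits differ whatever \<open>I\<close> is.\<close>

lemma chain_le_complexity:
  assumes lam: "lam 2 > 0" and N: "N \<le> d" and \<epsilon>: "\<epsilon> > 0"
    and gt: "\<And>k. k \<le> N \<Longrightarrow> \<epsilon>\<^sup>2 < lam 2 ^ k * lam 1 ^ (d - k)"
  shows "Suc N \<le> complexity \<epsilon>"
proof -
  define f where "f k = twos {1..k}" for k
  have sum_f: "(\<Sum>i=1..d. f k i) = d + k" if "k \<le> N" for k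
  proof -
    have "(\<Sum>i=1..d. f k i) = (\<Sum>i=1..d. 1 + (if i \<in> {1..k} then 1 else 0))"
      by (rule sum.cong) (auto simp: f_def twos_def)
    also have "\<dots> = d + card ({1..d} \<inter> {1..k})"
      unfolding sum.distrib sum.inter_restrict[OF finite_atLeastAtMost, symmetric] by simp
    also have "{1..d} \<inter> {1..k} = {1..k}" using that N by auto
    finally show ?thesis by simp
  qed
  have "card (f ` {..N}) \<le> complexity \<epsilon>"
  proof (rule card_le_complexity[OF \<epsilon>])
    show "f ` {..N} \<subseteq> large_idx (\<epsilon>\<^sup>2)"
    proof safe
      fix k assume "k \<le> N"
      then show "f k \<in> large_idx (\<epsilon>\<^sup>2)" unfolding f_def
        using gt[of k] N by (intro twos_in_large_idx lam) auto
    qed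
    fix j k \<pi> assume "j \<in> f ` {..N}" "k \<in> f ` {..N}" and \<pi>: "\<pi> permutes I" "k = j \<circ> \<pi>"
    then obtain a b where a: "a \<le> N" "j = f a" and b: "b \<le> N" "k = f b" by auto
    have "(\<Sum>i=1..d. k i) = (\<Sum>i=1..d. j i)"
      using sum.permute[OF permutes_subset[OF \<pi>(1) I], of j] by (simp add: \<pi>(2))
    then have "a = b" using sum_f[OF a(1)] sum_f[OF b(1)] by (simp add: a b)
    then show "j = k" by (simp add: a b)
  qed simp
  moreover have "inj_on f {..N}" by (rule inj_onI) (metis atMost_iff sum_f add_left_cancel)
  ultimately show ?thesis by (simp add: card_image)
qed

end

section \<open>Tractability\<close>

text \<open>\<open>M\<close> counts the eigenvalues equal to 1. All later ones are at most
  \<open>q < 1\<close>, so raising the exponent by \<open>k\<close> multiplies the finite tail sum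
  by at most \<open>q ^ k\<close>, until it drops to 1/2.\<close>

lemma (in singular_system) exists_small_tail_exponent:
  assumes lam1: "lam 1 \<le> 1" and \<tau>0: "\<tau>0 > 0" "in_ell \<tau>0 lam"
  shows "\<exists>M \<tau>. \<tau> > 0 \<and> (\<forall>m. 1 \<le> m \<longrightarrow> m \<le> M \<longrightarrow> lam m = 1) \<and>
    (\<forall>R. (\<Sum>m\<in>{M<..R}. lam m powr \<tau>) \<le> 1/2)"
proof -
  define M where "M = (LEAST M. lam (Suc M) < 1)"
  have "\<exists>M. lam (Suc M) < 1"
  proof -
    obtain B where B: "\<And>m. m \<in> {m. m \<ge> 1 \<and> 1 \<le> lam m} \<Longrightarrow> m \<le> B"
      using finite_lam_ge[OF zero_less_one] unfolding finite_nat_set_iff_bounded_le by blast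
    have "\<not> 1 \<le> lam (Suc B)" using B[of "Suc B"] by auto
    then show ?thesis by (intro exI[of _ B]) simp
  qed
  then have q1: "lam (Suc M) < 1" unfolding M_def by (rule LeastI_ex)
  have ones: "lam m = 1" if "1 \<le> m" "m \<le> M" for m
  proof -
    obtain k where k: "m = Suc k" "k < M" using \<open>1 \<le> m\<close> \<open>m \<le> M\<close> by (cases m) auto
    have "\<not> lam m < 1" using not_less_Least[of k] k unfolding M_def by blast
    moreover have "lam m \<le> lam 1" using lam_antimono[of 1 m] that by simp
    ultimately show ?thesis using lam1 by simp
  qed
  define q where "q = lam (Suc M)"
  have q: "0 \<le> q" "q < 1" using q1 lam_nonneg[of "Suc M"] by (auto simp: q_def)
  define K where "K = infsum (\<lambda>m. \<bar>lam m\<bar> powr \<tau>0) {1..}"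
  have sumK: "(\<Sum>m\<in>{M<..R}. lam m powr \<tau>0) \<le> K" for R
  proof -
    have "(\<Sum>m\<in>{M<..R}. lam m powr \<tau>0) = (\<Sum>m\<in>{M<..R}. \<bar>lam m\<bar> powr \<tau>0)"
      by (rule sum.cong) (use lam_nonneg in auto)
    also have "\<dots> \<le> K" unfolding K_def
      by (rule finite_sum_le_infsum) (use \<tau>0 in \<open>auto simp: in_ell_def\<close>)
    finally show ?thesis .
  qed
  have "K \<ge> 0" using sumK[of 0] by simp
  have "(\<lambda>n. q ^ n * K) \<longlonglongrightarrow> 0 * K" by (intro tendsto_intros LIMSEQ_power_zero) (use q in auto)
  then have "eventually (\<lambda>n. q ^ n * K < 1/2) sequentially" by (intro order_tendstoD(2)[of _ "0 * K"]) auto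
  then obtain n0 where "\<And>n. n \<ge> n0 \<Longrightarrow> q ^ n * K < 1/2" unfolding eventually_sequentially by blast
  then have n: "q ^ Suc n0 * K < 1/2" by (meson le_SucI order_refl)
  define \<tau> where "\<tau> = \<tau>0 + real (Suc n0)"
  show ?thesis
  proof (intro exI[of _ M] exI[of _ \<tau>] conjI allI impI)
    show "\<tau> > 0" using \<tau>0 by (simp add: \<tau>_def)
    show "(\<Sum>m\<in>{M<..R}. lam m powr \<tau>) \<le> 1/2" for R
    proof -
      have "(\<Sum>m\<in>{M<..R}. lam m powr \<tau>) \<le> (\<Sum>m\<in>{M<..R}. q ^ Suc n0 * lam m powr \<tau>0)"
      proof (rule sum_mono)
        fix m assume m: "m \<in> {M<..R}"
        have lm: "0 \<le> lam m" "lam m \<le> q" using m lam_nonneg[of m] lam_antimono[of "Suc M" m] by (auto simp: q_def)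
        have "lam m powr real (Suc n0) \<le> q ^ Suc n0"
        proof (cases "lam m = 0")
          case False
          then have "lam m powr real (Suc n0) = lam m ^ Suc n0" using lm(1) by (intro powr_realpow) simp
          then show ?thesis using lm by (simp add: power_mono del: power_Suc)
        qed (simp add: q)
        then have "lam m powr \<tau>0 * lam m powr real (Suc n0) \<le> lam m powr \<tau>0 * q ^ Suc n0"
          by (rule mult_left_mono) simp
        then show "lam m powr \<tau> \<le> q ^ Suc n0 * lam m powr \<tau>0" by (simp only: \<tau>_def powr_add mult.commute)
      qed
      also have "\<dots> = q ^ Suc n0 * (\<Sum>m\<in>{M<..R}. lam m powr \<tau>0)" by (rule sum_distrib_left[symmetric])
      also have "\<dots> \<le> q ^ Suc n0 * K" by (rule mult_left_mono[OF sumK]) (use q in simp)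
      finally show ?thesis using n by simp
    qed
  qed (use ones in auto)
qed

section \<open>From complexity bounds to tractability and back\<close>

lemma bigo_eventually_bound:
  fixes f g :: "nat \<Rightarrow> real"
  assumes "f \<in> O(g)" "\<And>d. d \<ge> 1 \<Longrightarrow> f d \<le> real d" "\<And>d. d \<ge> 1 \<Longrightarrow> 0 \<le> g d"
  obtains c B where "c > 0" "B \<ge> 0" "\<And>d. d \<ge> 1 \<Longrightarrow> f d \<le> c * g d + B"
proof -
  obtain c where c: "c > 0" "eventually (\<lambda>d. norm (f d) \<le> c * norm (g d)) at_top"
    using landau_o.bigE[OF assms(1)] by blast
  then obtain N where N: "\<And>d. d \<ge> N \<Longrightarrow> norm (f d) \<le> c * norm (g d)"
    unfolding eventually_sequentially by blast
  \<comment> \<open>\<open>g\<close> may vanish (\<open>ln 1 = 0\<close>), so the finitely many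
    \<open>d\<close> below \<open>N\<close> are absorbed by an additive constant.\<close>
  have "f d \<le> c * g d + real N" if d: "d \<ge> 1" for d
  proof (cases "d \<ge> N")
    case True
    then show ?thesis using N[OF True] assms(3)[OF d] by simp
  next
    case False
    have "0 \<le> c * g d" using c(1) assms(3)[OF d] by simp
    then show ?thesis using False assms(2)[OF d] by simp
  qed
  with c(1) show thesis using that[of c "real N"] by simp
qed

text \<open>In both cases \<open>M - 1 = 0\<close>, so the power of \<open>Suc (a d)\<close>
  disappears. The remaining base is 1/2, or it is 3/2 with a bounded exponent.\<close>

lemma strongly_polynomially_tractable_of_bound:
  fixes n :: "real \<Rightarrow> nat \<Rightarrow> nat"
  assumes \<tau>: "\<tau> > 0" and a: "\<And>d. d \<ge> 1 \<Longrightarrow> a d \<le> d"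
    and n: "\<And>\<epsilon> d. 0 < \<epsilon> \<Longrightarrow> d \<ge> 1 \<Longrightarrow> real (n \<epsilon> d) \<le>
      2 * real (Suc (a d)) ^ (M - 1) * (real M + 1/2) ^ (d - a d) * \<epsilon> powr (- 2 * \<tau>)"
    and M: "M = 0 \<or> M = 1 \<and> (\<lambda>d. real d - real (a d)) \<in> O(\<lambda>_. 1)"
  shows "strongly_polynomially_tractable n"
proof -
  have "\<exists>K\<ge>0. \<forall>d\<ge>1. (real M + 1/2) ^ (d - a d) \<le> K"
    using M
  proof
    assume "M = 0"
    then show ?thesis by (intro exI[of _ 1]) (auto intro: power_le_one)
  next
    assume M1: "M = 1 \<and> (\<lambda>d. real d - real (a d)) \<in> O(\<lambda>_. 1)"
    obtain c B where cB: "c > 0" "B \<ge> 0" "\<And>d. d \<ge> 1 \<Longrightarrow> real d - real (a d) \<le> c * 1 + B"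
      using bigo_eventually_bound[of "\<lambda>d. real d - real (a d)" "\<lambda>_. 1"] M1 by auto
    have "(real M + 1/2) ^ (d - a d) \<le> (3/2) powr (c + B)" if d: "d \<ge> 1" for d
    proof -
      have "(real M + 1/2) ^ (d - a d) = (3/2) powr (real (d - a d))" using M1 by (simp add: powr_realpow)
      also have "\<dots> \<le> (3/2) powr (c + B)" using cB(3)[OF d] a[OF d] by (intro powr_mono) (auto simp: of_nat_diff)
      finally show ?thesis .
    qed
    then show ?thesis by (intro exI[of _ "(3/2) powr (c + B)"]) auto
  qed
  then obtain K where K: "K \<ge> 0" "\<And>d. d \<ge> 1 \<Longrightarrow> (real M + 1/2) ^ (d - a d) \<le> K" by blast
  have "M - 1 = 0" using M by auto
  then have n': "real (n \<epsilon> d) \<le> 2 * (real M + 1/2) ^ (d - a d) * \<epsilon> powr (- 2 * \<tau>)" if "0 < \<epsilon>" "d \<ge> 1" for \<epsilon> d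
    using n[OF that] by simp
  \<comment> \<open>The summand 1 keeps the constant positive, as \<open>K\<close> is only known to
    be nonnegative.\<close>
  have "real (n \<epsilon> d) \<le> (2 * K + 1) * \<epsilon> powr (- (2 * \<tau>)) * real d powr 0" if "\<epsilon> \<in> {0<..1}" "d \<ge> 1" for \<epsilon> d
  proof -
    have "real (n \<epsilon> d) \<le> 2 * (real M + 1/2) ^ (d - a d) * \<epsilon> powr (- 2 * \<tau>)" using n' that by simp
    also have "\<dots> \<le> (2 * K + 1) * \<epsilon> powr (- 2 * \<tau>)" by (rule mult_right_mono) (use K(2)[OF that(2)] in auto)
    finally show ?thesis using that(2) by simp
  qed
  then show ?thesis unfolding strongly_polynomially_tractable_def polynomial_bound_def
    using \<tau> K(1) by (intro exI[of _ "2 * K + 1"] exI[of _ "2 * \<tau>"] conjI) auto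
qed

text \<open>Under a logarithmic bound on \<open>d - a d\<close>, a power with this exponent is a
  power of \<open>d\<close>; with \<open>Suc (a d) \<le> 2 * d\<close> the other factor is one as
  well.\<close>

lemma polynomially_tractable_of_bound:
  fixes n :: "real \<Rightarrow> nat \<Rightarrow> nat"
  assumes \<tau>: "\<tau> > 0" and a: "\<And>d. d \<ge> 1 \<Longrightarrow> a d \<le> d"
    and n: "\<And>\<epsilon> d. 0 < \<epsilon> \<Longrightarrow> d \<ge> 1 \<Longrightarrow> real (n \<epsilon> d) \<le>
      2 * real (Suc (a d)) ^ (M - 1) * (real M + 1/2) ^ (d - a d) * \<epsilon> powr (- 2 * \<tau>)"
    and b: "(\<lambda>d. real d - real (a d)) \<in> O(\<lambda>d. ln (real d))"
  shows "polynomially_tractable n"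
proof -
  obtain c B where cB: "c > 0" "B \<ge> 0" "\<And>d. d \<ge> 1 \<Longrightarrow> real d - real (a d) \<le> c * ln (real d) + B"
    using bigo_eventually_bound[OF b] by auto
  \<comment> \<open>\<open>M + 3/2\<close> rather than \<open>M + 1/2\<close>, so that the logarithm
    is nonnegative for \<open>M = 0\<close> too, as monotonicity in the exponent requires.\<close>
  define L where "L = ln (real M + 3/2)"
  have L: "L \<ge> 0" by (simp add: L_def)
  define q where "q = c * L + real (M - 1)"
  define C where "C = 2 * 2 ^ (M - 1) * exp (B * L)"
  have "real (n \<epsilon> d) \<le> C * \<epsilon> powr (- (2 * \<tau>)) * real d powr q" if \<epsilon>: "\<epsilon> \<in> {0<..1}" and d: "d \<ge> 1" for \<epsilon> d
  proof -
    have "(real M + 1/2) ^ (d - a d) \<le> (real M + 3/2) ^ (d - a d)" by (rule power_mono) auto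
    also have "\<dots> = exp (real (d - a d) * L)" by (simp add: L_def exp_of_nat_mult)
    also have "\<dots> \<le> exp ((c * ln (real d) + B) * L)"
      using cB(3)[OF d] a[OF d] L by (simp add: of_nat_diff mult_right_mono)
    also have "\<dots> = exp (B * L) * real d powr (c * L)"
      using d by (simp add: powr_def exp_add[symmetric] algebra_simps)
    finally have 1: "(real M + 1/2) ^ (d - a d) \<le> exp (B * L) * real d powr (c * L)" .
    have "real (Suc (a d)) ^ (M - 1) \<le> (2 * real d) ^ (M - 1)"
      using a[OF d] d by (intro power_mono) auto
    also have "\<dots> = 2 ^ (M - 1) * real d powr real (M - 1)" using d by (simp add: power_mult_distrib powr_realpow)
    finally have 2: "real (Suc (a d)) ^ (M - 1) \<le> 2 ^ (M - 1) * real d powr real (M - 1)" .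
    have "real (Suc (a d)) ^ (M - 1) * (real M + 1/2) ^ (d - a d) \<le>
        (2 ^ (M - 1) * real d powr real (M - 1)) * (exp (B * L) * real d powr (c * L))"
      by (rule mult_mono[OF 2 1]) auto
    then have "2 * real (Suc (a d)) ^ (M - 1) * (real M + 1/2) ^ (d - a d) \<le> C * real d powr q"
      by (simp add: C_def q_def powr_add ac_simps)
    then have "2 * real (Suc (a d)) ^ (M - 1) * (real M + 1/2) ^ (d - a d) * \<epsilon> powr (- 2 * \<tau>)
        \<le> C * real d powr q * \<epsilon> powr (- 2 * \<tau>)" by (rule mult_right_mono) simp
    moreover have "0 < \<epsilon>" using \<epsilon> by simp
    ultimately have "real (n \<epsilon> d) \<le> C * real d powr q * \<epsilon> powr (- 2 * \<tau>)" using n[OF _ d] order_trans by blast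
    then show ?thesis by (simp add: ac_simps)
  qed
  moreover have "C > 0" by (simp add: C_def)
  moreover have "q \<ge> 0" using cB(1) L by (simp add: q_def)
  ultimately show ?thesis unfolding polynomially_tractable_def polynomial_bound_def
    using \<tau> by (intro exI[of _ C] exI[of _ "2 * \<tau>"] conjI exI[of _ q]) auto
qed

lemma powr_square: "x > 0 \<Longrightarrow> (x\<^sup>2) powr r = x powr (2 * r)" for x :: real
  by (simp add: powr_powr[symmetric])

text \<open>
  The binomial coefficients are bounded with rates \<open>\<mu> ^ k\<close>, so summing them against the weights
  \<open>(\<mu> powr (p/2) / 2) ^ k\<close> makes the right-hand side a convergent geometric series.
\<close>

lemma binomial_bounds_imp_log_bound:
  fixes n :: "real \<Rightarrow> nat \<Rightarrow> nat"
  assumes \<mu>: "0 < \<mu>" "\<mu> \<le> 1" and C: "C > 0" and p: "p > 0"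
    and pb: "polynomial_bound n C p q"
    and bin: "\<And>\<epsilon> d k. \<epsilon> > 0 \<Longrightarrow> d \<ge> 1 \<Longrightarrow> \<epsilon>\<^sup>2 < \<mu> ^ k \<Longrightarrow> b d choose k \<le> n \<epsilon> d"
  obtains A D where "A > 0" "\<And>d. d \<ge> 1 \<Longrightarrow> real (b d) \<le> A * (D + q * ln (real d))"
proof -
  define y where "y = \<mu> powr (p/2) / 2"
  have y: "y > 0" using \<mu> by (simp add: y_def)
  define E where "E = C * 2 powr (p/2)"
  have E: "E > 0" using C by (simp add: E_def)
  have main: "(1 + y) ^ b d \<le> 2 * E * real d powr q" if d: "d \<ge> 1" for d
  proof -
    have term_le: "real (b d choose k) * y ^ k \<le> E * real d powr q * (1/2) ^ k" for k
    proof -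
      \<comment> \<open>Halving makes \<open>\<epsilon>\<^sup>2 < \<mu> ^ k\<close> strict; this 2
        is the origin of the factor \<open>2 powr (p/2)\<close> in \<open>E\<close>.\<close>
      define \<epsilon> where "\<epsilon> = sqrt (\<mu> ^ k / 2)"
      have \<epsilon>0: "\<epsilon> > 0" using \<mu> by (simp add: \<epsilon>_def)
      have \<epsilon>2: "\<epsilon>\<^sup>2 = \<mu> ^ k / 2" using \<mu> by (simp add: \<epsilon>_def)
      have "\<mu> ^ k \<le> 1" using \<mu> by (simp add: power_le_one)
      then have "\<epsilon> \<le> 1" by (simp add: \<epsilon>_def)
      have "real (b d choose k) \<le> real (n \<epsilon> d)"
        using bin[OF \<epsilon>0 d, of k] \<epsilon>2 \<mu> by simp
      also have "\<dots> \<le> C * \<epsilon> powr (- p) * real d powr q"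
        using pb \<epsilon>0 \<open>\<epsilon> \<le> 1\<close> d by (auto simp: polynomial_bound_def)
      also have "\<epsilon> powr (- p) = (\<mu> ^ k / 2) powr (- (p/2))"
        unfolding \<epsilon>2[symmetric] powr_square[OF \<epsilon>0] by simp
      also have "\<dots> = 2 powr (p/2) * (\<mu> powr (p/2)) powr (- real k)"
        using \<mu> by (simp add: powr_divide powr_powr powr_minus divide_simps flip: powr_realpow) (simp add: mult.commute)
      finally have "real (b d choose k) * y ^ k \<le>
          (C * (2 powr (p/2) * (\<mu> powr (p/2)) powr (- real k)) * real d powr q) * y ^ k"
        using y by (intro mult_right_mono) auto
      also have "\<dots> = E * real d powr q * (1/2) ^ k"
        using \<mu> by (simp add: E_def y_def power_divide powr_minus powr_realpow)
      finally show ?thesis .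
    qed
    \<comment> \<open>The weighted sum is a binomial expansion, exponential in \<open>b d\<close>,
      so taking logarithms bounds \<open>b d\<close>.\<close>
    have "(1 + y) ^ b d = (\<Sum>k\<le>b d. real (b d choose k) * y ^ k)"
      using binomial_ring[of y 1 "b d"] by (simp add: add.commute)
    also have "\<dots> \<le> (\<Sum>k\<le>b d. E * real d powr q * (1/2) ^ k)" by (rule sum_mono) (rule term_le)
    also have "\<dots> = E * real d powr q * (\<Sum>k\<le>b d. (1/2) ^ k)" by (rule sum_distrib_left[symmetric])
    also have "\<dots> \<le> E * real d powr q * 2"
      using sum_powers_le_inverse[of "1/2" "b d"] E by (intro mult_left_mono) auto
    finally show ?thesis by simp
  qed
  have "real (b d) \<le> 1 / ln (1 + y) * (ln (2 * E) + q * ln (real d))" if d: "d \<ge> 1" for d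
  proof -
    have "real (b d) * ln (1 + y) = ln ((1 + y) ^ b d)" using y by (simp add: ln_realpow)
    also have "\<dots> \<le> ln (2 * E * real d powr q)" using main[OF d] y by (intro ln_mono) auto
    also have "\<dots> = ln (2 * E) + q * ln (real d)" using E d by (simp add: ln_mult ln_powr)
    finally show ?thesis using y by (simp add: field_simps)
  qed
  moreover have "1 / ln (1 + y) > 0" using y by simp
  ultimately show thesis using that by blast
qed

text \<open>For \<open>lam m > 0\<close> and \<open>\<epsilon>\<^sup>2 = lam m / 2\<close> the first
  \<open>m\<close> eigenvalues exceed \<open>\<epsilon>\<^sup>2\<close>, so
  \<open>m \<le> C * \<epsilon> powr (- p)\<close>. Squaring gives \<open>lam m powr p\<close> of
  order \<open>1 / m\<^sup>2\<close>, hence the exponent \<open>p\<close>. The range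
  \<open>\<epsilon> \<le> 1\<close> leaves aside only finitely many \<open>m\<close>.\<close>

lemma in_ell_of_polynomial_bound:
  fixes n :: "real \<Rightarrow> nat \<Rightarrow> nat"
  assumes lam: "\<And>m. m \<ge> 1 \<Longrightarrow> 0 \<le> lam m" "\<And>m k. 1 \<le> m \<Longrightarrow> m \<le> k \<Longrightarrow> lam k \<le> lam m"
    and fin: "\<And>c. c > 0 \<Longrightarrow> finite {m. m \<ge> 1 \<and> c \<le> lam m}"
    and p: "p > 0" and C: "C > 0" and pb: "polynomial_bound n C p q"
    and n: "\<And>\<epsilon>. \<epsilon> > 0 \<Longrightarrow> card {m. m \<ge> 1 \<and> \<epsilon>\<^sup>2 < lam m} \<le> n \<epsilon> 1"
  shows "in_ell p lam"
proof -
  have bound: "\<bar>lam m\<bar> powr p \<le> (2 powr p * C\<^sup>2) * (1 / real m ^ 2)" if m: "m \<ge> 1" and m2: "lam m < 2" for m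
  proof (cases "lam m = 0")
    case False
    then have l0: "lam m > 0" using lam(1)[OF m] by simp
    define \<epsilon> where "\<epsilon> = sqrt (lam m / 2)"
    have \<epsilon>0: "\<epsilon> > 0" using l0 by (simp add: \<epsilon>_def)
    have \<epsilon>2: "\<epsilon>\<^sup>2 = lam m / 2" using l0 by (simp add: \<epsilon>_def)
    have \<epsilon>1: "\<epsilon> \<le> 1" using m2 by (simp add: \<epsilon>_def)
    have finM: "finite {k. k \<ge> 1 \<and> \<epsilon>\<^sup>2 < lam k}"
      by (rule finite_subset[OF _ fin[of "\<epsilon>\<^sup>2"]]) (use \<epsilon>0 in auto)
    have "{1..m} \<subseteq> {k. k \<ge> 1 \<and> \<epsilon>\<^sup>2 < lam k}"
    proof
      fix k assume "k \<in> {1..m}"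
      then have "k \<ge> 1" "lam m \<le> lam k" using lam(2)[of k m] by auto
      then show "k \<in> {k. k \<ge> 1 \<and> \<epsilon>\<^sup>2 < lam k}" using l0 \<epsilon>2 by simp
    qed
    from card_mono[OF finM this] have "m \<le> card {k. k \<ge> 1 \<and> \<epsilon>\<^sup>2 < lam k}" by simp
    also have "\<dots> \<le> n \<epsilon> 1" by (rule n[OF \<epsilon>0])
    finally have "real m \<le> real (n \<epsilon> 1)" by simp
    also have "\<dots> \<le> C * \<epsilon> powr (- p)"
      using pb[unfolded polynomial_bound_def, rule_format, of \<epsilon> 1] \<epsilon>0 \<epsilon>1 by simp
    finally have "real m * \<epsilon> powr p \<le> C" using \<epsilon>0 by (simp add: powr_minus field_simps)
    then have "(real m * \<epsilon> powr p)\<^sup>2 \<le> C\<^sup>2" using m by (intro power_mono) auto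
    moreover have "(\<epsilon> powr p)\<^sup>2 = (lam m / 2) powr p"
      unfolding \<epsilon>2[symmetric] powr_square[OF \<epsilon>0] using \<epsilon>0 by (simp add: power2_eq_square flip: powr_add)
    ultimately have "(real m)\<^sup>2 * (lam m powr p / 2 powr p) \<le> C\<^sup>2"
      using l0 by (simp add: power_mult_distrib powr_divide)
    then show ?thesis using l0 m by (simp add: field_simps)
  qed (simp add: p)
  obtain B where B: "\<And>m. m \<in> {m. m \<ge> 1 \<and> 2 \<le> lam m} \<Longrightarrow> m \<le> B"
    using fin[of 2] unfolding finite_nat_set_iff_bounded_le by auto
  have "summable (\<lambda>m. norm (\<bar>lam m\<bar> powr p))"
  proof (rule summable_comparison_test_ev)
    have "norm (norm (\<bar>lam m\<bar> powr p)) \<le> (2 powr p * C\<^sup>2) * (1 / real m ^ 2)" if "m \<ge> Suc B" for m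
    proof -
      have "lam m < 2" using B[of m] that by fastforce
      then show ?thesis using bound[of m] that by simp
    qed
    then show "eventually (\<lambda>m. norm (norm (\<bar>lam m\<bar> powr p)) \<le> (2 powr p * C\<^sup>2) * (1 / real m ^ 2)) sequentially"
      unfolding eventually_sequentially by blast
    show "summable (\<lambda>m. (2 powr p * C\<^sup>2) * (1 / real m ^ 2))"
      by (intro summable_mult) (use inverse_power_summable[of 2, where 'a = real] in \<open>simp add: divide_inverse\<close>)
  qed
  then have "(\<lambda>m. \<bar>lam m\<bar> powr p) summable_on UNIV" by (rule norm_summable_imp_summable_on)
  then show ?thesis unfolding in_ell_def by (rule summable_on_subset_banach) simp
qed

theorem theorem5:
  fixes S :: "'h::{real_inner, complete_space} \<Rightarrow> 'g::{real_inner, complete_space}"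
    and lam :: "nat \<Rightarrow> real"
    and tH :: "nat \<Rightarrow> (nat \<Rightarrow> 'h) \<Rightarrow> 'k::{real_inner, complete_space}"
    and tG :: "nat \<Rightarrow> (nat \<Rightarrow> 'g) \<Rightarrow> 'l::{real_inner, complete_space}"
    and I :: "nat \<Rightarrow> nat set"
  assumes "compact_operator S"
    and "eigenvalue_sequence (adjoint S \<circ> S) lam"
    and "lam 2 > 0"
    and "\<And>d. d \<ge> 1 \<Longrightarrow> tensor_map d (tH d)"
    and "\<And>d. d \<ge> 1 \<Longrightarrow> tensor_map d (tG d)"
    and "I 1 = {1}"
    and "\<And>d. d > 1 \<Longrightarrow> I d \<noteq> {} \<and> I d \<subseteq> {1..d}"
  shows "(strongly_polynomially_tractable (symmetric_problem_complexity tH tG S I) \<longleftrightarrow>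
            (\<exists>\<tau>>0. in_ell \<tau> lam) \<and>
            (lam 1 < 1 \<or>
             (1 = lam 1 \<and> lam 1 > lam 2 \<and>
              (\<lambda>d. real d - real (card (I d))) \<in> O(\<lambda>_. 1)))) \<and>
         (lam 1 \<le> 1 \<longrightarrow>
           (polynomially_tractable (symmetric_problem_complexity tH tG S I) \<longleftrightarrow>
              (\<exists>\<tau>>0. in_ell \<tau> lam) \<and>
              (lam 1 < 1 \<or>
               (lam 1 = 1 \<and> (\<lambda>d. real d - real (card (I d))) \<in> O(\<lambda>d. ln (real d))))))"
proof -
  define n where "n = symmetric_problem_complexity tH tG S I"
  define a where "a d = card (I d)" for d
  obtain e where sing: "singular_system S lam e" using singular_system_exists[OF assms(1,2)] by blast
  interpret sg: singular_system S lam e by (rule sing)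
  have Isub: "I d \<subseteq> {1..d}" if "d \<ge> 1" for d using assms(6) assms(7)[of d] that by (cases "d = 1") auto
  have sp: "symmetric_problem S lam e d (tH d) (tG d) (I d)" if "d \<ge> 1" for d
    by (intro symmetric_problem.intro tensor_problem.intro tensor_problem_axioms.intro
        symmetric_problem_axioms.intro sing that assms(4,5) Isub)
  have n_eq: "n \<epsilon> d = symmetric_problem.complexity S (tH d) (tG d) (I d) \<epsilon>" if "d \<ge> 1" for \<epsilon> d
  proof -
    interpret symmetric_problem S lam e d "tH d" "tG d" "I d" by (rule sp[OF that])
    show ?thesis by (simp add: n_def symmetric_problem_complexity_def complexity_def F_def T_def)
  qed
  have a_le: "a d \<le> d" if "d \<ge> 1" for d
    using card_mono[OF _ Isub[OF that]] by (simp add: a_def)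

  have upper: "real (n \<epsilon> d) \<le>
      2 * real (Suc (a d)) ^ (M - 1) * (real M + 1/2) ^ (d - a d) * \<epsilon> powr (- 2 * \<tau>)"
    if "lam 1 \<le> 1" "\<tau> > 0" "\<And>R. (\<Sum>m\<in>{M<..R}. lam m powr \<tau>) \<le> 1/2" "0 < \<epsilon>" "d \<ge> 1" for M \<tau> \<epsilon> d
    using symmetric_problem.complexity_upper_bound[OF sp[OF that(5)] that(4,2,1,3)]
    unfolding n_eq[OF that(5)] a_def .

  have ell: "in_ell p lam" if "C > 0" "p > 0" "polynomial_bound n C p q" for C p q
  proof (rule in_ell_of_polynomial_bound[OF sg.lam_nonneg sg.lam_antimono sg.finite_lam_ge that(2,1,3)])
    show "card {m. m \<ge> 1 \<and> \<epsilon>\<^sup>2 < lam m} \<le> n \<epsilon> 1" if "\<epsilon> > 0" for \<epsilon>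
      unfolding n_eq[OF order_refl]
      by (rule symmetric_problem.card_lam_le_complexity[OF sp[OF order_refl] refl assms(6) that])
  qed

  \<comment> \<open>With \<open>q\<close> in front of the logarithm one estimate serves both
    notions: \<open>q = 0\<close> leaves a constant.\<close>
  have log_bound: "\<exists>A D. A > 0 \<and> (\<forall>d\<ge>1. real d - real (a d) \<le> A * (D + q * ln (real d)))"
    if C: "C > 0" "p > 0" "polynomial_bound n C p q" and lam1: "lam 1 = 1" for C p q
  proof -
    have "lam 2 \<le> 1" using sg.lam_antimono[of 1 2] lam1 by simp
    moreover have "d - a d choose k \<le> n \<epsilon> d" if "\<epsilon> > 0" "d \<ge> 1" "\<epsilon>\<^sup>2 < lam 2 ^ k" for \<epsilon> d k
      unfolding n_eq[OF that(2)] a_def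
      by (rule symmetric_problem.binomial_le_complexity[OF sp[OF that(2)] lam1 assms(3) that(1,3)])
    ultimately obtain A D where AD: "A > 0" "\<And>d. d \<ge> 1 \<Longrightarrow> real (d - a d) \<le> A * (D + q * ln (real d))"
      using binomial_bounds_imp_log_bound[OF assms(3) _ C, of "\<lambda>d. d - a d"] by blast
    have "real d - real (a d) \<le> A * (D + q * ln (real d))" if "d \<ge> 1" for d
      using AD(2)[OF that] a_le[OF that] by (simp add: of_nat_diff)
    with AD(1) show ?thesis by blast
  qed

  have strong_lam: "lam 1 < 1 \<or> lam 1 = 1 \<and> lam 2 < 1" if pb: "polynomial_bound n C p 0" for C p
  proof (rule ccontr)
    assume contr: "\<not> ?thesis"
    have l2: "lam 2 \<le> lam 1" using sg.lam_antimono[of 1 2] by simp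
    have l1: "lam 1 \<ge> 1" using contr by auto
    \<comment> \<open>The supposed bound at \<open>\<epsilon> = 1/2\<close>, the same for every
      \<open>d\<close>; the contradiction needs \<open>N + 1\<close> orbits with
      \<open>N > K\<close> for a single \<open>d\<close>.\<close>
    define K where "K = C * (1/2) powr (- p)"
    obtain N where N: "K < real N" using reals_Archimedean2 by blast
    \<comment> \<open>Capping at 1 makes the powers decreasing, so the exponent \<open>N\<close>
      serves for all \<open>k \<le> N\<close>.\<close>
    define \<mu> where "\<mu> = min 1 (lam 2)"
    have \<mu>: "0 < \<mu>" "\<mu> \<le> 1" "\<mu> \<le> lam 2" using assms(3) by (auto simp: \<mu>_def)
    \<comment> \<open>If \<open>lam 1 > 1\<close>, enough extra entries 1 outweigh \<open>N\<close>
      factors \<open>\<mu>\<close>; if \<open>lam 1 = lam 2 = 1\<close>, there is nothing to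
      outweigh.\<close>
    have "\<exists>D. 1 \<le> \<mu> ^ N * lam 1 ^ D"
    proof (cases "lam 1 = 1")
      case True
      then have "lam 2 = 1" using contr l2 by auto
      then show ?thesis using True by (simp add: \<mu>_def)
    next
      case False
      then obtain D where "1 / \<mu> ^ N < lam 1 ^ D" using real_arch_pow[of "lam 1"] l1 by auto
      then show ?thesis using \<mu> by (intro exI[of _ D]) (simp add: field_simps)
    qed
    then obtain D where D: "1 \<le> \<mu> ^ N * lam 1 ^ D" by blast
    define d where "d = Suc (N + D)"
    have d1: "d \<ge> 1" by (simp add: d_def)
    have "Suc N \<le> n (1/2) d" unfolding n_eq[OF d1]
    proof (rule symmetric_problem.chain_le_complexity[OF sp[OF d1] assms(3)])
      fix k assume k: "k \<le> N"
      have "1 \<le> \<mu> ^ N * lam 1 ^ D" by (rule D)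
      also have "\<dots> \<le> lam 2 ^ k * lam 1 ^ (d - k)"
      proof (rule mult_mono)
        have "\<mu> ^ N \<le> \<mu> ^ k" using k \<mu> by (intro power_decreasing) auto
        also have "\<dots> \<le> lam 2 ^ k" using \<mu> by (intro power_mono) auto
        finally show "\<mu> ^ N \<le> lam 2 ^ k" .
        show "lam 1 ^ D \<le> lam 1 ^ (d - k)" using k l1 by (intro power_increasing) (auto simp: d_def)
      qed (use l1 assms(3) in auto)
      finally show "(1/2)\<^sup>2 < lam 2 ^ k * lam 1 ^ (d - k)" by (simp add: power2_eq_square)
    qed (simp_all add: d_def)
    moreover have "real (n (1/2) d) \<le> K"
      using pb[unfolded polynomial_bound_def, rule_format, of "1/2" d] d1 by (simp add: K_def)
    ultimately show False using N by linarith
  qed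

  have b_nonneg: "real d - real (a d) \<ge> 0" if "d \<ge> 1" for d using a_le[OF that] by simp

  have strong_iff: "strongly_polynomially_tractable n \<longleftrightarrow> (\<exists>\<tau>>0. in_ell \<tau> lam) \<and>
      (lam 1 < 1 \<or> (1 = lam 1 \<and> lam 1 > lam 2 \<and> (\<lambda>d. real d - real (a d)) \<in> O(\<lambda>_. 1)))"
    (is "_ \<longleftrightarrow> ?R")
  proof
    assume "strongly_polynomially_tractable n"
    then obtain C p where C: "C > 0" "p > 0" "polynomial_bound n C p 0"
      unfolding strongly_polynomially_tractable_def by blast
    have "(\<lambda>d. real d - real (a d)) \<in> O(\<lambda>_. 1)" if lam1: "lam 1 = 1"
    proof -
      obtain A D where AD: "A > 0" "\<And>d. d \<ge> 1 \<Longrightarrow> real d - real (a d) \<le> A * (D + 0 * ln (real d))"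
        using log_bound[OF C lam1] by blast
      have "norm (real d - real (a d)) \<le> A * D * norm (1::real)" if "d \<ge> 1" for d
        using AD(2)[OF that] b_nonneg[OF that] by simp
      then have "eventually (\<lambda>d. norm (real d - real (a d)) \<le> A * D * norm (1::real)) at_top"
        by (rule eventually_sequentiallyI)
      then show ?thesis by (rule bigoI)
    qed
    moreover have "\<exists>\<tau>>0. in_ell \<tau> lam" using ell[OF C] C(2) by blast
    ultimately show ?R using strong_lam[OF C(3)] by auto
  next
    assume R: ?R
    then have lam1: "lam 1 \<le> 1" by auto
    from R obtain \<tau>0 where \<tau>0: "\<tau>0 > 0" "in_ell \<tau>0 lam" by blast
    obtain M \<tau> where M: "\<tau> > 0" "\<And>m. 1 \<le> m \<Longrightarrow> m \<le> M \<Longrightarrow> lam m = 1"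
      "\<And>R. (\<Sum>m\<in>{M<..R}. lam m powr \<tau>) \<le> 1/2"
      using sg.exists_small_tail_exponent[OF lam1 \<tau>0] by blast
    \<comment> \<open>\<open>M \<noteq> 0\<close> forces \<open>lam 1 = 1\<close>, and
      \<open>M \<ge> 2\<close> would give \<open>lam 2 = 1\<close> against the strict gap in
      \<open>?R\<close>.\<close>
    have Mcases: "M = 0 \<or> M = 1 \<and> (\<lambda>d. real d - real (a d)) \<in> O(\<lambda>_. 1)"
    proof (cases "M = 0")
      case False
      then have 1: "lam 1 = 1" using M(2)[of 1] by simp
      then have "lam 2 < 1" using R by auto
      then have "\<not> 2 \<le> M" using M(2)[of 2] by auto
      with False have "M = 1" by simp
      with R 1 show ?thesis by auto
    qed simp
    show "strongly_polynomially_tractable n"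
      by (rule strongly_polynomially_tractable_of_bound[OF M(1) _ _ Mcases])
        (fact a_le upper[OF lam1 M(1,3)])+
  qed

  have poly_iff: "polynomially_tractable n \<longleftrightarrow> (\<exists>\<tau>>0. in_ell \<tau> lam) \<and>
      (lam 1 < 1 \<or> (lam 1 = 1 \<and> (\<lambda>d. real d - real (a d)) \<in> O(\<lambda>d. ln (real d))))"
    (is "_ \<longleftrightarrow> ?R") if le1: "lam 1 \<le> 1"
  proof
    assume "polynomially_tractable n"
    then obtain C p q where C: "C > 0" "p > 0" "q \<ge> 0" "polynomial_bound n C p q"
      unfolding polynomially_tractable_def by blast
    have "(\<lambda>d. real d - real (a d)) \<in> O(\<lambda>d. ln (real d))" if lam1: "lam 1 = 1"
    proof -
      obtain A D where AD: "A > 0" "\<And>d. d \<ge> 1 \<Longrightarrow> real d - real (a d) \<le> A * (D + q * ln (real d))"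
        using log_bound[OF C(1,2,4) lam1] by blast
      \<comment> \<open>From \<open>d \<ge> 3\<close> on, \<open>ln (real d) \<ge> 1\<close> because
        \<open>exp 1 \<le> 3\<close>; this lets the logarithm absorb the constant
        \<open>D\<close>.\<close>
      have "norm (real d - real (a d)) \<le> (A * (\<bar>D\<bar> + q)) * norm (ln (real d))" if d: "d \<ge> 3" for d
      proof -
        have "ln (exp 1) \<le> ln (real d)" using exp_le d by (intro ln_mono) auto
        then have ln1: "1 \<le> ln (real d)" by simp
        have "D \<le> \<bar>D\<bar> * ln (real d)"
          using mult_left_mono[OF ln1, of "\<bar>D\<bar>"] by simp
        then have "A * (D + q * ln (real d)) \<le> A * ((\<bar>D\<bar> + q) * ln (real d))"
          using AD(1) by (intro mult_left_mono) (auto simp: algebra_simps)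
        with AD(2)[of d] b_nonneg[of d] d ln1 show ?thesis by (simp add: mult.assoc)
      qed
      then have "eventually (\<lambda>d. norm (real d - real (a d)) \<le> (A * (\<bar>D\<bar> + q)) * norm (ln (real d))) at_top"
        by (rule eventually_sequentiallyI)
      then show ?thesis by (rule bigoI)
    qed
    moreover have "\<exists>\<tau>>0. in_ell \<tau> lam" using ell[OF C(1,2,4)] C(2) by blast
    ultimately show ?R using le1 by auto
  next
    assume R: ?R
    then obtain \<tau>0 where \<tau>0: "\<tau>0 > 0" "in_ell \<tau>0 lam" by blast
    obtain M \<tau> where M: "\<tau> > 0" "\<And>m. 1 \<le> m \<Longrightarrow> m \<le> M \<Longrightarrow> lam m = 1"
      "\<And>R. (\<Sum>m\<in>{M<..R}. lam m powr \<tau>) \<le> 1/2"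
      using sg.exists_small_tail_exponent[OF le1 \<tau>0] by blast
    show "polynomially_tractable n"
    proof (cases "lam 1 < 1")
      case True
      have "M = 0" using M(2)[of 1] True by (cases M) auto
      have "strongly_polynomially_tractable n"
        by (rule strongly_polynomially_tractable_of_bound[OF M(1) _ _ disjI1[OF \<open>M = 0\<close>]])
          (fact a_le upper[OF le1 M(1,3)])+
      then show ?thesis
        unfolding strongly_polynomially_tractable_def polynomially_tractable_def by blast
    next
      case False
      with R have b: "(\<lambda>d. real d - real (a d)) \<in> O(\<lambda>d. ln (real d))" by blast
      show ?thesis
        by (rule polynomially_tractable_of_bound[OF M(1) _ _ b]) (fact a_le upper[OF le1 M(1,3)])+
    qed
  qed
  show ?thesis using strong_iff poly_iff unfolding n_def a_def by blast
qed

end
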